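(* Let $\nu_0=\inf_{v\in\mathbb R^3}\sigma(v)$; then $\nu_0=\sigma(u_1)>0$, and the spectrum of $\mathcal L$ in $\mathcal H$ is $$\mathfrak S(\mathcal L)=(-\infty,-\nu_0]\cup\{\lambda_n:n\in I\},$$ where $I\subset\mathbb N$ contains $0$, and $(\lambda_n)_{n\in I}$ is a strictly decreasing family of real isolated eigenvalues of $\mathcal L$ lying in $(-\nu_0,0]$, each of finite algebraic multiplicity, with $\lambda_0=0>\lambda_1>\lambda_2>\cdots$, whose only possible accumulation point is $-\nu_0$. Moreover $0$ is a simple eigenvalue of $\mathcal L$ with eigenspace spanned by $\mathcal M$.
   Context: Fix masses $m,m_1>0$, a constant restitution coefficient $\epsilon\in(0,1)$, a bulk velocity $u_1\in\mathbb R^3$ and a temperature $\vartheta_1>0$. Let $\mathcal M_1(v)=\big(\frac{m_1}{2\pi\vartheta_1}\big)^{3/2}\exp\big(-\frac{m_1|v-u_1|^2}{2\vartheta_1}\big)$. Set $\alpha=\frac{m_1}{m+m_1}$, $\beta=\frac{1-\epsilon}{2}$, $\gamma=\alpha\frac{1-\beta}{1-2\beta}$, $\mu=\frac{1-2\alpha(1-\beta)}{\alpha(1-\beta)}$, $\vartheta^\#=\frac{(1-\alpha)(1-\beta)}{1-\alpha(1-\beta)}\vartheta_1$ and $\mathcal M(v)=\big(\frac{m}{2\pi\vartheta^\#}\big)^{3/2}\exp\big(-\frac{m|v-u_1|^2}{2\vartheta^\#}\big)$. The kernel is $k(v,v')=\big(\frac{m_1}{2\pi\vartheta_1}\big)^{1/2}|v-v'|^{-1}\exp\big\{-\frac{m_1}{8\vartheta_1}\big((1+\mu)|v-v'|+\frac{|v-u_1|^2-|v'-u_1|^2}{|v-v'|}\big)^2\big\}$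 and the collision frequency is $\sigma(v)=\int_{\mathbb R^3\times\mathbb S^2}|(v-w)\cdot n|\mathcal M_1(w)\,dw\,dn$. Let $\mathcal H=L^2(\mathbb R^3,\mathcal M^{-1}(v)dv)$, $\mathscr D(\mathcal L)=\{f\in\mathcal H:\int|f|^2\sigma\mathcal M^{-1}dv<\infty\}$, and $\mathcal Lf(v)=\frac{1}{2\epsilon^2\gamma^2}\int_{\mathbb R^3}k(v,v')f(v')dv'-\sigma(v)f(v)$ (the linear inelastic hard-sphere Boltzmann operator realized in $\mathcal H$).
   Formalization: The domain of L is taken as those f in H with finite integral of |f|²σ/M for which also Lf lies in H; on the domain as literally written, L does not map into H (e.g. f = M^{1/2}(1+|v|)^{-9/4}). *)

theory Defs
  imports "HOL-Analysis.Analysis"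
begin

text \<open>Velocities live in real^3; densities are real-valued; elements of the Hilbert
space H = L^2(R^3, M^{-1} dv) are complex-valued functions (spectrum taken in the
complexification), identified up to Lebesgue-a.e. equality.\<close>

type_synonym vel = "real^3"

definition alpha :: "real \<Rightarrow> real \<Rightarrow> real" where
  "alpha m m1 = m1 / (m + m1)"

definition beta :: "real \<Rightarrow> real" where
  "beta eps = (1 - eps) / 2"

definition gamma :: "real \<Rightarrow> real \<Rightarrow> real \<Rightarrow> real" where
  "gamma m m1 eps = alpha m m1 * (1 - beta eps) / (1 - 2 * beta eps)"

definition mu :: "real \<Rightarrow> real \<Rightarrow> real \<Rightarrow> real" where
  "mu m m1 eps = (1 - 2 * alpha m m1 * (1 - beta eps)) / (alpha m m1 * (1 - beta eps))"

definition theta_sharp :: "real \<Rightarrow> real \<Rightarrow> real \<Rightarrow> real \<Rightarrow> real" where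
  "theta_sharp m m1 eps th1 =
     (1 - alpha m m1) * (1 - beta eps) / (1 - alpha m m1 * (1 - beta eps)) * th1"

definition Maxw1 :: "real \<Rightarrow> vel \<Rightarrow> real \<Rightarrow> vel \<Rightarrow> real" where
  "Maxw1 m1 u1 th1 v = (m1 / (2 * pi * th1)) powr (3/2) * exp (- m1 * (norm (v - u1))\<^sup>2 / (2 * th1))"

definition Maxw :: "real \<Rightarrow> real \<Rightarrow> real \<Rightarrow> vel \<Rightarrow> real \<Rightarrow> vel \<Rightarrow> real" where
  "Maxw m m1 eps u1 th1 v =
     (let ts = theta_sharp m m1 eps th1 in
       (m / (2 * pi * ts)) powr (3/2) * exp (- m * (norm (v - u1))\<^sup>2 / (2 * ts)))"

definition kern :: "real \<Rightarrow> real \<Rightarrow> real \<Rightarrow> vel \<Rightarrow> real \<Rightarrow> vel \<Rightarrow> vel \<Rightarrow> real" where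
  "kern m m1 eps u1 th1 v v' =
     sqrt (m1 / (2 * pi * th1)) / norm (v - v') *
     exp (- (m1 / (8 * th1)) *
          ((1 + mu m m1 eps) * norm (v - v')
           + ((norm (v - u1))\<^sup>2 - (norm (v' - u1))\<^sup>2) / norm (v - v'))\<^sup>2)"

text \<open>Surface (area) measure on the unit sphere S^2 of real^3, defined by the standard
cone construction: sigma_S(A) = 3 * Leb {r x. 0 < r <= 1, x in A}, i.e. the image of
3 * Lebesgue measure on the unit ball under x |-> x/|x|.\<close>

definition sphere_measure :: "vel measure" where
  "sphere_measure =
     distr (density lborel (\<lambda>x. ennreal (3 * indicator (ball 0 1) x))) borel (\<lambda>x. sgn x)"

definition coll_freq :: "real \<Rightarrow> vel \<Rightarrow> real \<Rightarrow> vel \<Rightarrow> real" where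
  "coll_freq m1 u1 th1 v =
     integral\<^sup>L (lborel \<Otimes>\<^sub>M sphere_measure)
       (\<lambda>(w, n). \<bar>(v - w) \<bullet> n\<bar> * Maxw1 m1 u1 th1 w)"

definition inH :: "real \<Rightarrow> real \<Rightarrow> real \<Rightarrow> vel \<Rightarrow> real \<Rightarrow> (vel \<Rightarrow> complex) \<Rightarrow> bool" where
  "inH m m1 eps u1 th1 f \<longleftrightarrow>
     f \<in> borel_measurable lborel \<and>
     integrable lborel (\<lambda>v. (cmod (f v))\<^sup>2 / Maxw m m1 eps u1 th1 v)"

definition Hnorm :: "real \<Rightarrow> real \<Rightarrow> real \<Rightarrow> vel \<Rightarrow> real \<Rightarrow> (vel \<Rightarrow> complex) \<Rightarrow> real" where
  "Hnorm m m1 eps u1 th1 f =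
     sqrt (integral\<^sup>L lborel (\<lambda>v. (cmod (f v))\<^sup>2 / Maxw m m1 eps u1 th1 v))"

definition Lop :: "real \<Rightarrow> real \<Rightarrow> real \<Rightarrow> vel \<Rightarrow> real \<Rightarrow> (vel \<Rightarrow> complex) \<Rightarrow> vel \<Rightarrow> complex" where
  "Lop m m1 eps u1 th1 f v =
     complex_of_real (1 / (2 * eps\<^sup>2 * (gamma m m1 eps)\<^sup>2)) *
       integral\<^sup>L lborel (\<lambda>v'. complex_of_real (kern m m1 eps u1 th1 v v') * f v')
     - complex_of_real (coll_freq m1 u1 th1 v) * f v"

definition inD :: "real \<Rightarrow> real \<Rightarrow> real \<Rightarrow> vel \<Rightarrow> real \<Rightarrow> (vel \<Rightarrow> complex) \<Rightarrow> bool" where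
  "inD m m1 eps u1 th1 f \<longleftrightarrow>
     inH m m1 eps u1 th1 f \<and>
     integrable lborel (\<lambda>v. (cmod (f v))\<^sup>2 * coll_freq m1 u1 th1 v / Maxw m m1 eps u1 th1 v) \<and>
     inH m m1 eps u1 th1 (Lop m m1 eps u1 th1 f)"

text \<open>Resolvent set: L - z : D(L) -> H is bijective (modulo a.e. equality) with bounded inverse.\<close>

definition resolvent_set :: "real \<Rightarrow> real \<Rightarrow> real \<Rightarrow> vel \<Rightarrow> real \<Rightarrow> complex set" where
  "resolvent_set m m1 eps u1 th1 = {z.
     (\<exists>C. \<forall>f. inD m m1 eps u1 th1 f \<longrightarrow>
        Hnorm m m1 eps u1 th1 f \<le> C * Hnorm m m1 eps u1 th1 (\<lambda>v. Lop m m1 eps u1 th1 f v - z * f v)) \<and>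
     (\<forall>g. inH m m1 eps u1 th1 g \<longrightarrow>
        (\<exists>f. inD m m1 eps u1 th1 f \<and> (AE v in lborel. Lop m m1 eps u1 th1 f v - z * f v = g v)))}"

definition spec :: "real \<Rightarrow> real \<Rightarrow> real \<Rightarrow> vel \<Rightarrow> real \<Rightarrow> complex set" where
  "spec m m1 eps u1 th1 = - resolvent_set m m1 eps u1 th1"

definition is_eigenvalue :: "real \<Rightarrow> real \<Rightarrow> real \<Rightarrow> vel \<Rightarrow> real \<Rightarrow> complex \<Rightarrow> bool" where
  "is_eigenvalue m m1 eps u1 th1 z \<longleftrightarrow>
     (\<exists>f. inD m m1 eps u1 th1 f \<and> \<not> (AE v in lborel. f v = 0) \<and>
          (AE v in lborel. Lop m m1 eps u1 th1 f v = z * f v))"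

definition gen_eigvec :: "real \<Rightarrow> real \<Rightarrow> real \<Rightarrow> vel \<Rightarrow> real \<Rightarrow> complex \<Rightarrow> (vel \<Rightarrow> complex) \<Rightarrow> bool" where
  "gen_eigvec m m1 eps u1 th1 z f \<longleftrightarrow>
     (\<exists>(k::nat) (g :: nat \<Rightarrow> vel \<Rightarrow> complex). g 0 = f \<and> inH m m1 eps u1 th1 f \<and>
        (\<forall>j<k. inD m m1 eps u1 th1 (g j) \<and>
               g (Suc j) = (\<lambda>v. Lop m m1 eps u1 th1 (g j) v - z * g j v)) \<and>
        (AE v in lborel. g k v = 0))"

definition finite_alg_mult :: "real \<Rightarrow> real \<Rightarrow> real \<Rightarrow> vel \<Rightarrow> real \<Rightarrow> complex \<Rightarrow> bool" where
  "finite_alg_mult m m1 eps u1 th1 z \<longleftrightarrow>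
     (\<exists>B :: (vel \<Rightarrow> complex) set. finite B \<and>
        (\<forall>f. gen_eigvec m m1 eps u1 th1 z f \<longrightarrow>
           (\<exists>c. AE v in lborel. f v = (\<Sum>b\<in>B. c b * b v))))"

definition isolated_in_spec :: "real \<Rightarrow> real \<Rightarrow> real \<Rightarrow> vel \<Rightarrow> real \<Rightarrow> complex \<Rightarrow> bool" where
  "isolated_in_spec m m1 eps u1 th1 z \<longleftrightarrow>
     z \<in> spec m m1 eps u1 th1 \<and>
     (\<exists>e>0. \<forall>w \<in> spec m m1 eps u1 th1. cmod (w - z) < e \<longrightarrow> w = z)"

end

theory Submission
  imports Defs "HOL-Probability.Distributions" "HOL-Complex_Analysis.Great_Picard"
begin

text \<open>Conjugating with \<open>\<phi> = \<M>\<^bsup>1/2\<^esup>\<close> turns \<open>\<L>\<close> into \<open>K - \<sigma>\<close> on the unweighted \<open>L\<^sup>2\<close>, where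
\<open>K\<close> is an integral operator with a symmetric positive kernel and \<open>K \<phi> = \<sigma> \<phi>\<close>. The kernel has
integrable rows that decay at infinity, so by the Schur test \<open>K\<close> is a norm limit of operators
that are compact by Arzela-Ascoli. For \<open>z\<close> off the half line \<open>(-\<infinity>, -\<nu>\<^sub>0]\<close>, dividing the resolvent
equation by \<open>\<sigma> + z\<close> leaves a Fredholm equation, so the spectrum there consists of eigenvalues;
symmetry makes them real and semisimple, and orthonormal eigenfunctions together with compactness
forbid accumulation away from \<open>-\<nu>\<^sub>0\<close>. On the half line, \<open>\<sigma>\<close> takes the value \<open>-z\<close>, and functions
concentrated near such a point are approximate eigenvectors. Finally, the Dirichlet form
\<open>-2\<langle>\<L>f, f\<rangle> = \<integral>\<integral> k \<phi> \<phi>' |f/\<phi> - f'/\<phi>'|\<^sup>2\<close> is nonnegative and vanishes only on multiples of \<open>\<phi>\<close>,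
which bounds the eigenvalues by \<open>0\<close> and makes \<open>0\<close> simple.\<close>

text \<open>The constants collapse to one parameter: with \<open>p = alpha * (1 - beta)\<close> one
  has \<open>eps * gamma = p\<close>, \<open>1 + mu = (1 - p) / p\<close> and
  \<open>m / (2 * theta_sharp) = m1 / (2 * th1) * (1 + mu)\<close>. The last identity makes the
  cross term of the squared bracket in the kernel cancel against the ratio of square roots of the
  Maxwellian; this is why the conjugated kernel is symmetric. That it maps the square root to its
  multiple by the collision frequency is conservation of mass: integrated over the outgoing
  velocity, in polar coordinates about the incoming one, the exponent becomes minus a positive
  multiple of the square of an affine function of the radius, and the prefactors multiply to 1. The
  obstacle to compactness is that the obvious majorant of the conjugated kernel is translation
  invariant. Decay must come from the difference of energies in the exponent. The Schur norm is the
  geometric mean of a row bound and a column bound, so small rows suffice. Complex functions form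
  only a real inner product space here, with the real part of the Hermitian product; imaginary parts
  are recovered by testing against \<open>\<i> * f\<close>.\<close>

section \<open>Compact operators\<close>

text \<open>Compactness is phrased as the absence of bounded sequences with uniformly separated images.
This is equivalent to total boundedness of the image of the unit ball, and it is the form in
which compactness gets contradicted.\<close>

definition compact_operator :: "('a::real_normed_vector \<Rightarrow> 'b::real_normed_vector) \<Rightarrow> bool" where
  "compact_operator T \<longleftrightarrow>
     (\<forall>e>0. \<forall>x::nat \<Rightarrow> 'a. (\<forall>n. norm (x n) \<le> 1) \<longrightarrow> (\<exists>i j. i < j \<and> norm (T (x i) - T (x j)) < e))"

lemma compact_operatorD:
  assumes "compact_operator T" "e > 0" "\<And>n. norm (x n) \<le> 1"
  obtains i j :: nat where "i < j" "norm (T (x i) - T (x j)) < e"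
proof -
  have "\<exists>i j. i < j \<and> norm (T (x i) - T (x j)) < e"
    using assms(1)[unfolded compact_operator_def, rule_format, OF assms(2), of x] assms(3) by simp
  then show thesis using that by metis
qed

lemma compact_operator_comp_left:
  fixes T :: "'a::real_normed_vector \<Rightarrow> 'b::real_normed_vector"
  assumes A: "bounded_linear A" and T: "compact_operator T"
  shows "compact_operator (\<lambda>x. A (T x))"
  unfolding compact_operator_def
proof (intro allI impI)
  fix e :: real and x :: "nat \<Rightarrow> 'a"
  assume e: "e > 0" and x: "\<forall>n. norm (x n) \<le> 1"
  obtain B where B: "B > 0" "\<And>u. norm (A u) \<le> norm u * B"
    using bounded_linear.pos_bounded[OF A] by blast
  obtain i j where ij: "i < j" "norm (T (x i) - T (x j)) < e / B"
    using compact_operatorD[OF T, of "e / B" x] e B(1) x by (auto intro: divide_pos_pos)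
  have "norm (A (T (x i)) - A (T (x j))) = norm (A (T (x i) - T (x j)))"
    by (simp add: linear_diff bounded_linear.linear[OF A])
  also have "\<dots> \<le> norm (T (x i) - T (x j)) * B" by (rule B)
  also have "\<dots> < e" using ij(2) B(1) by (simp add: field_simps)
  finally show "\<exists>i j. i < j \<and> norm (A (T (x i)) - A (T (x j))) < e" using ij(1) by blast
qed

text \<open>Without a finite \<open>e\<close>-net one can choose greedily points of the unit ball
  whose images are pairwise at least \<open>e\<close> apart, which is what compactness
  forbids.\<close>

lemma compact_operator_totally_bounded:
  fixes T :: "'a::real_normed_vector \<Rightarrow> 'b::real_normed_vector"
  assumes T: "compact_operator T" and e: "e > 0"
  shows "\<exists>k. finite k \<and> T ` cball 0 1 \<subseteq> (\<Union>x\<in>k. ball x e)"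
proof (rule ccontr)
  assume *: "\<nexists>k. finite k \<and> T ` cball 0 1 \<subseteq> (\<Union>x\<in>k. ball x e)"
  let ?P = "\<lambda>x (n::nat) r. norm r \<le> 1 \<and> (\<forall>i<n. dist (T (x i)) (T r) \<ge> e)"
  have "\<exists>x. \<forall>n. ?P x n (x n)"
  proof (rule dependent_wellorder_choice)
    fix n :: nat and x :: "nat \<Rightarrow> 'a"
    have "finite ((\<lambda>i. T (x i)) ` {..<n})" by simp
    then obtain y where "y \<in> T ` cball 0 1" "y \<notin> (\<Union>z\<in>(\<lambda>i. T (x i)) ` {..<n}. ball z e)"
      using * by blast
    then show "\<exists>r. ?P x n r" by (force simp: not_less)
  qed auto
  then obtain x where x: "\<forall>n. ?P x n (x n)" ..
  then obtain i j where "i < j" "norm (T (x i) - T (x j)) < e"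
    using compact_operatorD[OF T e, of x] by metis
  with x show False by (metis dist_norm not_less)
qed

lemma compact_operator_convergent_subseq:
  fixes T :: "'a::real_normed_vector \<Rightarrow> 'b::banach"
  assumes T: "compact_operator T" and x: "\<And>n. norm (x n) \<le> 1"
  obtains y r where "strict_mono (r :: nat \<Rightarrow> nat)" "(\<lambda>n. T (x (r n))) \<longlonglongrightarrow> y"
proof -
  let ?S = "closure (T ` cball 0 1)"
  have "\<exists>k. finite k \<and> ?S \<subseteq> (\<Union>x\<in>k. ball x e)" if e: "e > 0" for e
  proof -
    obtain k where k: "finite k" "T ` cball 0 1 \<subseteq> (\<Union>x\<in>k. ball x (e/2))"
      using compact_operator_totally_bounded[OF T, of "e/2"] e by auto
    \<comment> \<open>The closure may leave the open balls. A finite union of closed balls of radius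
      \<open>e/2\<close> is closed, hence absorbs it, and still fits into the open balls of radius
      \<open>e\<close>.\<close>
    have "T ` cball 0 1 \<subseteq> (\<Union>x\<in>k. cball x (e/2))"
      using k(2) ball_subset_cball by (meson SUP_mono' order_trans)
    then have "?S \<subseteq> (\<Union>x\<in>k. cball x (e/2))"
      using k(1) by (intro closure_minimal closed_UN) auto
    also have "\<dots> \<subseteq> (\<Union>x\<in>k. ball x e)" using e by fastforce
    finally show ?thesis using k(1) by blast
  qed
  then have "compact ?S"
    by (simp add: compact_eq_totally_bounded complete_eq_closed)
  moreover have "T (x n) \<in> ?S" for n using x[of n] closure_subset by fastforce
  ultimately obtain l r where "strict_mono (r :: nat \<Rightarrow> nat)" "((\<lambda>n. T (x n)) \<circ> r) \<longlonglongrightarrow> l"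
    unfolding compact_def by metis
  then show thesis using that by (simp add: o_def)
qed

section \<open>Riesz theory and the Fredholm alternative\<close>

lemma one_minus_compact_bounded_below:
  fixes T :: "'a::banach \<Rightarrow> 'a"
  assumes lin: "bounded_linear T" and T: "compact_operator T" and inj: "\<And>x. T x = x \<Longrightarrow> x = 0"
  obtains c where "c > 0" "\<And>x. c * norm x \<le> norm (x - T x)"
proof (rule ccontr)
  assume *: "\<not> thesis"
  have "\<exists>x. norm x = 1 \<and> norm (x - T x) < 1 / real (Suc n)" for n
  proof -
    have "0 < 1 / real (Suc n)" by simp
    with * that obtain x where x: "norm (x - T x) < 1 / real (Suc n) * norm x"
      by (meson not_less)
    then have nx: "norm x \<noteq> 0" using inj[of x] by auto
    let ?y = "(1 / norm x) *\<^sub>R x"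
    have "?y - T ?y = (1 / norm x) *\<^sub>R (x - T x)"
      by (simp add: linear_cmul bounded_linear.linear[OF lin] algebra_simps)
    then have "norm (?y - T ?y) = norm (x - T x) / norm x" by simp
    also have "\<dots> < 1 / real (Suc n)" using x nx by (simp add: field_simps)
    finally show ?thesis using nx by (intro exI[of _ ?y]) simp
  qed
  then obtain x where x: "\<And>n. norm (x n) = 1" "\<And>n. norm (x n - T (x n)) < 1 / real (Suc n)"
    by metis
  \<comment> \<open>Along this subsequence \<open>x = (x - T x) + T x\<close> converges as well, so
    the limit is a fixed point of norm 1, against injectivity.\<close>
  obtain y r where r: "strict_mono (r :: nat \<Rightarrow> nat)" and y: "(\<lambda>n. T (x (r n))) \<longlonglongrightarrow> y"
    using compact_operator_convergent_subseq[OF T, of x] x(1) by (metis order_refl)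
  have "(\<lambda>n. x n - T (x n)) \<longlonglongrightarrow> 0"
    by (rule Lim_null_comparison[OF _ LIMSEQ_Suc[OF lim_inverse_n']]) (use x(2) in \<open>auto intro!: eventuallyI less_imp_le\<close>)
  from tendsto_add[OF LIMSEQ_subseq_LIMSEQ[OF this r] y]
  have xr: "(\<lambda>n. x (r n)) \<longlonglongrightarrow> y" by (simp add: o_def)
  have "(\<lambda>n. T (x (r n))) \<longlonglongrightarrow> T y" by (rule bounded_linear.tendsto[OF lin xr])
  then have "T y = y" using y LIMSEQ_unique by blast
  then have "y = 0" by (rule inj)
  moreover have "norm y = 1"
    using tendsto_norm[OF xr] x(1) by (simp add: LIMSEQ_const_iff)
  ultimately show False by simp
qed

text \<open>Take \<open>z0\<close> in \<open>Y\<close> whose distance to \<open>x\<close> is less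
  than twice the infimum and normalise \<open>x - z0\<close>. The factor 2 is the origin of the
  constant 1/2.\<close>

lemma riesz_almost_orthogonal:
  fixes Y :: "'a::real_normed_vector set"
  assumes Y: "subspace Y" "closed Y" and X: "subspace X" "Y \<subseteq> X" and x: "x \<in> X" "x \<notin> Y"
  obtains y where "y \<in> X" "norm y = 1" "\<And>z. z \<in> Y \<Longrightarrow> norm (y - z) \<ge> 1/2"
proof -
  have ne: "Y \<noteq> {}" using subspace_0[OF Y(1)] by auto
  define d where "d = infdist x Y"
  have d: "d > 0"
    using in_closed_iff_infdist_zero[OF Y(2) ne, of x] x(2) infdist_nonneg[of x Y] by (simp add: d_def)
  obtain z0 where z0: "z0 \<in> Y" "norm (x - z0) < 2 * d"
  proof -
    have "\<exists>z\<in>Y. dist x z < 2 * d"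
    proof (rule ccontr)
      assume "\<not> ?thesis"
      then have "2 * d \<le> infdist x Y" unfolding infdist_notempty[OF ne]
        by (intro cINF_greatest[OF ne]) auto
      then show False using d by (simp add: d_def)
    qed
    then show thesis using that by (auto simp: dist_norm)
  qed
  define N where "N = norm (x - z0)"
  have N: "N > 0" using z0 x(2) by (auto simp: N_def)
  show thesis
  proof
    show "(1 / N) *\<^sub>R (x - z0) \<in> X"
      using X z0(1) x(1) by (intro subspace_scale subspace_diff) auto
    show "norm ((1 / N) *\<^sub>R (x - z0)) = 1" using N by (simp add: N_def)
    fix z assume z: "z \<in> Y"
    have "z0 + N *\<^sub>R z \<in> Y" using Y(1) z z0(1) by (intro subspace_add subspace_scale)
    then have "d \<le> norm (x - (z0 + N *\<^sub>R z))"
      unfolding d_def dist_norm[symmetric] by (rule infdist_le)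
    also have "x - (z0 + N *\<^sub>R z) = N *\<^sub>R ((1 / N) *\<^sub>R (x - z0) - z)"
      using N by (simp add: algebra_simps)
    also have "norm \<dots> = N * norm ((1 / N) *\<^sub>R (x - z0) - z)" using N by simp
    finally have "d \<le> N * norm ((1 / N) *\<^sub>R (x - z0) - z)" .
    moreover have "N < 2 * d" using z0 by (simp add: N_def)
    ultimately have "N * (1/2) < N * norm ((1 / N) *\<^sub>R (x - z0) - z)" by linarith
    then show "norm ((1 / N) *\<^sub>R (x - z0) - z) \<ge> 1/2" using N by simp
  qed
qed

text \<open>Injectivity gives a lower bound for \<open>S = 1 - T\<close>, so all iterated ranges
  \<open>R n\<close> are closed. If \<open>S\<close> were not onto, injectivity would make them
  strictly decreasing, and almost orthogonal unit vectors of consecutive ranges would have separated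
  images under \<open>T\<close>.\<close>

theorem fredholm_alternative:
  fixes T :: "'a::banach \<Rightarrow> 'a"
  assumes lin: "bounded_linear T" and T: "compact_operator T" and inj: "\<And>x. T x = x \<Longrightarrow> x = 0"
  obtains c where "c > 0" "\<And>x. c * norm x \<le> norm (x - T x)" "\<And>y. \<exists>x. x - T x = y"
proof -
  obtain c where c: "c > 0" "\<And>x. c * norm x \<le> norm (x - T x)"
    using one_minus_compact_bounded_below[OF assms] by blast
  define S where "S = (\<lambda>x. x - T x)"
  define R where "R n = range (S ^^ n)" for n
  have blS: "bounded_linear S" unfolding S_def by (intro bounded_linear_sub bounded_linear_ident lin)
  have RSuc: "R (Suc n) = S ` R n" for n by (simp add: R_def image_comp)
  have injS: "inj S"
  proof (rule injI)
    fix x y assume "S x = S y"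
    then have "T (x - y) = x - y"
      by (simp add: S_def linear_diff[OF bounded_linear.linear[OF lin]] algebra_simps)
    then show "x = y" using inj[of "x - y"] by simp
  qed
  have sub: "subspace (R n) \<and> complete (R n)" for n
  proof (induction n)
    case 0 then show ?case by (simp add: R_def complete_eq_closed)
  next
    case (Suc n)
    have "complete (S ` R n)"
      by (rule complete_isometric_image[OF c(1) _ blS _]) (use Suc c(2) in \<open>auto simp: S_def\<close>)
    moreover have "subspace (S ` R n)"
      using Suc bounded_linear.linear[OF blS] by (simp add: linear_subspace_image)
    ultimately show ?case by (simp add: RSuc)
  qed
  have mono1: "R (Suc n) \<subseteq> R n" for n
    by (auto simp: R_def funpow_Suc_right simp del: funpow.simps)
  have mono: "R j \<subseteq> R i" if "i \<le> j" for i j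
    using that by (rule lift_Suc_antimono_le[of R, OF mono1])
  have surj: "range S = UNIV"
  proof (rule ccontr)
    assume "range S \<noteq> UNIV"
    then obtain x where x: "x \<notin> range S" by auto
    have "\<exists>y. y \<in> R n \<and> norm y = 1 \<and> (\<forall>z\<in>R (Suc n). norm (y - z) \<ge> 1/2)" for n
    proof -
      have "(S ^^ n) x \<notin> R (Suc n)"
      proof
        assume "(S ^^ n) x \<in> R (Suc n)"
        then obtain w where "(S ^^ n) x = (S ^^ n) (S w)"
          by (auto simp: R_def funpow_Suc_right simp del: funpow.simps)
        then show False using x inj_fn[OF injS, of n] by (auto dest: injD)
      qed
      moreover have "(S ^^ n) x \<in> R n" by (simp add: R_def)
      moreover have "closed (R (Suc n))" using sub complete_eq_closed by blast
      ultimately show ?thesis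
        using riesz_almost_orthogonal[of "R (Suc n)" "R n" "(S ^^ n) x"] sub mono1[of n] by metis
    qed
    then obtain y where y: "\<And>n. y n \<in> R n" "\<And>n. norm (y n) = 1"
        "\<And>n z. z \<in> R (Suc n) \<Longrightarrow> norm (y n - z) \<ge> 1/2" by metis
    obtain i j where ij: "i < j" "norm (T (y i) - T (y j)) < 1/2"
      using compact_operatorD[OF T, of "1/2" y] y(2) by auto
    have a: "S (y i) \<in> R (Suc i)" "S (y j) \<in> R (Suc j)" using y(1) by (auto simp: RSuc)
    \<comment> \<open>\<open>T (y i) - T (y j)\<close> is \<open>y i\<close> minus this vector, and
      the vector lies in \<open>R (Suc i)\<close>, from which \<open>y i\<close> keeps distance
      1/2.\<close>
    have "S (y i) + y j - S (y j) \<in> R (Suc i)"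
      using a mono[of "Suc i" j] mono[of "Suc i" "Suc j"] y(1)[of j] ij(1) sub[of "Suc i"]
      by (intro subspace_diff subspace_add) auto
    from y(3)[OF this] ij(2) show False by (simp add: S_def)
  qed
  show thesis by (rule that[OF c]) (metis S_def surj rangeE UNIV_I)
qed

text \<open>Otherwise the Gram-Schmidt process never stops and yields an orthonormal sequence of
  fixed points. These are their own images and lie at mutual distance \<open>sqrt 2\<close>.\<close>

lemma compact_operator_fixed_points_finite_dim:
  fixes T :: "'a::real_inner \<Rightarrow> 'a"
  assumes lin: "linear T" and T: "compact_operator T"
  obtains B where "finite B" "{x. T x = x} \<subseteq> span B"
proof (rule ccontr)
  assume *: "\<not> thesis"
  let ?P = "\<lambda>y (n::nat) r. T r = r \<and> norm r = 1 \<and> (\<forall>i<n. y i \<bullet> r = 0)"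
  have "\<exists>y. \<forall>n. ?P y n (y n)"
  proof (rule dependent_wellorder_choice)
    fix n :: nat and y :: "nat \<Rightarrow> 'a"
    assume IH: "\<And>i. i < n \<Longrightarrow> ?P y i (y i)"
    have orth: "y i \<bullet> y j = (if i = j then 1 else 0)" if "i < n" "j < n" for i j
      using IH that by (metis dot_square_norm inner_commute nat_neq_iff power_one)
    have "finite (y ` {..<n})" by simp
    with * that obtain x where x: "T x = x" "x \<notin> span (y ` {..<n})" by blast
    define w where "w = x - (\<Sum>i<n. (y i \<bullet> x) *\<^sub>R y i)"
    have "(\<Sum>i<n. (y i \<bullet> x) *\<^sub>R y i) \<in> span (y ` {..<n})"
      by (intro span_sum span_scale span_base) auto
    then have w0: "w \<noteq> 0" using x(2) by (auto simp: w_def)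
    have Tw: "T w = w"
      using IH x(1) by (simp add: w_def linear_diff[OF lin] linear_sum[OF lin] linear_cmul[OF lin])
    have "y j \<bullet> w = 0" if "j < n" for j
    proof -
      have "y j \<bullet> w = y j \<bullet> x - (\<Sum>i<n. (y i \<bullet> x) * (if j = i then 1 else 0))"
        unfolding w_def inner_diff_right inner_sum_right inner_scaleR_right using orth that by simp
      then show ?thesis using that by (simp add: sum.delta if_distrib cong: if_cong)
    qed
    then show "\<exists>r. ?P y n r"
      using Tw w0 by (intro exI[of _ "(1 / norm w) *\<^sub>R w"]) (simp add: linear_cmul[OF lin])
  qed auto
  then obtain y where "\<forall>n. ?P y n (y n)" ..
  then have y: "T (y n) = y n" "norm (y n) = 1" "i < n \<Longrightarrow> y i \<bullet> y n = 0" for i n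
    by simp_all
  obtain i j where ij: "i < j" "norm (T (y i) - T (y j)) < 1"
    using compact_operatorD[OF T, of 1 y] y(2) by auto
  have "(norm (y i - y j))\<^sup>2 = 2"
    using y(2)[of i] y(2)[of j] y(3)[OF ij(1)]
    by (simp add: power2_norm_eq_inner inner_diff_left inner_diff_right inner_commute norm_eq_1)
  moreover have "(norm (y i - y j))\<^sup>2 < 1"
    using ij(2) y(1) by (simp add: power_less_one_iff abs_square_less_1)
  ultimately show False by simp
qed

section \<open>The Hilbert space of square integrable functions\<close>

definition square_integrable :: "('a::euclidean_space \<Rightarrow> 'b::euclidean_space) \<Rightarrow> bool" where
  "square_integrable f \<longleftrightarrow> f \<in> borel_measurable borel \<and> integrable lborel (\<lambda>x. (norm (f x))\<^sup>2)"

lemma square_integrable_measurable [measurable_dest]: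
  "square_integrable f \<Longrightarrow> f \<in> borel_measurable borel"
  by (simp add: square_integrable_def)

lemma square_integrable_iff_nn:
  "square_integrable f \<longleftrightarrow> f \<in> borel_measurable borel \<and> (\<integral>\<^sup>+x. ennreal ((norm (f x))\<^sup>2) \<partial>lborel) < \<infinity>"
  by (auto simp: square_integrable_def integrable_iff_bounded)

lemma square_integrable_nn_integral:
  assumes "square_integrable f"
  shows "(\<integral>\<^sup>+x. ennreal ((norm (f x))\<^sup>2) \<partial>lborel) = ennreal (\<integral>x. (norm (f x))\<^sup>2 \<partial>lborel)"
  using assms by (intro nn_integral_eq_integral) (auto simp: square_integrable_def)

lemma square_integrable_inner:
  assumes f: "square_integrable f" and g: "square_integrable g"
  shows "integrable lborel (\<lambda>x. norm (f x) * norm (g x))" "integrable lborel (\<lambda>x. f x \<bullet> g x)"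
proof -
  have [measurable]: "f \<in> borel_measurable borel" "g \<in> borel_measurable borel"
    using f g by (auto simp: square_integrable_def)
  have i: "integrable lborel (\<lambda>x. (norm (f x))\<^sup>2 + (norm (g x))\<^sup>2)"
    using f g by (auto simp: square_integrable_def)
  have *: "norm (f x) * norm (g x) \<le> (norm (f x))\<^sup>2 + (norm (g x))\<^sup>2" for x
    using sum_squares_bound[of "norm (f x)" "norm (g x)"] mult_nonneg_nonneg[of "norm (f x)" "norm (g x)"]
    by (simp del: mult_nonneg_nonneg) 
  show "integrable lborel (\<lambda>x. norm (f x) * norm (g x))"
    by (rule Bochner_Integration.integrable_bound[OF i]) (use * in auto)
  show "integrable lborel (\<lambda>x. f x \<bullet> g x)"
    by (rule Bochner_Integration.integrable_bound[OF i])
       (use * Cauchy_Schwarz_ineq2 in \<open>auto intro!: order_trans[OF Cauchy_Schwarz_ineq2]\<close>)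
qed

lemma square_integrable_zero [simp]: "square_integrable (\<lambda>x. 0)"
  by (simp add: square_integrable_def)

lemma square_integrable_scaleR:
  "square_integrable f \<Longrightarrow> square_integrable (\<lambda>x. c *\<^sub>R f x)"
  by (auto simp: square_integrable_def power_mult_distrib)

lemma square_integrable_add:
  assumes f: "square_integrable f" and g: "square_integrable g"
  shows "square_integrable (\<lambda>x. f x + g x)"
proof -
  have "integrable lborel (\<lambda>x. (norm (f x))\<^sup>2 + 2 * (f x \<bullet> g x) + (norm (g x))\<^sup>2)"
    using f g square_integrable_inner(2)[OF f g] by (auto simp: square_integrable_def)
  also have "(\<lambda>x. (norm (f x))\<^sup>2 + 2 * (f x \<bullet> g x) + (norm (g x))\<^sup>2) = (\<lambda>x. (norm (f x + g x))\<^sup>2)"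
    by (simp add: power2_norm_eq_inner inner_add_left inner_add_right inner_commute algebra_simps)
  finally show ?thesis using f g by (auto simp: square_integrable_def)
qed

lemma square_integrable_uminus:
  "square_integrable f \<Longrightarrow> square_integrable (\<lambda>x. - f x)"
  by (auto simp: square_integrable_def)

lemma square_integrable_diff:
  "square_integrable f \<Longrightarrow> square_integrable g \<Longrightarrow> square_integrable (\<lambda>x. f x - g x)"
  using square_integrable_add[of f "\<lambda>x. - g x"] square_integrable_uminus[of g] by simp

lemma square_integrable_bound:
  assumes f: "square_integrable f" and g: "g \<in> borel_measurable borel"
    and le: "AE x in lborel. norm (g x) \<le> C * norm (f x)"
  shows "square_integrable g"
proof -
  have i: "integrable lborel (\<lambda>x. C\<^sup>2 * (norm (f x))\<^sup>2)" using f by (auto simp: square_integrable_def)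
  have "integrable lborel (\<lambda>x. (norm (g x))\<^sup>2)"
  proof (rule Bochner_Integration.integrable_bound[OF i])
    show "AE x in lborel. norm ((norm (g x))\<^sup>2) \<le> norm (C\<^sup>2 * (norm (f x))\<^sup>2)"
      using le by eventually_elim (simp add: power_mono flip: power_mult_distrib)
  qed (use g in auto)
  then show ?thesis using g by (simp add: square_integrable_def)
qed

lemma square_integrable_cong_AE:
  assumes "square_integrable f" "g \<in> borel_measurable borel" "AE x in lborel. f x = g x"
  shows "square_integrable g"
  by (rule square_integrable_bound[of f _ 1]) (use assms in auto)

lemma part_equivp_square_integrable_AE:
  "part_equivp (\<lambda>f g::'a::euclidean_space \<Rightarrow> 'b::euclidean_space.
     square_integrable f \<and> square_integrable g \<and> (AE x in lborel. f x = g x))"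
proof (rule part_equivpI)
  show "\<exists>f::'a \<Rightarrow> 'b. square_integrable f \<and> square_integrable f \<and> (AE x in lborel. f x = f x)"
    by (intro exI[of _ "\<lambda>_. 0"]) simp
  show "symp (\<lambda>f g::'a \<Rightarrow> 'b. square_integrable f \<and> square_integrable g \<and> (AE x in lborel. f x = g x))"
    by (auto intro!: sympI elim: AE_mp)
  show "transp (\<lambda>f g::'a \<Rightarrow> 'b. square_integrable f \<and> square_integrable g \<and> (AE x in lborel. f x = g x))"
  proof (rule transpI, elim conjE, intro conjI)
    fix x y z :: "'a \<Rightarrow> 'b"
    assume "AE t in lborel. x t = y t" "AE t in lborel. y t = z t"
    then show "AE t in lborel. x t = z t" by eventually_elim simp
  qed
qed

quotient_type (overloaded) ('a, 'b) l2 = "'a::euclidean_space \<Rightarrow> 'b::euclidean_space" / partial: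
  "\<lambda>f g. square_integrable f \<and> square_integrable g \<and> (AE x in lborel. f x = g x)"
  by (rule part_equivp_square_integrable_AE)

instantiation l2 :: (euclidean_space, euclidean_space) real_vector
begin

lift_definition zero_l2 :: "('a, 'b) l2" is "\<lambda>x. 0" by simp

lift_definition plus_l2 :: "('a, 'b) l2 \<Rightarrow> ('a, 'b) l2 \<Rightarrow> ('a, 'b) l2" is "\<lambda>f g x. f x + g x"
  by (auto intro: square_integrable_add)

lift_definition minus_l2 :: "('a, 'b) l2 \<Rightarrow> ('a, 'b) l2 \<Rightarrow> ('a, 'b) l2" is "\<lambda>f g x. f x - g x"
  by (auto intro: square_integrable_diff)

lift_definition uminus_l2 :: "('a, 'b) l2 \<Rightarrow> ('a, 'b) l2" is "\<lambda>f x. - f x"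
  by (auto intro: square_integrable_uminus)

lift_definition scaleR_l2 :: "real \<Rightarrow> ('a, 'b) l2 \<Rightarrow> ('a, 'b) l2" is "\<lambda>c f x. c *\<^sub>R f x"
  by (auto intro: square_integrable_scaleR)

instance
proof
  fix a b c :: "('a, 'b) l2" and r s :: real
  show "a + b + c = a + (b + c)"
    by transfer (auto simp: add.assoc intro!: square_integrable_add)
  show "a + b = b + a"
    by transfer (auto simp: add.commute intro!: square_integrable_add)
  show "0 + a = a" by transfer auto
  show "- a + a = 0" by transfer (auto intro!: square_integrable_uminus)
  show "a - b = a + - b"
    by transfer (auto intro!: square_integrable_diff)
  show "r *\<^sub>R (a + b) = r *\<^sub>R a + r *\<^sub>R b"
    by transfer (auto simp: scaleR_right_distrib intro!: square_integrable_add square_integrable_scaleR)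
  show "(r + s) *\<^sub>R a = r *\<^sub>R a + s *\<^sub>R a"
    by transfer (auto simp: scaleR_left_distrib intro!: square_integrable_add square_integrable_scaleR)
  show "r *\<^sub>R s *\<^sub>R a = (r * s) *\<^sub>R a"
    by transfer (auto intro!: square_integrable_scaleR)
  show "1 *\<^sub>R a = a" by transfer auto
qed

end

text \<open>For complex values the inner product of the codomain is the real part of the Hermitian
  product, so this is the real Hilbert space underlying the complex one. Norm, completeness and
  compactness are the same; complex scalars act through multiplication operators.\<close>

instantiation l2 :: (euclidean_space, euclidean_space) real_inner
begin

lift_definition inner_l2 :: "('a, 'b) l2 \<Rightarrow> ('a, 'b) l2 \<Rightarrow> real" is "\<lambda>f g. \<integral>x. f x \<bullet> g x \<partial>lborel"
proof (safe, goal_cases)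
  case (1 f f' g g')
  then show ?case by (intro integral_cong_AE) (auto simp: square_integrable_def)
qed

definition norm_l2 :: "('a, 'b) l2 \<Rightarrow> real" where "norm_l2 x = sqrt (x \<bullet> x)"
definition dist_l2 :: "('a, 'b) l2 \<Rightarrow> ('a, 'b) l2 \<Rightarrow> real" where "dist_l2 x y = norm (x - y)"
definition sgn_l2 :: "('a, 'b) l2 \<Rightarrow> ('a, 'b) l2" where "sgn_l2 x = x /\<^sub>R norm x"
definition uniformity_l2 :: "(('a, 'b) l2 \<times> ('a, 'b) l2) filter"
  where "uniformity_l2 = (INF e\<in>{0<..}. principal {(x, y). dist x y < e})"
definition open_l2 :: "('a, 'b) l2 set \<Rightarrow> bool"
  where "open_l2 U \<longleftrightarrow> (\<forall>x\<in>U. eventually (\<lambda>(x', y). x' = x \<longrightarrow> y \<in> U) uniformity)"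

instance
proof
  fix a b c :: "('a, 'b) l2" and r s :: real
  show "dist a b = norm (a - b)" by (rule dist_l2_def)
  show "sgn a = a /\<^sub>R norm a" by (rule sgn_l2_def)
  show "norm a = sqrt (a \<bullet> a)" by (rule norm_l2_def)
  show "uniformity = (INF e\<in>{0<..}. principal {(x::('a, 'b) l2, y). dist x y < e})" by (rule uniformity_l2_def)
  show "open U = (\<forall>x\<in>U. eventually (\<lambda>(x', y). x' = x \<longrightarrow> y \<in> U) uniformity)" for U :: "('a, 'b) l2 set"
    by (rule open_l2_def)
  show "a \<bullet> b = b \<bullet> a" by transfer (simp add: inner_commute)
  show "(a + b) \<bullet> c = a \<bullet> c + b \<bullet> c"
    by transfer (simp add: inner_add_left square_integrable_inner)
  show "(r *\<^sub>R a) \<bullet> b = r * (a \<bullet> b)" by transfer simp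
  show "0 \<le> a \<bullet> a" by transfer simp
  show "(a \<bullet> a = 0) = (a = 0)"
  proof transfer
    fix f :: "'a \<Rightarrow> 'b"
    assume f: "square_integrable f \<and> square_integrable f \<and> (AE x in lborel. f x = f x)"
    then have "integrable lborel (\<lambda>x. f x \<bullet> f x)" using square_integrable_inner by blast
    then have "(\<integral>x. f x \<bullet> f x \<partial>lborel) = 0 \<longleftrightarrow> (AE x in lborel. f x \<bullet> f x = 0)"
      by (intro integral_nonneg_eq_0_iff_AE) auto
    with f show "((\<integral>x. f x \<bullet> f x \<partial>lborel) = 0) =
       (square_integrable f \<and> square_integrable (\<lambda>x. 0::'b) \<and> (AE x in lborel. f x = 0))"
      by simp
  qed
qed

end

lemma square_integrable_rep_l2: "square_integrable (rep_l2 x)"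
  using Quotient_rep_reflp[OF Quotient_l2] by blast

lemma abs_l2_rep_l2: "abs_l2 (rep_l2 x) = x"
  by (rule Quotient_abs_rep[OF Quotient_l2])

lemma abs_l2_eq_iff:
  "square_integrable f \<Longrightarrow> square_integrable g \<Longrightarrow> abs_l2 f = abs_l2 g \<longleftrightarrow> (AE x in lborel. f x = g x)"
  using Quotient_rel[OF Quotient_l2, of f g] by auto

lemma rep_l2_abs_l2:
  assumes "square_integrable f" shows "AE x in lborel. rep_l2 (abs_l2 f) x = f x"
  using abs_l2_eq_iff[of "rep_l2 (abs_l2 f)" f] assms by (simp add: square_integrable_rep_l2 abs_l2_rep_l2)

lemma l2_cases:
  obtains f where "square_integrable f" "x = abs_l2 f"
  using square_integrable_rep_l2 abs_l2_rep_l2 by metis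

lemma zero_l2_abs: "0 = abs_l2 (\<lambda>x. 0)"
  by (rule zero_l2.abs_eq)

lemma abs_l2_eq_0_iff: "square_integrable f \<Longrightarrow> abs_l2 f = 0 \<longleftrightarrow> (AE x in lborel. f x = 0)"
  by (simp add: zero_l2_abs abs_l2_eq_iff)

lemma abs_l2_add:
  "square_integrable f \<Longrightarrow> square_integrable g \<Longrightarrow> abs_l2 f + abs_l2 g = abs_l2 (\<lambda>x. f x + g x)"
  by (intro plus_l2.abs_eq) auto

lemma abs_l2_diff:
  "square_integrable f \<Longrightarrow> square_integrable g \<Longrightarrow> abs_l2 f - abs_l2 g = abs_l2 (\<lambda>x. f x - g x)"
  by (intro minus_l2.abs_eq) auto

lemma abs_l2_scaleR:
  "square_integrable f \<Longrightarrow> c *\<^sub>R abs_l2 f = abs_l2 (\<lambda>x. c *\<^sub>R f x)"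
  by (intro scaleR_l2.abs_eq) auto

lemma abs_l2_inner:
  "square_integrable f \<Longrightarrow> square_integrable g \<Longrightarrow> abs_l2 f \<bullet> abs_l2 g = (\<integral>x. f x \<bullet> g x \<partial>lborel)"
  by (intro inner_l2.abs_eq) auto

lemma norm_abs_l2:
  "square_integrable f \<Longrightarrow> norm (abs_l2 f) = sqrt (\<integral>x. (norm (f x))\<^sup>2 \<partial>lborel)"
  by (simp add: norm_eq_sqrt_inner abs_l2_inner power2_norm_eq_inner)

lemma norm_abs_l2_nn:
  assumes "square_integrable f"
  shows "(\<integral>\<^sup>+x. ennreal ((norm (f x))\<^sup>2) \<partial>lborel) = ennreal ((norm (abs_l2 f))\<^sup>2)"
  using assms by (simp add: norm_abs_l2 square_integrable_nn_integral)

lemma norm_abs_l2_le_nn: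
  assumes "square_integrable f" "C \<ge> 0" "(\<integral>\<^sup>+x. ennreal ((norm (f x))\<^sup>2) \<partial>lborel) \<le> ennreal (C\<^sup>2)"
  shows "norm (abs_l2 f) \<le> C"
proof (rule power2_le_imp_le)
  show "(norm (abs_l2 f))\<^sup>2 \<le> C\<^sup>2" using assms norm_abs_l2_nn[OF assms(1)] by simp
qed (rule assms)

text \<open>The Riesz-Fischer argument: along a subsequence with geometrically small increments the
  representatives converge almost everywhere, and Fatou's lemma bounds the distance of every member
  from the pointwise limit.\<close>

instance l2 :: (euclidean_space, euclidean_space) banach
proof
  fix X :: "nat \<Rightarrow> ('a, 'b) l2"
  assume C: "Cauchy X"
  have "\<exists>N. \<forall>m\<ge>N. \<forall>n\<ge>N. norm (X m - X n) < (1/2) ^ k" for k :: nat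
    using C by (simp add: Cauchy_iff)
  then obtain N where N: "\<And>k m n. m \<ge> N k \<Longrightarrow> n \<ge> N k \<Longrightarrow> norm (X m - X n) < (1/2) ^ k" by metis
  \<comment> \<open>Summing makes \<open>r\<close> monotone while it stays above each
    \<open>N k\<close>.\<close>
  define r where "r k = (\<Sum>i\<le>k. N i) + k" for k
  have rN: "N k \<le> r k" "r k \<le> r (Suc k)" "k \<le> r k" for k
    by (auto simp: r_def intro!: trans_le_add1 member_le_sum)
  define f where "f k = rep_l2 (X (r k))" for k
  have f: "square_integrable (f k)" "abs_l2 (f k) = X (r k)" for k
    by (auto simp: f_def square_integrable_rep_l2 abs_l2_rep_l2)
  note [measurable] = square_integrable_measurable[OF f(1)]
  define d where "d k x = norm (f (Suc k) x - f k x)" for k x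
  have d_int: "(\<integral>\<^sup>+x. ennreal ((d k x)\<^sup>2) \<partial>lborel) \<le> ennreal ((1/4) ^ k)" for k
  proof -
    have "norm (X (r (Suc k)) - X (r k)) < (1/2) ^ k"
      using N rN by (meson order_trans)
    then have "(norm (X (r (Suc k)) - X (r k)))\<^sup>2 \<le> ((1/2) ^ k)\<^sup>2" by (intro power_mono) auto
    also have "((1/2) ^ k)\<^sup>2 = ((1/4::real) ^ k)"
      unfolding power2_eq_square power_mult_distrib[symmetric] by simp
    finally show ?thesis
      using norm_abs_l2_nn[OF square_integrable_diff[OF f(1) f(1)], of "Suc k" k]
      by (simp add: d_def f(2)[symmetric] abs_l2_diff f(1))
  qed
  text \<open>The weights make the series of squares summable in the mean while still forcing
    summability of the increments themselves.\<close>
  have "(\<integral>\<^sup>+x. (\<Sum>k. ennreal (2 ^ k * (d k x)\<^sup>2)) \<partial>lborel) = (\<Sum>k. \<integral>\<^sup>+x. ennreal (2 ^ k * (d k x)\<^sup>2) \<partial>lborel)"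
    by (rule nn_integral_suminf) (simp add: d_def)
  also have "\<dots> \<le> (\<Sum>k. ennreal ((1/2) ^ k))"
  proof (intro suminf_le)
    fix k
    have "(\<integral>\<^sup>+x. ennreal (2 ^ k * (d k x)\<^sup>2) \<partial>lborel) = ennreal (2 ^ k) * (\<integral>\<^sup>+x. ennreal ((d k x)\<^sup>2) \<partial>lborel)"
      unfolding d_def by (subst nn_integral_cmult[symmetric]) (auto simp: ennreal_mult)
    also have "\<dots> \<le> ennreal (2 ^ k) * ennreal ((1/4) ^ k)" by (intro mult_left_mono d_int) auto
    also have "\<dots> = ennreal ((1/2) ^ k)" by (simp add: ennreal_mult[symmetric] power_mult_distrib[symmetric])
    finally show "(\<integral>\<^sup>+x. ennreal (2 ^ k * (d k x)\<^sup>2) \<partial>lborel) \<le> ennreal ((1/2) ^ k)" .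
  qed auto
  also have "\<dots> < \<infinity>"
    by (subst suminf_ennreal_eq[of _ 2]) (use geometric_sums[of "1/2::real"] in auto)
  finally have "AE x in lborel. (\<Sum>k. ennreal (2 ^ k * (d k x)\<^sup>2)) \<noteq> \<infinity>"
    by (intro nn_integral_PInf_AE) (auto simp: d_def)
  then have conv: "AE x in lborel. convergent (\<lambda>k. f k x)"
  proof eventually_elim
    case (elim x)
    then have "summable (\<lambda>k. 2 ^ k * (d k x)\<^sup>2)" by (intro summable_suminf_not_top) (auto simp: top_ennreal_def)
    then have dsum: "summable (\<lambda>k. 2 ^ k * (d k x)\<^sup>2 + (1/2) ^ k)" by (intro summable_add) auto
    have dle: "norm (d k x) \<le> 2 ^ k * (d k x)\<^sup>2 + (1/2) ^ k" for k
    proof -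
      \<comment> \<open>Completing the square linearises: twice the increment is at most its
        weighted square plus a term of a convergent geometric series.\<close>
      have "0 \<le> 2 ^ k * (d k x - (1/2)^k)\<^sup>2" by simp
      also have "\<dots> = 2 ^ k * (d k x)\<^sup>2 + (1/2) ^ k - 2 * d k x"
        by (simp add: power2_eq_square algebra_simps power_divide)
      finally have "2 * d k x \<le> 2 ^ k * (d k x)\<^sup>2 + (1/2) ^ k" by simp
      moreover have "0 \<le> d k x" by (simp add: d_def)
      ultimately show ?thesis by simp
    qed
    have "summable (\<lambda>k. d k x)" by (rule summable_comparison_test'[OF dsum dle])
    then have "summable (\<lambda>k. f (Suc k) x - f k x)" unfolding d_def by (rule summable_norm_cancel)
    then have "convergent (\<lambda>n. (\<Sum>k<n. f (Suc k) x - f k x))" by (simp add: summable_iff_convergent)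
    then have "convergent (\<lambda>n. f n x - f 0 x)" by (simp add: sum_lessThan_telescope[of "\<lambda>n. f n x"])
    then show ?case by (simp add: convergent_diff_const_right_iff)
  qed
  define g where "g x = lim (\<lambda>k. f k x)" for x
  have [measurable]: "g \<in> borel_measurable borel" unfolding g_def
    by (rule borel_measurable_lim_metric) measurable
  have gk: "square_integrable (\<lambda>x. g x - f k x) \<and> norm (abs_l2 (\<lambda>x. g x - f k x)) \<le> (1/2) ^ k" for k
  proof -
    have "(\<integral>\<^sup>+x. ennreal ((norm (g x - f k x))\<^sup>2) \<partial>lborel)
        = (\<integral>\<^sup>+x. liminf (\<lambda>j. ennreal ((norm (f j x - f k x))\<^sup>2)) \<partial>lborel)"
    proof (rule nn_integral_cong_AE)
      show "AE x in lborel. ennreal ((norm (g x - f k x))\<^sup>2) = liminf (\<lambda>j. ennreal ((norm (f j x - f k x))\<^sup>2))"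
        using conv
      proof eventually_elim
        case (elim x)
        then have "(\<lambda>j. f j x) \<longlonglongrightarrow> g x" by (simp add: g_def convergent_LIMSEQ_iff)
        then have "(\<lambda>j. ennreal ((norm (f j x - f k x))\<^sup>2)) \<longlonglongrightarrow> ennreal ((norm (g x - f k x))\<^sup>2)"
          by (intro tendsto_intros)
        then show ?case by (intro lim_imp_Liminf[symmetric]) auto
      qed
    qed
    also have "\<dots> \<le> liminf (\<lambda>j. \<integral>\<^sup>+x. ennreal ((norm (f j x - f k x))\<^sup>2) \<partial>lborel)"
      by (rule nn_integral_liminf) simp
    also have "\<dots> \<le> liminf (\<lambda>j. ennreal (((1/2) ^ k)\<^sup>2))"
    proof (intro Liminf_mono eventually_sequentiallyI[of k])
      fix j assume "k \<le> j"
      then have "r k \<le> r j" using lift_Suc_mono_le[of r] rN(2) by blast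
      then have "norm (X (r j) - X (r k)) < (1/2) ^ k" using N rN by (meson order_trans)
      then have "(norm (X (r j) - X (r k)))\<^sup>2 \<le> ((1/2) ^ k)\<^sup>2" by (intro power_mono) auto
      then show "(\<integral>\<^sup>+x. ennreal ((norm (f j x - f k x))\<^sup>2) \<partial>lborel) \<le> ennreal (((1/2) ^ k)\<^sup>2)"
        using norm_abs_l2_nn[OF square_integrable_diff[OF f(1) f(1)], of j k]
        by (simp add: f(2)[symmetric] abs_l2_diff f(1))
    qed
    finally have le: "(\<integral>\<^sup>+x. ennreal ((norm (g x - f k x))\<^sup>2) \<partial>lborel) \<le> ennreal (((1/2) ^ k)\<^sup>2)"
      by (simp add: Liminf_const)
    then have sq: "square_integrable (\<lambda>x. g x - f k x)"
      by (auto simp: square_integrable_iff_nn intro: le_less_trans)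
    then show ?thesis using norm_abs_l2_le_nn[OF sq _ le] by simp
  qed
  have g: "square_integrable g"
    using square_integrable_add[OF conjunct1[OF gk[of 0]] f(1)[of 0]] by simp
  have "X \<longlonglongrightarrow> abs_l2 g"
  proof (rule LIMSEQ_I)
    fix e :: real assume "e > 0"
    then obtain k where k: "(1/2) ^ k < e / 2" using real_arch_pow_inv[of "e/2" "1/2"] by auto
    have "norm (X n - abs_l2 g) < e" if "n \<ge> r k" for n
    proof -
      have "norm (X n - X (r k)) < (1/2) ^ k" using N rN that by (meson order_trans)
      moreover have "norm (X (r k) - abs_l2 g) \<le> (1/2) ^ k"
        using gk[of k] norm_minus_commute[of "X (r k)" "abs_l2 g"]
        by (simp add: f(2)[symmetric] abs_l2_diff[OF g f(1)])
      ultimately show ?thesis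
        using norm_triangle_ineq[of "X n - X (r k)" "X (r k) - abs_l2 g"] k by simp
    qed
    then show "\<exists>no. \<forall>n\<ge>no. norm (X n - abs_l2 g) < e" by blast
  qed
  then show "convergent X" by (auto simp: convergent_def)
qed

section \<open>Integral operators and the Schur test\<close>

text \<open>\<open>A\<close> bounds the rows and \<open>B\<close> the columns. They are kept apart
  because the operator norm is at most \<open>sqrt (A * B)\<close>: smallness of one of them is
  enough in the approximation arguments.\<close>

definition schur_kernel :: "('a::euclidean_space \<Rightarrow> 'a \<Rightarrow> real) \<Rightarrow> real \<Rightarrow> real \<Rightarrow> bool" where
  "schur_kernel k A B \<longleftrightarrow> A \<ge> 0 \<and> B \<ge> 0 \<and> case_prod k \<in> borel_measurable (borel \<Otimes>\<^sub>M borel) \<and>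
     (\<forall>v. (\<integral>\<^sup>+w. ennreal \<bar>k v w\<bar> \<partial>lborel) \<le> ennreal A) \<and>
     (\<forall>w. (\<integral>\<^sup>+v. ennreal \<bar>k v w\<bar> \<partial>lborel) \<le> ennreal B)"

definition kernel_integral ::
  "('a::euclidean_space \<Rightarrow> 'a \<Rightarrow> real) \<Rightarrow> ('a \<Rightarrow> 'b::euclidean_space) \<Rightarrow> 'a \<Rightarrow> 'b" where
  "kernel_integral k f v = (\<integral>w. k v w *\<^sub>R f w \<partial>lborel)"

context
  fixes k :: "'a::euclidean_space \<Rightarrow> 'a \<Rightarrow> real" and A B :: real
  assumes schur: "schur_kernel k A B"
begin

lemma schur_kernel_measurable [measurable]: "case_prod k \<in> borel_measurable (borel \<Otimes>\<^sub>M borel)"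
  using schur by (simp add: schur_kernel_def)

lemma schur_kernel_measurable_snd [measurable]: "k v \<in> borel_measurable borel"
  using measurable_Pair2[OF schur_kernel_measurable, of v] by simp

lemma kernel_integral_measurable:
  assumes [measurable]: "f \<in> borel_measurable borel"
  shows "kernel_integral k f \<in> borel_measurable borel"
proof -
  have "(\<lambda>(v, w). k v w *\<^sub>R f w) \<in> borel_measurable (borel \<Otimes>\<^sub>M lborel)"
    by (subst measurable_cong_sets[of _ "borel \<Otimes>\<^sub>M borel" _ borel]) (auto intro!: sets_pair_measure_cong)
  from lborel.borel_measurable_lebesgue_integral[OF this] show ?thesis
    by (simp add: kernel_integral_def[abs_def])
qed

text \<open>Splitting the absolute kernel into two square roots, Cauchy-Schwarz in \<open>w\<close>
  costs one row bound; after exchanging the integrals the remaining factor costs one column bound.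
  Absolute values stay inside so that the estimate also yields convergence of the integral for
  almost every \<open>v\<close>.\<close>

lemma schur_test_nn:
  assumes [measurable]: "f \<in> borel_measurable borel"
  shows "(\<integral>\<^sup>+v. (\<integral>\<^sup>+w. ennreal (\<bar>k v w\<bar> * norm (f w)) \<partial>lborel)\<^sup>2 \<partial>lborel)
    \<le> ennreal (A * B) * (\<integral>\<^sup>+w. ennreal ((norm (f w))\<^sup>2) \<partial>lborel)"
proof -
  have AB: "A \<ge> 0" "B \<ge> 0" "\<And>v. (\<integral>\<^sup>+w. ennreal \<bar>k v w\<bar> \<partial>lborel) \<le> ennreal A"
    "\<And>w. (\<integral>\<^sup>+v. ennreal \<bar>k v w\<bar> \<partial>lborel) \<le> ennreal B"
    using schur by (auto simp: schur_kernel_def)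
  have CS: "(\<integral>\<^sup>+w. ennreal (\<bar>k v w\<bar> * norm (f w)) \<partial>lborel)\<^sup>2
      \<le> ennreal A * (\<integral>\<^sup>+w. ennreal (\<bar>k v w\<bar> * (norm (f w))\<^sup>2) \<partial>lborel)" for v
  proof -
    have "(\<integral>\<^sup>+w. ennreal (\<bar>k v w\<bar> * norm (f w)) \<partial>lborel)\<^sup>2
       = (\<integral>\<^sup>+w. ennreal (sqrt \<bar>k v w\<bar>) * ennreal (sqrt \<bar>k v w\<bar> * norm (f w)) \<partial>lborel)\<^sup>2"
      by (simp add: ennreal_mult[symmetric] mult.assoc[symmetric])
    also have "\<dots> \<le> (\<integral>\<^sup>+w. (ennreal (sqrt \<bar>k v w\<bar>))\<^sup>2 \<partial>lborel) * (\<integral>\<^sup>+w. (ennreal (sqrt \<bar>k v w\<bar> * norm (f w)))\<^sup>2 \<partial>lborel)"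
      by (rule Cauchy_Schwarz_nn_integral) measurable
    also have "\<dots> = (\<integral>\<^sup>+w. ennreal \<bar>k v w\<bar> \<partial>lborel) * (\<integral>\<^sup>+w. ennreal (\<bar>k v w\<bar> * (norm (f w))\<^sup>2) \<partial>lborel)"
      by (simp add: ennreal_power power_mult_distrib)
    also have "\<dots> \<le> ennreal A * (\<integral>\<^sup>+w. ennreal (\<bar>k v w\<bar> * (norm (f w))\<^sup>2) \<partial>lborel)"
      by (intro mult_right_mono AB) auto
    finally show ?thesis .
  qed
  have "(\<integral>\<^sup>+v. (\<integral>\<^sup>+w. ennreal (\<bar>k v w\<bar> * norm (f w)) \<partial>lborel)\<^sup>2 \<partial>lborel)
      \<le> (\<integral>\<^sup>+v. ennreal A * (\<integral>\<^sup>+w. ennreal (\<bar>k v w\<bar> * (norm (f w))\<^sup>2) \<partial>lborel) \<partial>lborel)"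
    by (intro nn_integral_mono CS)
  also have "\<dots> = ennreal A * (\<integral>\<^sup>+v. (\<integral>\<^sup>+w. ennreal (\<bar>k v w\<bar> * (norm (f w))\<^sup>2) \<partial>lborel) \<partial>lborel)"
    by (intro nn_integral_cmult) measurable
  also have "(\<integral>\<^sup>+v. (\<integral>\<^sup>+w. ennreal (\<bar>k v w\<bar> * (norm (f w))\<^sup>2) \<partial>lborel) \<partial>lborel)
      = (\<integral>\<^sup>+w. (\<integral>\<^sup>+v. ennreal (\<bar>k v w\<bar> * (norm (f w))\<^sup>2) \<partial>lborel) \<partial>lborel)"
    by (rule lborel_pair.Fubini') measurable
  also have "\<dots> = (\<integral>\<^sup>+w. (\<integral>\<^sup>+v. ennreal \<bar>k v w\<bar> \<partial>lborel) * ennreal ((norm (f w))\<^sup>2) \<partial>lborel)"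
    by (simp add: ennreal_mult nn_integral_multc)
  also have "\<dots> \<le> (\<integral>\<^sup>+w. ennreal B * ennreal ((norm (f w))\<^sup>2) \<partial>lborel)"
    by (intro nn_integral_mono mult_right_mono AB) auto
  also have "\<dots> = ennreal B * (\<integral>\<^sup>+w. ennreal ((norm (f w))\<^sup>2) \<partial>lborel)"
    by (intro nn_integral_cmult) measurable
  finally show ?thesis using AB(1,2) by (simp add: ennreal_mult mult.assoc mult_left_mono)
qed

text \<open>Where the integrand is not integrable, the Bochner integral has the value 0, so the
  bound holds at every \<open>v\<close>.\<close>

lemma kernel_integral_norm_le:
  assumes [measurable]: "f \<in> borel_measurable borel"
  shows "ennreal (norm (kernel_integral k f v)) \<le> (\<integral>\<^sup>+w. ennreal (\<bar>k v w\<bar> * norm (f w)) \<partial>lborel)"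
proof (cases "integrable lborel (\<lambda>w. k v w *\<^sub>R f w)")
  case True
  from integral_norm_bound_ennreal[OF this] show ?thesis by (simp add: kernel_integral_def)
qed (simp add: kernel_integral_def not_integrable_integral_eq)

lemma kernel_integral_nn_le:
  assumes [measurable]: "f \<in> borel_measurable borel"
  shows "(\<integral>\<^sup>+v. ennreal ((norm (kernel_integral k f v))\<^sup>2) \<partial>lborel)
    \<le> ennreal (A * B) * (\<integral>\<^sup>+w. ennreal ((norm (f w))\<^sup>2) \<partial>lborel)"
proof -
  have "(\<integral>\<^sup>+v. ennreal ((norm (kernel_integral k f v))\<^sup>2) \<partial>lborel)
    \<le> (\<integral>\<^sup>+v. (\<integral>\<^sup>+w. ennreal (\<bar>k v w\<bar> * norm (f w)) \<partial>lborel)\<^sup>2 \<partial>lborel)"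
    unfolding ennreal_power[OF norm_ge_zero, symmetric]
    by (intro nn_integral_mono power_mono kernel_integral_norm_le) auto
  also note schur_test_nn[OF assms]
  finally show ?thesis .
qed

lemma square_integrable_kernel_abs:
  assumes f: "square_integrable f"
  shows "(\<integral>\<^sup>+v. (\<integral>\<^sup>+w. ennreal (\<bar>k v w\<bar> * norm (f w)) \<partial>lborel)\<^sup>2 \<partial>lborel) < \<infinity>"
proof -
  have "(\<integral>\<^sup>+w. ennreal ((norm (f w))\<^sup>2) \<partial>lborel) < \<infinity>" using f by (simp add: square_integrable_iff_nn)
  then show ?thesis
    by (intro le_less_trans[OF schur_test_nn]) (use f in \<open>auto simp: ennreal_mult_less_top square_integrable_def\<close>)
qed

lemma AE_integrable_kernel:
  assumes f: "square_integrable f"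
  shows "AE v in lborel. integrable lborel (\<lambda>w. k v w *\<^sub>R f w)"
proof -
  have [measurable]: "f \<in> borel_measurable borel" using f by (simp add: square_integrable_def)
  have "AE v in lborel. (\<integral>\<^sup>+w. ennreal (\<bar>k v w\<bar> * norm (f w)) \<partial>lborel)\<^sup>2 \<noteq> \<infinity>"
    using square_integrable_kernel_abs[OF f] by (intro nn_integral_PInf_AE) auto
  then show ?thesis
    by eventually_elim (auto simp: integrable_iff_bounded top.not_eq_extremum power_less_top_ennreal)
qed

lemma square_integrable_kernel_integral:
  assumes f: "square_integrable f"
  shows "square_integrable (kernel_integral k f)"
proof -
  have "(\<integral>\<^sup>+w. ennreal ((norm (f w))\<^sup>2) \<partial>lborel) < \<infinity>" using f by (simp add: square_integrable_iff_nn)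
  then show ?thesis
    using f unfolding square_integrable_iff_nn
    by (auto intro!: kernel_integral_measurable le_less_trans[OF kernel_integral_nn_le] simp: ennreal_mult_less_top)
qed

lemma norm_kernel_integral:
  assumes f: "square_integrable f"
  shows "norm (abs_l2 (kernel_integral k f)) \<le> sqrt (A * B) * norm (abs_l2 f)"
proof (rule norm_abs_l2_le_nn[OF square_integrable_kernel_integral[OF f]])
  have "A \<ge> 0" "B \<ge> 0" using schur by (auto simp: schur_kernel_def)
  then show "0 \<le> sqrt (A * B) * norm (abs_l2 f)" by simp
  show "(\<integral>\<^sup>+v. ennreal ((norm (kernel_integral k f v))\<^sup>2) \<partial>lborel) \<le> ennreal ((sqrt (A * B) * norm (abs_l2 f))\<^sup>2)"
    using kernel_integral_nn_le[of f] f norm_abs_l2_nn[OF f] \<open>A \<ge> 0\<close> \<open>B \<ge> 0\<close>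
    by (simp add: square_integrable_def power_mult_distrib ennreal_mult)
qed

text \<open>This is what licenses Fubini in the symmetry of the operator: the absolute integral is a
  pairing of a function controlled by the Schur test with \<open>norm (g v)\<close>.\<close>

lemma integrable_kernel_pair:
  fixes f g :: "'a \<Rightarrow> 'b::euclidean_space"
  assumes f: "square_integrable f" and g: "square_integrable g"
  shows "integrable (lborel \<Otimes>\<^sub>M lborel) (\<lambda>(v, w). k v w * (f w \<bullet> g v))"
proof -
  have [measurable]: "f \<in> borel_measurable borel" "g \<in> borel_measurable borel"
    using f g by (auto simp: square_integrable_def)
  define F where "F v = (\<integral>\<^sup>+w. ennreal (\<bar>k v w\<bar> * norm (f w)) \<partial>lborel)" for v
  have [measurable]: "F \<in> borel_measurable borel" unfolding F_def by measurable
  have "(\<integral>\<^sup>+p. ennreal (norm (case p of (v, w) \<Rightarrow> k v w * (f w \<bullet> g v))) \<partial>(lborel \<Otimes>\<^sub>M lborel))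
     = (\<integral>\<^sup>+v. \<integral>\<^sup>+w. ennreal (norm (k v w * (f w \<bullet> g v))) \<partial>lborel \<partial>lborel)"
    by (subst lborel.nn_integral_fst[symmetric]) auto
  also have "\<dots> \<le> (\<integral>\<^sup>+v. \<integral>\<^sup>+w. ennreal (\<bar>k v w\<bar> * norm (f w)) * ennreal (norm (g v)) \<partial>lborel \<partial>lborel)"
    by (intro nn_integral_mono)
       (auto simp: ennreal_mult[symmetric] abs_mult mult.assoc intro!: mult_left_mono Cauchy_Schwarz_ineq2)
  also have "\<dots> = (\<integral>\<^sup>+v. F v * ennreal (norm (g v)) \<partial>lborel)"
    by (simp add: nn_integral_multc F_def)
  also have "\<dots> < \<infinity>"
  proof -
    have "(\<integral>\<^sup>+v. F v * ennreal (norm (g v)) \<partial>lborel)\<^sup>2 \<le> (\<integral>\<^sup>+v. (F v)\<^sup>2 \<partial>lborel) * (\<integral>\<^sup>+v. (ennreal (norm (g v)))\<^sup>2 \<partial>lborel)"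
      by (rule Cauchy_Schwarz_nn_integral) measurable
    also have "\<dots> < \<infinity>"
      using square_integrable_kernel_abs[OF f] g
      by (simp add: F_def ennreal_mult_less_top ennreal_power square_integrable_iff_nn)
    finally show ?thesis by (simp add: power_less_top_ennreal)
  qed
  finally show ?thesis by (simp add: integrable_iff_bounded)
qed

lemma kernel_integral_inner:
  fixes f g :: "'a \<Rightarrow> 'b::euclidean_space"
  assumes f: "square_integrable f" and g: "square_integrable g"
  shows "(\<integral>v. kernel_integral k f v \<bullet> g v \<partial>lborel) = (\<integral>v. \<integral>w. k v w * (f w \<bullet> g v) \<partial>lborel \<partial>lborel)"
proof (rule integral_cong_AE)
  have [measurable]: "f \<in> borel_measurable borel" "g \<in> borel_measurable borel"
    using f g by (auto simp: square_integrable_def)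
  show "AE v in lborel. kernel_integral k f v \<bullet> g v = (\<integral>w. k v w * (f w \<bullet> g v) \<partial>lborel)"
    using AE_integrable_kernel[OF f]
  proof eventually_elim
    case (elim v)
    have "kernel_integral k f v \<bullet> g v = (\<integral>w. (k v w *\<^sub>R f w) \<bullet> g v \<partial>lborel)"
      unfolding kernel_integral_def using elim by (intro integral_inner_left[symmetric]) auto
    then show ?case by simp
  qed
  show "(\<lambda>v. kernel_integral k f v \<bullet> g v) \<in> borel_measurable lborel"
    using kernel_integral_measurable[of f] by simp
  show "(\<lambda>v. \<integral>w. k v w * (f w \<bullet> g v) \<partial>lborel) \<in> borel_measurable lborel"
    by measurable
qed

lemma kernel_integral_symmetric:
  fixes f g :: "'a \<Rightarrow> 'b::euclidean_space"
  assumes f: "square_integrable f" and g: "square_integrable g" and sym: "\<And>v w. k v w = k w v"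
  shows "(\<integral>v. kernel_integral k f v \<bullet> g v \<partial>lborel) = (\<integral>v. f v \<bullet> kernel_integral k g v \<partial>lborel)"
proof -
  have "(\<integral>v. kernel_integral k f v \<bullet> g v \<partial>lborel) = (\<integral>v. \<integral>w. k v w * (f w \<bullet> g v) \<partial>lborel \<partial>lborel)"
    by (rule kernel_integral_inner[OF f g])
  also have "\<dots> = (\<integral>w. \<integral>v. k v w * (f w \<bullet> g v) \<partial>lborel \<partial>lborel)"
    using lborel_pair.Fubini_integral[OF integrable_kernel_pair[OF f g]] by simp
  also have "\<dots> = (\<integral>w. \<integral>v. k w v * (g v \<bullet> f w) \<partial>lborel \<partial>lborel)"
    by (simp add: sym inner_commute)
  also have "\<dots> = (\<integral>v. kernel_integral k g v \<bullet> f v \<partial>lborel)"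
    by (rule kernel_integral_inner[OF g f, symmetric])
  finally show ?thesis by (simp add: inner_commute)
qed

lemma AE_kernel_integral_add:
  assumes "square_integrable f" "square_integrable g"
  shows "AE v in lborel. kernel_integral k (\<lambda>w. f w + g w) v = kernel_integral k f v + kernel_integral k g v"
  using AE_integrable_kernel[OF assms(1)] AE_integrable_kernel[OF assms(2)]
  by eventually_elim (simp add: kernel_integral_def scaleR_right_distrib)

end

text \<open>As global measurability rules these two would apply to every function application.\<close>
declare schur_kernel_measurable [measurable del] schur_kernel_measurable_snd [measurable del]

lemma kernel_integral_scaleR:
  "kernel_integral k (\<lambda>w. c *\<^sub>R f w) v = c *\<^sub>R kernel_integral k f v"
proof -
  have "kernel_integral k (\<lambda>w. c *\<^sub>R f w) v = (\<integral>w. c *\<^sub>R (k v w *\<^sub>R f w) \<partial>lborel)"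
    by (simp add: kernel_integral_def mult.commute)
  also have "\<dots> = c *\<^sub>R kernel_integral k f v"
    unfolding kernel_integral_def by (rule integral_scaleR_right)
  finally show ?thesis .
qed

lemma kernel_integral_cmult:
  fixes c :: complex
  shows "kernel_integral k (\<lambda>w. c * f w) v = c * kernel_integral k f v"
proof -
  have "kernel_integral k (\<lambda>w. c * f w) v = (\<integral>w. c * (k v w *\<^sub>R f w) \<partial>lborel)"
    by (simp add: kernel_integral_def)
  also have "\<dots> = c * kernel_integral k f v"
    unfolding kernel_integral_def by (rule integral_mult_right_zero)
  finally show ?thesis .
qed

text \<open>The equality holds at every \<open>v\<close>, not just almost everywhere: a kernel
  integral does not depend on the representative of the class it is applied to.\<close>

lemma kernel_integral_cong_AE:
  assumes "case_prod k \<in> borel_measurable (borel \<Otimes>\<^sub>M borel)"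
    and [measurable]: "f \<in> borel_measurable borel" "g \<in> borel_measurable borel"
    and "AE x in lborel. f x = g x"
  shows "kernel_integral k f v = kernel_integral k g v"
proof -
  have [measurable]: "k v \<in> borel_measurable borel"
    using measurable_Pair2[OF assms(1), of v] by simp
  show ?thesis unfolding kernel_integral_def
    by (rule integral_cong_AE) (use assms(4) in auto)
qed

definition kernel_operator ::
  "('a::euclidean_space \<Rightarrow> 'a \<Rightarrow> real) \<Rightarrow> ('a, 'b::euclidean_space) l2 \<Rightarrow> ('a, 'b) l2" where
  "kernel_operator k x = abs_l2 (kernel_integral k (rep_l2 x))"

lemma kernel_operator_abs:
  assumes k: "schur_kernel k A B" and f: "square_integrable f"
  shows "kernel_operator k (abs_l2 f) = abs_l2 (kernel_integral k f)"
proof -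
  have "kernel_integral k (rep_l2 (abs_l2 f)) = kernel_integral k f"
    by (rule ext, rule kernel_integral_cong_AE[OF schur_kernel_measurable[OF k]])
       (use f rep_l2_abs_l2[OF f] square_integrable_rep_l2 in \<open>auto simp: square_integrable_def\<close>)
  then show ?thesis by (simp add: kernel_operator_def)
qed

lemma norm_kernel_operator:
  assumes k: "schur_kernel k A B"
  shows "norm (kernel_operator k x) \<le> sqrt (A * B) * norm x"
  using norm_kernel_integral[OF k square_integrable_rep_l2[of x]]
  by (simp add: kernel_operator_def abs_l2_rep_l2)

lemma bounded_linear_kernel_operator:
  assumes k: "schur_kernel k A B"
  shows "bounded_linear (kernel_operator k)"
proof
  fix x y :: "('a, 'b) l2" and r :: real
  show "kernel_operator k (x + y) = kernel_operator k x + kernel_operator k y"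
  proof (cases x rule: l2_cases; cases y rule: l2_cases)
    fix f g assume f: "square_integrable f" "x = abs_l2 f" and g: "square_integrable g" "y = abs_l2 g"
    note si = square_integrable_add[OF f(1) g(1)]
    show ?thesis
      using AE_kernel_integral_add[OF k f(1) g(1)] square_integrable_kernel_integral[OF k f(1)]
        square_integrable_kernel_integral[OF k g(1)] square_integrable_kernel_integral[OF k si]
      by (simp add: f g abs_l2_add si kernel_operator_abs[OF k] abs_l2_eq_iff square_integrable_add)
  qed
  show "kernel_operator k (r *\<^sub>R x) = r *\<^sub>R kernel_operator k x"
  proof (cases x rule: l2_cases)
    fix f assume f: "square_integrable f" "x = abs_l2 f"
    have "kernel_integral k (\<lambda>w. r *\<^sub>R f w) = (\<lambda>v. r *\<^sub>R kernel_integral k f v)"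
      by (rule ext) (rule kernel_integral_scaleR)
    then show ?thesis
      using square_integrable_kernel_integral[OF k f(1)]
      by (simp add: f abs_l2_scaleR square_integrable_scaleR kernel_operator_abs[OF k])
  qed
  show "\<exists>K. \<forall>x::('a, 'b) l2. norm (kernel_operator k x) \<le> norm x * K"
    using norm_kernel_operator[OF k] by (metis mult.commute)
qed

lemma kernel_operator_diff:
  assumes k: "schur_kernel k A B" and l: "schur_kernel l C D" and kl: "schur_kernel (\<lambda>v w. k v w - l v w) E F"
  shows "kernel_operator k x - kernel_operator l x = kernel_operator (\<lambda>v w. k v w - l v w) x"
proof (cases x rule: l2_cases)
  fix f assume f: "square_integrable f" "x = abs_l2 f"
  note si = square_integrable_kernel_integral[OF k f(1)] square_integrable_kernel_integral[OF l f(1)]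
    square_integrable_kernel_integral[OF kl f(1)]
  have "AE v in lborel. kernel_integral k f v - kernel_integral l f v = kernel_integral (\<lambda>v w. k v w - l v w) f v"
    using AE_integrable_kernel[OF k f(1)] AE_integrable_kernel[OF l f(1)]
    by eventually_elim (simp add: kernel_integral_def scaleR_left_diff_distrib)
  then show ?thesis
    using si by (simp add: f kernel_operator_abs[OF k] kernel_operator_abs[OF l] kernel_operator_abs[OF kl]
        abs_l2_diff abs_l2_eq_iff square_integrable_diff)
qed

section \<open>Multiplication by bounded complex functions\<close>

definition multiplication_operator ::
  "('a::euclidean_space \<Rightarrow> complex) \<Rightarrow> ('a, complex) l2 \<Rightarrow> ('a, complex) l2" where
  "multiplication_operator h x = abs_l2 (\<lambda>v. h v * rep_l2 x v)"

context
  fixes h :: "'a::euclidean_space \<Rightarrow> complex" and C :: real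
  assumes meas [measurable]: "h \<in> borel_measurable borel" and bd: "\<And>v. norm (h v) \<le> C"
begin

lemma square_integrable_multiplication:
  "square_integrable f \<Longrightarrow> square_integrable (\<lambda>v. h v * f v)"
  by (rule square_integrable_bound[of f _ C])
     (auto simp: norm_mult bd mult_right_mono)

lemma multiplication_operator_abs:
  assumes f: "square_integrable f"
  shows "multiplication_operator h (abs_l2 f) = abs_l2 (\<lambda>v. h v * f v)"
  unfolding multiplication_operator_def
  by (subst abs_l2_eq_iff)
     (use rep_l2_abs_l2[OF f] in \<open>auto intro!: square_integrable_multiplication square_integrable_rep_l2 f\<close>)

lemma norm_multiplication_operator: "norm (multiplication_operator h x) \<le> C * norm x"
proof (cases x rule: l2_cases)
  fix f assume f: "square_integrable f" "x = abs_l2 f"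
  have C: "C \<ge> 0" using order_trans[OF norm_ge_zero bd] .
  have "(\<integral>v. (norm (h v * f v))\<^sup>2 \<partial>lborel) \<le> (\<integral>v. C\<^sup>2 * (norm (f v))\<^sup>2 \<partial>lborel)"
    using f(1) square_integrable_multiplication[OF f(1)] bd
    by (intro integral_mono)
       (auto simp: square_integrable_def norm_mult power_mult_distrib intro!: mult_right_mono power_mono)
  also have "\<dots> = C\<^sup>2 * (\<integral>v. (norm (f v))\<^sup>2 \<partial>lborel)" by simp
  finally show ?thesis
    using C by (simp add: f multiplication_operator_abs norm_abs_l2 square_integrable_multiplication
        real_sqrt_mult[symmetric] real_le_lsqrt flip: real_sqrt_unique)
       (metis real_sqrt_abs2 real_sqrt_le_mono real_sqrt_mult abs_of_nonneg power2_eq_square)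
qed

lemma bounded_linear_multiplication_operator: "bounded_linear (multiplication_operator h)"
proof
  fix x y :: "('a, complex) l2" and r :: real
  show "multiplication_operator h (x + y) = multiplication_operator h x + multiplication_operator h y"
    by (cases x rule: l2_cases; cases y rule: l2_cases)
       (simp add: abs_l2_add square_integrable_add multiplication_operator_abs
         square_integrable_multiplication distrib_left)
  show "multiplication_operator h (r *\<^sub>R x) = r *\<^sub>R multiplication_operator h x"
    by (cases x rule: l2_cases)
       (simp add: abs_l2_scaleR square_integrable_scaleR multiplication_operator_abs square_integrable_multiplication)
  show "\<exists>K. \<forall>x::('a, complex) l2. norm (multiplication_operator h x) \<le> norm x * K"
    using norm_multiplication_operator by (metis mult.commute)
qed

end

section \<open>Spectrum of a compact positive kernel operator minus a multiplication\<close>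

text \<open>Each element is ranked by the number of larger ones. This number is finite, since
  infinitely many elements in a compact interval \<open>{x..0}\<close> would accumulate above
  \<open>a\<close>. The rank is injective with downward closed image, and its inverse is the
  enumeration.\<close>

lemma decreasing_enumeration:
  fixes E :: "real set"
  assumes E: "E \<subseteq> {a<..0}" "0 \<in> E" and lim: "\<forall>p>a. \<not> p islimpt E"
  shows "\<exists>(I :: nat set) (lam :: nat \<Rightarrow> real). 0 \<in> I \<and> (\<forall>n\<in>I. \<forall>k\<le>n. k \<in> I) \<and> lam 0 = 0 \<and>
    (\<forall>n\<in>I. \<forall>k\<in>I. n < k \<longrightarrow> lam k < lam n) \<and> lam ` I = E"
proof -
  define F where "F x = {y \<in> E. x < y}" for x
  define N where "N x = card (F x)" for x
  have fin: "finite (F x)" if x: "x \<in> E" for x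
  proof (rule ccontr)
    assume "infinite (F x)"
    moreover have "F x \<subseteq> {x..0}" using E by (auto simp: F_def)
    ultimately obtain p where p: "p \<in> {x..0}" "p islimpt F x"
      using Heine_Borel_imp_Bolzano_Weierstrass[OF compact_Icc] by blast
    have "p islimpt E" by (rule islimpt_subset[OF p(2)]) (auto simp: F_def)
    moreover have "a < p" using p(1) x E by force
    ultimately show False using lim by blast
  qed
  have Nless: "N y < N x" if "x \<in> E" "y \<in> E" "x < y" for x y
    unfolding N_def using that by (intro psubset_card_mono fin) (auto simp: F_def)
  have inj: "inj_on N E"
    by (rule inj_onI) (metis Nless less_irrefl linorder_neq_iff)
  have pred: "\<exists>y\<in>E. N y = m" if x: "x \<in> E" and N: "N x = Suc m" for x m
  proof -
    have ne: "F x \<noteq> {}" using N by (auto simp: N_def)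
    define y where "y = Min (F x)"
    have y: "y \<in> F x" "\<And>z. z \<in> F x \<Longrightarrow> y \<le> z" using fin[OF x] ne by (auto simp: y_def)
    have "F x = insert y (F y)" using y by (force simp: F_def)
    moreover have "y \<notin> F y" "finite (F y)" using y fin by (auto simp: F_def)
    ultimately have "N x = Suc (N y)" by (simp add: N_def)
    then show ?thesis using N y(1) by (auto simp: F_def)
  qed
  have down: "k \<in> N ` E" if "n \<in> N ` E" "k \<le> n" for n k
    using that(2,1)
  proof (induction rule: inc_induct)
    case (step i)
    then obtain x where "x \<in> E" "N x = Suc i" by auto
    then show ?case using pred by blast
  qed
  have "F 0 = {}" using E(1) by (auto simp: F_def dest!: subsetD)
  then have N0: "N 0 = 0" by (simp add: N_def)
  show ?thesis
  proof (intro exI[of _ "N ` E"] exI[of _ "inv_into E N"] conjI ballI allI impI)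
    show "0 \<in> N ` E" using N0 E(2) by force
    show "inv_into E N 0 = 0" using inv_into_f_f[OF inj E(2)] N0 by simp
    show "inv_into E N ` (N ` E) = E" using inj by (simp add: inv_into_image_cancel)
    fix n k
    show "n \<in> N ` E \<Longrightarrow> k \<le> n \<Longrightarrow> k \<in> N ` E" by (rule down)
    assume nk: "n \<in> N ` E" "k \<in> N ` E" "n < k"
    then obtain x y where xy: "x \<in> E" "n = N x" "y \<in> E" "k = N y" by auto
    have "y < x"
    proof (rule ccontr)
      assume "\<not> y < x"
      then have "N y \<le> N x" using Nless[OF xy(1,3)] by (cases "x = y") auto
      then show False using nk(3) xy by simp
    qed
    then show "inv_into E N k < inv_into E N n" using inj xy by simp
  qed
qed

text \<open>\<open>balance\<close> uses the nonnegative integral so that it asserts convergence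
  together with the value; it makes \<open>\<phi>\<close> a positive null vector.
  \<open>range_\<sigma>\<close> carries two facts: \<open>\<nu>\<close> is the minimum, and every
  larger value is attained, which later fills the half line with spectrum.\<close>

locale kernel_minus_multiplication =
  fixes k :: "'a::euclidean_space \<Rightarrow> 'a \<Rightarrow> real" and \<sigma> \<phi> :: "'a \<Rightarrow> real" and \<nu> A :: real
  assumes schur: "schur_kernel k A A"
    and nonneg: "0 \<le> k v w"
    and pos: "v \<noteq> w \<Longrightarrow> 0 < k v w"
    and sym: "k v w = k w v"
    and compact: "compact_operator (kernel_operator k :: ('a, complex) l2 \<Rightarrow> ('a, complex) l2)"
    and continuous_\<sigma>: "continuous_on UNIV \<sigma>"
    and range_\<sigma>: "range \<sigma> = {\<nu>..}"
    and \<nu>_pos: "0 < \<nu>"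
    and \<phi>_pos: "0 < \<phi> v"
    and square_integrable_\<phi>: "square_integrable \<phi>"
    and balance: "(\<integral>\<^sup>+w. ennreal (k v w * \<phi> w) \<partial>lborel) = ennreal (\<sigma> v * \<phi> v)"
begin

section \<open>Symmetry, the Dirichlet form and the null space\<close>

definition L :: "('a \<Rightarrow> complex) \<Rightarrow> 'a \<Rightarrow> complex" where
  "L f v = kernel_integral k f v - complex_of_real (\<sigma> v) * f v"

definition dom :: "('a \<Rightarrow> complex) \<Rightarrow> bool" where
  "dom f \<longleftrightarrow> square_integrable f \<and> integrable lborel (\<lambda>v. (norm (f v))\<^sup>2 * \<sigma> v) \<and> square_integrable (L f)"

definition eigenfunction :: "complex \<Rightarrow> ('a \<Rightarrow> complex) \<Rightarrow> bool" where
  "eigenfunction z f \<longleftrightarrow> dom f \<and> (AE v in lborel. L f v = z * f v)"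

definition eigenvalue :: "complex \<Rightarrow> bool" where
  "eigenvalue z \<longleftrightarrow> (\<exists>f. eigenfunction z f \<and> \<not> (AE v in lborel. f v = 0))"

definition regular :: "complex \<Rightarrow> bool" where
  "regular z \<longleftrightarrow>
     (\<exists>C. \<forall>f. dom f \<longrightarrow> norm (abs_l2 f) \<le> C * norm (abs_l2 (\<lambda>v. L f v - z * f v))) \<and>
     (\<forall>g. square_integrable g \<longrightarrow> (\<exists>f. dom f \<and> (AE v in lborel. L f v - z * f v = g v)))"

lemma \<sigma>_measurable [measurable]: "\<sigma> \<in> borel_measurable borel"
  by (rule borel_measurable_continuous_onI[OF continuous_\<sigma>])

lemma \<sigma>_ge: "\<nu> \<le> \<sigma> v"
  using range_\<sigma> by blast

lemma \<phi>_measurable [measurable]: "\<phi> \<in> borel_measurable borel"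
  using square_integrable_\<phi> by (rule square_integrable_measurable)

lemma k_measurable [measurable]: "case_prod k \<in> borel_measurable (borel \<Otimes>\<^sub>M borel)"
  by (rule schur_kernel_measurable[OF schur])

lemmas square_integrable_K = square_integrable_kernel_integral[OF schur]

lemma square_integrable_cmult: "square_integrable f \<Longrightarrow> square_integrable (\<lambda>v. z * f v)" for z :: complex
  by (rule square_integrable_multiplication[of "\<lambda>_. z" "norm z"]) auto

lemma domD:
  assumes "dom f"
  shows "square_integrable f" "square_integrable (L f)" "square_integrable (\<lambda>v. complex_of_real (\<sigma> v) * f v)"
proof -
  show f: "square_integrable f" "square_integrable (L f)" using assms by (auto simp: dom_def)
  show "square_integrable (\<lambda>v. complex_of_real (\<sigma> v) * f v)"
    using square_integrable_diff[OF square_integrable_K[OF f(1)] f(2)] by (simp add: L_def)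
qed

text \<open>The energy density \<open>(norm (f v))\<^sup>2 * \<sigma> v\<close> is the product of
  the norms of \<open>f\<close> and \<open>\<sigma> f\<close>, and \<open>K\<close> is bounded.
  Together with \<open>domD\<close> this shows that \<open>dom\<close> is the natural domain of
  multiplication by \<open>\<sigma>\<close>.\<close>

lemma domI:
  assumes f: "square_integrable f" and sf: "square_integrable (\<lambda>v. complex_of_real (\<sigma> v) * f v)"
  shows "dom f"
proof -
  have "integrable lborel (\<lambda>v. norm (f v) * norm (complex_of_real (\<sigma> v) * f v))"
    by (rule square_integrable_inner(1)[OF f sf])
  also have "(\<lambda>v. norm (f v) * norm (complex_of_real (\<sigma> v) * f v)) = (\<lambda>v. (norm (f v))\<^sup>2 * \<sigma> v)"
  proof
    fix v
    have "0 \<le> \<sigma> v" using \<sigma>_ge[of v] \<nu>_pos by simp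
    then show "norm (f v) * norm (complex_of_real (\<sigma> v) * f v) = (norm (f v))\<^sup>2 * \<sigma> v"
      by (simp add: norm_mult power2_eq_square)
  qed
  finally show ?thesis
    using f square_integrable_diff[OF square_integrable_K[OF f] sf] by (simp add: dom_def L_def[abs_def])
qed

lemma L_symmetric:
  assumes f: "dom f" and g: "dom g"
  shows "(\<integral>v. L f v \<bullet> g v \<partial>lborel) = (\<integral>v. f v \<bullet> L g v \<partial>lborel)"
proof -
  note ff = domD[OF f] and gg = domD[OF g]
  have "(\<integral>v. L f v \<bullet> g v \<partial>lborel)
      = (\<integral>v. kernel_integral k f v \<bullet> g v \<partial>lborel) - (\<integral>v. (complex_of_real (\<sigma> v) * f v) \<bullet> g v \<partial>lborel)"
    unfolding L_def inner_diff_left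
    by (intro Bochner_Integration.integral_diff square_integrable_inner square_integrable_K ff gg)
  also have "\<dots> = (\<integral>v. f v \<bullet> kernel_integral k g v \<partial>lborel) - (\<integral>v. f v \<bullet> (complex_of_real (\<sigma> v) * g v) \<partial>lborel)"
    by (simp add: kernel_integral_symmetric[OF schur ff(1) gg(1) sym] scaleR_conv_of_real[symmetric])
  also have "\<dots> = (\<integral>v. f v \<bullet> L g v \<partial>lborel)"
    unfolding L_def inner_diff_right
    by (intro Bochner_Integration.integral_diff[symmetric] square_integrable_inner square_integrable_K ff gg)
  finally show ?thesis .
qed

text \<open>The real inner product of \<open>f\<close> with itself cannot see \<open>Im z\<close>.
  Against \<open>\<i> * f\<close> the two sides of symmetry are \<open>Im z\<close> and
  \<open>- Im z\<close> times the squared norm.\<close>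

lemma eigenvalue_real:
  assumes "eigenvalue z" shows "Im z = 0"
proof -
  obtain f where f: "dom f" "AE v in lborel. L f v = z * f v" and nz: "\<not> (AE v in lborel. f v = 0)"
    using assms by (auto simp: eigenvalue_def eigenfunction_def)
  define g where "g v = \<i> * f v" for v
  have Lg: "L g v = \<i> * L f v" for v
    by (simp add: L_def g_def[abs_def] kernel_integral_cmult algebra_simps)
  have g: "dom g"
    unfolding g_def using domD[OF f(1)]
    by (intro domI) (auto intro!: square_integrable_cmult simp: mult.left_commute[of _ \<i>])
  have [measurable]: "f \<in> borel_measurable borel" "L f \<in> borel_measurable borel"
    using domD[OF f(1)] by (auto simp: square_integrable_def)
  have "(\<integral>v. L f v \<bullet> g v \<partial>lborel) = (\<integral>v. Im z * (norm (f v))\<^sup>2 \<partial>lborel)"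
  proof (rule integral_cong_AE)
    show "AE v in lborel. L f v \<bullet> g v = Im z * (norm (f v))\<^sup>2"
      using f(2)
      unfolding cmod_power2
      by eventually_elim (simp add: g_def inner_complex_def power2_eq_square algebra_simps)
  qed (auto simp: g_def)
  moreover have "(\<integral>v. f v \<bullet> L g v \<partial>lborel) = (\<integral>v. - Im z * (norm (f v))\<^sup>2 \<partial>lborel)"
  proof (rule integral_cong_AE)
    show "AE v in lborel. f v \<bullet> L g v = - Im z * (norm (f v))\<^sup>2"
      using f(2)
      unfolding cmod_power2
      by eventually_elim (simp add: Lg inner_complex_def power2_eq_square algebra_simps)
  qed (auto simp: Lg)
  ultimately have "Im z * (\<integral>v. (norm (f v))\<^sup>2 \<partial>lborel) = 0"
    using L_symmetric[OF f(1) g] by simp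
  moreover have "(\<integral>v. (norm (f v))\<^sup>2 \<partial>lborel) \<noteq> 0"
    using nz domD(1)[OF f(1)] by (subst integral_nonneg_eq_0_iff_AE) (auto simp: square_integrable_def)
  ultimately show ?thesis by simp
qed

text \<open>Expanding the square gives two diagonal parts and a mixed one. The first diagonal part
  is \<open>q\<close>; integrating out \<open>w\<close> by \<open>balance\<close> turns it into the
  energy, which is finite on \<open>dom\<close>, and the second is its mirror image by symmetry. The
  mixed part is the pairing of \<open>K f\<close> with \<open>f\<close>.\<close>

lemma dirichlet_form:
  assumes f: "dom f"
  defines "u \<equiv> (\<lambda>(v, w). k v w * \<phi> v * \<phi> w * (norm (f v / complex_of_real (\<phi> v) - f w / complex_of_real (\<phi> w)))\<^sup>2)"
  shows "integrable (lborel \<Otimes>\<^sub>M lborel) u"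
    and "integral\<^sup>L (lborel \<Otimes>\<^sub>M lborel) u = - 2 * (\<integral>v. L f v \<bullet> f v \<partial>lborel)"
proof -
  note ff = domD[OF f]
  have [measurable]: "f \<in> borel_measurable borel" using ff by (auto simp: square_integrable_def)
  have \<sigma>0: "0 \<le> \<sigma> v" for v using \<sigma>_ge[of v] \<nu>_pos by simp
  have i\<sigma>: "integrable lborel (\<lambda>v. (norm (f v))\<^sup>2 * \<sigma> v)" using f by (simp add: dom_def)
  define s where "s = (\<integral>v. (norm (f v))\<^sup>2 * \<sigma> v \<partial>lborel)"
  define q where "q = (\<lambda>(v, w). k v w * \<phi> w / \<phi> v * (norm (f v))\<^sup>2)"
  have qm[measurable]: "q \<in> borel_measurable (lborel \<Otimes>\<^sub>M lborel)" unfolding q_def by measurable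
  have "(\<integral>\<^sup>+p. ennreal (q p) \<partial>(lborel \<Otimes>\<^sub>M lborel)) = (\<integral>\<^sup>+v. \<integral>\<^sup>+w. ennreal (q (v, w)) \<partial>lborel \<partial>lborel)"
    by (subst lborel.nn_integral_fst[symmetric]) auto
  also have "\<dots> = (\<integral>\<^sup>+v. ennreal ((norm (f v))\<^sup>2 * \<sigma> v) \<partial>lborel)"
  proof (rule nn_integral_cong)
    fix v
    have "(\<integral>\<^sup>+w. ennreal (q (v, w)) \<partial>lborel) = (\<integral>\<^sup>+w. ennreal ((norm (f v))\<^sup>2 / \<phi> v) * ennreal (k v w * \<phi> w) \<partial>lborel)"
      using \<phi>_pos nonneg
      by (intro nn_integral_cong) (simp add: q_def ennreal_mult[symmetric] less_imp_le mult.commute)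
    also have "\<dots> = ennreal ((norm (f v))\<^sup>2 / \<phi> v) * ennreal (\<sigma> v * \<phi> v)"
      by (subst nn_integral_cmult) (auto simp: balance schur_kernel_measurable_snd[OF schur])
    also have "\<dots> = ennreal ((norm (f v))\<^sup>2 * \<sigma> v)"
      using \<phi>_pos[of v] \<sigma>0[of v] by (simp add: ennreal_mult[symmetric])
    finally show "(\<integral>\<^sup>+w. ennreal (q (v, w)) \<partial>lborel) = ennreal ((norm (f v))\<^sup>2 * \<sigma> v)" .
  qed
  also have "\<dots> = ennreal s"
    unfolding s_def using i\<sigma> \<sigma>0 by (intro nn_integral_eq_integral) auto
  finally have "(\<integral>\<^sup>+p. ennreal (q p) \<partial>(lborel \<Otimes>\<^sub>M lborel)) = ennreal s" .
  moreover have "0 \<le> s" unfolding s_def using \<sigma>0 by (intro integral_nonneg_AE) auto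
  moreover have "0 \<le> q p" for p using nonneg \<phi>_pos by (auto simp: q_def less_imp_le split: prod.split)
  ultimately have q: "integrable (lborel \<Otimes>\<^sub>M lborel) q" "integral\<^sup>L (lborel \<Otimes>\<^sub>M lborel) q = s"
    by (auto simp: nn_integral_eq_integrable[OF qm])
  have q': "integrable (lborel \<Otimes>\<^sub>M lborel) (\<lambda>(v, w). q (w, v))"
      "integral\<^sup>L (lborel \<Otimes>\<^sub>M lborel) (\<lambda>(v, w). q (w, v)) = s"
    using lborel_pair.integrable_product_swap[OF q(1)] lborel_pair.integral_product_swap[OF qm] q(2) by auto
  note kp = integrable_kernel_pair[OF schur ff(1) ff(1)]
  have kpi: "integral\<^sup>L (lborel \<Otimes>\<^sub>M lborel) (\<lambda>(v, w). k v w * (f w \<bullet> f v)) = (\<integral>v. kernel_integral k f v \<bullet> f v \<partial>lborel)"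
    using lborel_pair.integral_fst'[OF kp] kernel_integral_inner[OF schur ff(1) ff(1)] by simp
  have u: "u = (\<lambda>p. q p + (case p of (v, w) \<Rightarrow> q (w, v)) - 2 * (case p of (v, w) \<Rightarrow> k v w * (f w \<bullet> f v)))"
  proof
    fix p :: "'a \<times> 'a"
    obtain v w where p: "p = (v, w)" by (cases p)
    have e: "(norm (f v / complex_of_real (\<phi> v) - f w / complex_of_real (\<phi> w)))\<^sup>2
      = (norm (f v))\<^sup>2 / (\<phi> v)\<^sup>2 + (norm (f w))\<^sup>2 / (\<phi> w)\<^sup>2 - 2 * (f w \<bullet> f v) / (\<phi> v * \<phi> w)"
    proof -
      have 1: "f v / complex_of_real (\<phi> v) = (1 / \<phi> v) *\<^sub>R f v" for v
        by (simp add: scaleR_conv_of_real)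
      have 2: "(norm (a *\<^sub>R f v - b *\<^sub>R f w))\<^sup>2
          = a\<^sup>2 * (norm (f v))\<^sup>2 + b\<^sup>2 * (norm (f w))\<^sup>2 - 2 * (a * b) * (f w \<bullet> f v)" for a b
        unfolding power2_norm_eq_inner
        by (simp add: inner_diff_left inner_diff_right inner_commute power2_eq_square algebra_simps)
      show ?thesis unfolding 1 2 by (simp add: power_divide)
    qed
    show "u p = q p + (case p of (v, w) \<Rightarrow> q (w, v)) - 2 * (case p of (v, w) \<Rightarrow> k v w * (f w \<bullet> f v))"
      using \<phi>_pos[of v] \<phi>_pos[of w] unfolding p u_def q_def prod.case e sym[of w v]
      by (simp add: power2_eq_square field_simps)
  qed
  show "integrable (lborel \<Otimes>\<^sub>M lborel) u" unfolding u using q q' kp by auto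
  have "integral\<^sup>L (lborel \<Otimes>\<^sub>M lborel) u = 2 * s - 2 * (\<integral>v. kernel_integral k f v \<bullet> f v \<partial>lborel)"
    unfolding u using q q' kp kpi by simp
  also have "(\<integral>v. L f v \<bullet> f v \<partial>lborel) = (\<integral>v. kernel_integral k f v \<bullet> f v \<partial>lborel) - (\<integral>v. (complex_of_real (\<sigma> v) * f v) \<bullet> f v \<partial>lborel)"
    unfolding L_def inner_diff_left
    by (intro Bochner_Integration.integral_diff square_integrable_inner square_integrable_K ff)
  moreover have "(\<integral>v. (complex_of_real (\<sigma> v) * f v) \<bullet> f v \<partial>lborel) = s"
  proof -
    have "(complex_of_real (\<sigma> v) * f v) \<bullet> f v = (norm (f v))\<^sup>2 * \<sigma> v" for v
      by (simp add: scaleR_conv_of_real[symmetric] power2_norm_eq_inner)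
    then show ?thesis by (simp add: s_def)
  qed
  ultimately show "integral\<^sup>L (lborel \<Otimes>\<^sub>M lborel) u = - 2 * (\<integral>v. L f v \<bullet> f v \<partial>lborel)" by simp
qed

lemma eigenvalue_nonpos:
  assumes "eigenvalue (complex_of_real x)" shows "x \<le> 0"
proof -
  obtain f where f: "dom f" "AE v in lborel. L f v = complex_of_real x * f v" and nz: "\<not> (AE v in lborel. f v = 0)"
    using assms by (auto simp: eigenvalue_def eigenfunction_def)
  have [measurable]: "f \<in> borel_measurable borel" "L f \<in> borel_measurable borel"
    using domD[OF f(1)] by (auto simp: square_integrable_def)
  have "(\<integral>v. L f v \<bullet> f v \<partial>lborel) = (\<integral>v. x * (norm (f v))\<^sup>2 \<partial>lborel)"
  proof (rule integral_cong_AE)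
    show "AE v in lborel. L f v \<bullet> f v = x * (norm (f v))\<^sup>2"
      using f(2) by eventually_elim (simp add: scaleR_conv_of_real[symmetric] power2_norm_eq_inner)
  qed auto
  moreover have "0 \<le> - 2 * (\<integral>v. L f v \<bullet> f v \<partial>lborel)"
    unfolding dirichlet_form(2)[OF f(1), symmetric] using nonneg \<phi>_pos
    by (intro integral_nonneg_AE) (auto simp: less_imp_le)
  moreover have "0 < (\<integral>v. (norm (f v))\<^sup>2 \<partial>lborel)"
  proof -
    have "(\<integral>v. (norm (f v))\<^sup>2 \<partial>lborel) \<noteq> 0"
      using nz domD(1)[OF f(1)] by (subst integral_nonneg_eq_0_iff_AE) (auto simp: square_integrable_def)
    moreover have "0 \<le> (\<integral>v. (norm (f v))\<^sup>2 \<partial>lborel)" by (intro integral_nonneg_AE) auto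
    ultimately show ?thesis by linarith
  qed
  ultimately show ?thesis by (simp add: mult_le_0_iff)
qed

lemma eigenfunction_0:
  assumes "eigenfunction 0 f"
  obtains c where "AE v in lborel. f v = c * complex_of_real (\<phi> v)"
proof -
  have f: "dom f" "AE v in lborel. L f v = 0" using assms by (auto simp: eigenfunction_def)
  let ?u = "\<lambda>(v, w). k v w * \<phi> v * \<phi> w * (norm (f v / complex_of_real (\<phi> v) - f w / complex_of_real (\<phi> w)))\<^sup>2"
  have "(\<integral>v. L f v \<bullet> f v \<partial>lborel) = 0"
    by (rule integral_eq_zero_AE) (use f(2) in \<open>auto elim: AE_mp\<close>)
  then have "integral\<^sup>L (lborel \<Otimes>\<^sub>M lborel) ?u = 0" using dirichlet_form(2)[OF f(1)] by simp
  moreover have "AE p in lborel \<Otimes>\<^sub>M lborel. 0 \<le> ?u p"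
    using nonneg \<phi>_pos by (intro AE_I2) (auto simp: less_imp_le split: prod.split)
  ultimately have "AE p in lborel \<Otimes>\<^sub>M lborel. ?u p = 0"
    using integral_nonneg_eq_0_iff_AE[OF dirichlet_form(1)[OF f(1)]] by blast
  then have "AE v in lborel. AE w in lborel. ?u (v, w) = 0" by (rule lborel_pair.AE_pair)
  \<comment> \<open>One good row is enough: since the kernel is positive off the diagonal,
    \<open>f / \<phi>\<close> takes at almost every \<open>w\<close> the value it has at this
    \<open>v\<close>.\<close>
  then obtain v where v: "AE w in lborel. ?u (v, w) = 0"
    using eventually_happens[of _ "ae_filter (lborel :: 'a measure)"]
    by (auto simp: ae_filter_eq_bot_iff)
  show thesis
  proof (rule that)
    show "AE w in lborel. f w = (f v / complex_of_real (\<phi> v)) * complex_of_real (\<phi> w)"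
      using v AE_lborel_singleton[of v]
    proof eventually_elim
      case (elim w)
      then have "f v / complex_of_real (\<phi> v) = f w / complex_of_real (\<phi> w)"
        using pos[of v w] \<phi>_pos[of v] \<phi>_pos[of w] by auto
      then show ?case using \<phi>_pos[of w] by simp
    qed
  qed
qed

lemma \<phi>_eigenfunction:
  "L (\<lambda>v. complex_of_real (\<phi> v)) v = 0" "eigenfunction 0 (\<lambda>v. complex_of_real (\<phi> v))" "eigenvalue 0"
proof -
  have K: "kernel_integral k (\<lambda>v. complex_of_real (\<phi> v)) v = complex_of_real (\<sigma> v * \<phi> v)" for v
  proof -
    have m: "(\<lambda>w. k v w * \<phi> w) \<in> borel_measurable lborel"
      using schur_kernel_measurable_snd[OF schur, of v] by simp
    have "0 \<le> \<sigma> v * \<phi> v" using \<sigma>_ge[of v] \<nu>_pos \<phi>_pos[of v] by simp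
    then have "(\<integral>w. k v w * \<phi> w \<partial>lborel) = \<sigma> v * \<phi> v"
      using balance[of v] nn_integral_eq_integrable[OF m, of "\<sigma> v * \<phi> v"] nonneg \<phi>_pos by (auto simp: less_imp_le)
    moreover have "kernel_integral k (\<lambda>v. complex_of_real (\<phi> v)) v = (\<integral>w. complex_of_real (k v w * \<phi> w) \<partial>lborel)"
      by (simp add: kernel_integral_def scaleR_conv_of_real)
    ultimately show ?thesis unfolding integral_complex_of_real by simp
  qed
  show L0: "L (\<lambda>v. complex_of_real (\<phi> v)) v = 0" for v by (simp add: L_def K)
  have si: "square_integrable (\<lambda>v. complex_of_real (\<phi> v))"
    using square_integrable_\<phi> by (simp add: square_integrable_def)
  have "dom (\<lambda>v. complex_of_real (\<phi> v))"
  proof (rule domI[OF si])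
    \<comment> \<open>By \<open>balance\<close>, \<open>\<sigma> \<phi>\<close> equals
      \<open>K \<phi>\<close>, so boundedness of \<open>K\<close> gives its square integrability
      without any growth estimate on \<open>\<sigma>\<close>.\<close>
    have "kernel_integral k (\<lambda>v. complex_of_real (\<phi> v)) = (\<lambda>v. complex_of_real (\<sigma> v) * complex_of_real (\<phi> v))"
      by (rule ext) (simp add: K)
    with square_integrable_K[OF si] show "square_integrable (\<lambda>v. complex_of_real (\<sigma> v) * complex_of_real (\<phi> v))"
      by simp
  qed
  then show e0: "eigenfunction 0 (\<lambda>v. complex_of_real (\<phi> v))" by (simp add: eigenfunction_def L0)
  have "\<not> (AE v in lborel. complex_of_real (\<phi> v) = 0)"
    using \<phi>_pos by (auto simp: less_le ae_filter_eq_bot_iff trivial_limit_def[symmetric])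
  with e0 show "eigenvalue 0" by (auto simp: eigenvalue_def)
qed

section \<open>The resolvent equation off the half line\<close>

lemma multiplier_bound:
  assumes z: "z \<notin> complex_of_real ` {..-\<nu>}"
  obtains d where "d > 0" "\<And>v. d \<le> norm (complex_of_real (\<sigma> v) + z)"
proof (cases "Im z = 0")
  case True
  then have "z = complex_of_real (Re z)" by (simp add: complex_eq_iff)
  then have "- \<nu> < Re z" using z by (metis atMost_iff image_eqI not_le)
  moreover have "Re z + \<nu> \<le> norm (complex_of_real (\<sigma> v) + z)" for v
    using complex_Re_le_cmod[of "complex_of_real (\<sigma> v) + z"] \<sigma>_ge[of v] by simp
  ultimately show thesis using that[of "Re z + \<nu>"] by simp
next
  case False
  moreover have "\<bar>Im z\<bar> \<le> norm (complex_of_real (\<sigma> v) + z)" for v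
    using abs_Im_le_cmod[of "complex_of_real (\<sigma> v) + z"] by simp
  ultimately show thesis using that[of "\<bar>Im z\<bar>"] by simp
qed

text \<open>Up to sign, this is the resolvent at \<open>z\<close> of multiplication by
  \<open>- \<sigma>\<close>; it is bounded because \<open>- z\<close> keeps a positive distance from
  the range of \<open>\<sigma>\<close>.\<close>

definition R :: "complex \<Rightarrow> 'a \<Rightarrow> complex" where
  "R z v = 1 / (complex_of_real (\<sigma> v) + z)"

lemma R_props:
  assumes z: "z \<notin> complex_of_real ` {..-\<nu>}"
  obtains C where "R z \<in> borel_measurable borel" "\<And>v. norm (R z v) \<le> C" "\<And>v. complex_of_real (\<sigma> v) + z \<noteq> 0"
proof -
  obtain d where d: "d > 0" "\<And>v. d \<le> norm (complex_of_real (\<sigma> v) + z)" using multiplier_bound[OF z] by metis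
  show thesis
  proof (rule that[of "1 / d"])
    show "R z \<in> borel_measurable borel" unfolding R_def by measurable
    fix v
    show "complex_of_real (\<sigma> v) + z \<noteq> 0" using d(1) d(2)[of v] by auto
    show "norm (R z v) \<le> 1 / d" unfolding R_def norm_divide using d(1) d(2)[of v] by (simp add: frac_le)
  qed
qed

definition T :: "complex \<Rightarrow> ('a, complex) l2 \<Rightarrow> ('a, complex) l2" where
  "T z x = multiplication_operator (R z) (kernel_operator k x)"

context
  fixes z :: complex
  assumes z: "z \<notin> complex_of_real ` {..-\<nu>}"
begin

lemma bounded_linear_T: "bounded_linear (T z)"
proof -
  obtain C where C: "R z \<in> borel_measurable borel" "\<And>v. norm (R z v) \<le> C"
    using R_props[OF z] by metis
  show ?thesis unfolding T_def[abs_def]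
    by (rule bounded_linear_compose[OF bounded_linear_multiplication_operator[OF C] bounded_linear_kernel_operator[OF schur]])
qed

lemma compact_T: "compact_operator (T z)"
proof -
  obtain C where C: "R z \<in> borel_measurable borel" "\<And>v. norm (R z v) \<le> C"
    using R_props[OF z] by metis
  show ?thesis unfolding T_def[abs_def]
    by (rule compact_operator_comp_left[OF bounded_linear_multiplication_operator[OF C] compact])
qed

lemma square_integrable_R:
  assumes "square_integrable f" shows "square_integrable (\<lambda>v. R z v * f v)"
  by (rule R_props[OF z]) (rule square_integrable_multiplication[OF _ _ assms], auto)

lemma T_abs:
  assumes f: "square_integrable f"
  shows "T z (abs_l2 f) = abs_l2 (\<lambda>v. R z v * kernel_integral k f v)"
  unfolding T_def kernel_operator_abs[OF schur f]
  by (rule R_props[OF z]) (rule multiplication_operator_abs[OF _ _ square_integrable_K[OF f]], auto)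

text \<open>The resolvent equation divided by the multiplier.\<close>
lemma one_minus_T_iff:
  assumes f: "square_integrable f" and g: "square_integrable g"
  shows "abs_l2 f - T z (abs_l2 f) = - abs_l2 (\<lambda>v. R z v * g v) \<longleftrightarrow>
     dom f \<and> (AE v in lborel. L f v - z * f v = g v)"
proof -
  have nz: "complex_of_real (\<sigma> v) + z \<noteq> 0" for v using R_props[OF z] by metis
  have "abs_l2 f - T z (abs_l2 f) = - abs_l2 (\<lambda>v. R z v * g v) \<longleftrightarrow>
      abs_l2 f + abs_l2 (\<lambda>v. R z v * g v) = abs_l2 (\<lambda>v. R z v * kernel_integral k f v)"
    unfolding T_abs[OF f] by (simp add: algebra_simps)
  also have "\<dots> \<longleftrightarrow> (AE v in lborel. f v + R z v * g v = R z v * kernel_integral k f v)"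
    by (simp add: abs_l2_add abs_l2_eq_iff f g square_integrable_R square_integrable_add square_integrable_K)
  also have "\<dots> \<longleftrightarrow> (AE v in lborel. L f v - z * f v = g v)"
  proof (intro arg_cong[where f = "\<lambda>P. AE v in lborel. P v"] ext)
    fix v
    show "f v + R z v * g v = R z v * kernel_integral k f v \<longleftrightarrow> L f v - z * f v = g v"
      unfolding R_def L_def using nz[of v] by (simp add: field_simps) (auto simp: algebra_simps)
  qed
  also have "\<dots> \<longleftrightarrow> dom f \<and> (AE v in lborel. L f v - z * f v = g v)"
  proof safe
    \<comment> \<open>The equation itself puts \<open>f\<close> into the domain:
      \<open>\<sigma> f\<close> agrees almost everywhere with \<open>K f - z f - g\<close>.\<close>
    assume ae: "AE v in lborel. L f v - z * f v = g v"
    have m [measurable]: "f \<in> borel_measurable borel" using f by (rule square_integrable_measurable)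
    have "square_integrable (\<lambda>v. kernel_integral k f v - z * f v - g v)"
      by (intro square_integrable_diff square_integrable_K f g square_integrable_cmult)
    then have "square_integrable (\<lambda>v. complex_of_real (\<sigma> v) * f v)"
      by (rule square_integrable_cong_AE) (use ae in \<open>auto simp: L_def algebra_simps elim: AE_mp\<close>)
    then show "dom f" by (rule domI[OF f])
  qed
  finally show ?thesis .
qed

lemma T_fixed_iff:
  assumes f: "square_integrable f"
  shows "T z (abs_l2 f) = abs_l2 f \<longleftrightarrow> eigenfunction z f"
  using one_minus_T_iff[OF f square_integrable_zero] zero_l2_abs[where 'a='a and 'b=complex, symmetric]
  by (auto simp: eigenfunction_def)

lemma regular_if_not_eigenvalue:
  assumes ne: "\<not> eigenvalue z" shows "regular z"
proof -
  obtain C where C: "R z \<in> borel_measurable borel" "\<And>v. norm (R z v) \<le> C"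
    using R_props[OF z] by metis
  have C0: "0 \<le> C" using order_trans[OF norm_ge_zero C(2)] .
  have "x = 0" if "T z x = x" for x
  proof (cases x rule: l2_cases)
    fix f assume f: "square_integrable f" "x = abs_l2 f"
    then have "AE v in lborel. f v = 0" using that ne T_fixed_iff[OF f(1)] by (auto simp: eigenvalue_def)
    then show "x = 0" using f by (simp add: abs_l2_eq_0_iff)
  qed
  then obtain c where c: "c > 0" "\<And>x. c * norm x \<le> norm (x - T z x)" "\<And>y. \<exists>x. x - T z x = y"
    using fredholm_alternative[OF bounded_linear_T compact_T] by metis
  have "norm (abs_l2 f) \<le> C / c * norm (abs_l2 (\<lambda>v. L f v - z * f v))" if f: "dom f" for f
  proof -
    note ff = domD[OF f]
    let ?g = "\<lambda>v. L f v - z * f v"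
    have g: "square_integrable ?g" by (intro square_integrable_diff square_integrable_cmult ff)
    have "c * norm (abs_l2 f) \<le> norm (abs_l2 f - T z (abs_l2 f))" by (rule c)
    also have "abs_l2 f - T z (abs_l2 f) = - abs_l2 (\<lambda>v. R z v * ?g v)"
      using one_minus_T_iff[OF ff(1) g] f by simp
    also have "abs_l2 (\<lambda>v. R z v * ?g v) = multiplication_operator (R z) (abs_l2 ?g)"
      by (rule multiplication_operator_abs[OF C g, symmetric])
    also have "norm (- \<dots>) \<le> C * norm (abs_l2 ?g)"
      using norm_multiplication_operator[OF C] by simp
    finally show ?thesis using c(1) by (simp add: field_simps)
  qed
  moreover have "\<exists>f. dom f \<and> (AE v in lborel. L f v - z * f v = g v)" if g: "square_integrable g" for g
  proof -
    obtain x where x: "x - T z x = - abs_l2 (\<lambda>v. R z v * g v)" using c(3) by blast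
    obtain f where f: "square_integrable f" "x = abs_l2 f" by (rule l2_cases)
    show ?thesis using one_minus_T_iff[OF f(1) g] x f(2) by blast
  qed
  ultimately show ?thesis unfolding regular_def by blast
qed

text \<open>The eigenspace is the fixed space of the compact operator \<open>T z\<close>. Its
  spanning set and coefficients come from the real vector space structure; real coefficients are
  then read as complex ones, and classes are replaced by representatives, which differ for different
  classes.\<close>

lemma eigenspace_finite_dim:
  obtains B :: "('a \<Rightarrow> complex) set" where "finite B"
    "\<And>f. eigenfunction z f \<Longrightarrow> \<exists>c. AE v in lborel. f v = (\<Sum>b\<in>B. c b * b v)"
proof -
  obtain S where S: "finite S" "{x. T z x = x} \<subseteq> span S"
    using compact_operator_fixed_points_finite_dim[OF bounded_linear.linear[OF bounded_linear_T] compact_T] .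
  have inj: "inj_on rep_l2 S" by (rule inj_on_inverseI[of _ abs_l2]) (rule abs_l2_rep_l2)
  show thesis
  proof (rule that[of "rep_l2 ` S"])
    fix f assume "eigenfunction z f"
    then have f: "square_integrable f" "T z (abs_l2 f) = abs_l2 f"
      using T_fixed_iff domD(1) by (auto simp: eigenfunction_def)
    then obtain c where c: "abs_l2 f = (\<Sum>b\<in>S. c b *\<^sub>R b)"
      using S span_finite[OF S(1)] by auto
    have sum: "square_integrable (\<lambda>v. \<Sum>b\<in>S'. c b *\<^sub>R rep_l2 b v) \<and>
       (\<Sum>b\<in>S'. c b *\<^sub>R b) = abs_l2 (\<lambda>v. \<Sum>b\<in>S'. c b *\<^sub>R rep_l2 b v)" if "finite S'" for S'
      using that
    proof induction
      case (insert b S')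
      have "c b *\<^sub>R b = abs_l2 (\<lambda>v. c b *\<^sub>R rep_l2 b v)"
        using abs_l2_scaleR[OF square_integrable_rep_l2, of "c b" b] by (simp add: abs_l2_rep_l2)
      with insert show ?case
        by (simp add: abs_l2_add square_integrable_add square_integrable_scaleR square_integrable_rep_l2)
    qed (simp add: zero_l2_abs)
    have "AE v in lborel. f v = (\<Sum>b\<in>S. c b *\<^sub>R rep_l2 b v)"
      using c sum[OF S(1)] f(1) by (simp add: abs_l2_eq_iff)
    moreover have "(\<Sum>b\<in>rep_l2 ` S. complex_of_real (c (abs_l2 b)) * b v) = (\<Sum>b\<in>S. c b *\<^sub>R rep_l2 b v)" for v
      by (simp add: sum.reindex[OF inj] abs_l2_rep_l2 scaleR_conv_of_real)
    ultimately show "\<exists>c. AE v in lborel. f v = (\<Sum>b\<in>rep_l2 ` S. c b * b v)"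
      by (intro exI[of _ "\<lambda>b. complex_of_real (c (abs_l2 b))"]) simp
  qed (use S in simp)
qed

end

section \<open>Points of the spectrum and accumulation of eigenvalues\<close>

lemma eigenvalue_not_regular:
  assumes "eigenvalue z" shows "\<not> regular z"
proof
  assume "regular z"
  then obtain C where C: "\<And>f. dom f \<Longrightarrow> norm (abs_l2 f) \<le> C * norm (abs_l2 (\<lambda>v. L f v - z * f v))"
    by (auto simp: regular_def)
  obtain f where f: "dom f" "AE v in lborel. L f v = z * f v" "\<not> (AE v in lborel. f v = 0)"
    using assms by (auto simp: eigenvalue_def eigenfunction_def)
  note ff = domD[OF f(1)]
  have "abs_l2 (\<lambda>v. L f v - z * f v) = 0"
    using f(2) by (subst abs_l2_eq_0_iff) (auto intro!: square_integrable_diff square_integrable_cmult ff elim: AE_mp)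
  then have "abs_l2 f = 0" using C[OF f(1)] by simp
  then show False using f(3) ff(1) by (simp add: abs_l2_eq_0_iff)
qed

text \<open>Normalised indicators of disjoint annuli around a point where \<open>\<sigma>\<close> takes the value \<open>- t\<close>
  form an approximate eigenvector sequence; compactness of the kernel operator makes a difference
  of two of them an approximate eigenvector of the whole operator.\<close>
lemma half_line_not_regular:
  assumes t: "t \<le> - \<nu>" shows "\<not> regular (complex_of_real t)"
proof
  assume "regular (complex_of_real t)"
  then obtain C where C: "\<And>f. dom f \<Longrightarrow> norm (abs_l2 f) \<le> C * norm (abs_l2 (\<lambda>v. L f v - complex_of_real t * f v))"
    by (auto simp: regular_def)
  \<comment> \<open>The test function will have norm \<open>sqrt 2\<close> and residual at most
    \<open>e + e * sqrt 2\<close>, hence at most \<open>3 * e\<close>; this \<open>e\<close> makes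
    \<open>\<bar>C\<bar> * (3 * e)\<close> less than 1.\<close>
  define e where "e = 1 / (3 * (\<bar>C\<bar> + 1))"
  have e: "e > 0" by (simp add: e_def)
  have "- t \<in> range \<sigma>" using t range_\<sigma> by simp
  then obtain p where p: "\<sigma> p = - t" by auto
  have "isCont \<sigma> p" using continuous_\<sigma> by (simp add: continuous_on_eq_continuous_at)
  then obtain \<delta> where \<delta>: "\<delta> > 0" "\<And>v. dist v p < \<delta> \<Longrightarrow> dist (\<sigma> v) (\<sigma> p) < e"
    using e unfolding continuous_at_eps_delta by blast
  define S where "S n = ball p (\<delta> / real (n + 1)) - cball p (\<delta> / real (n + 2))" for n
  have Sdist: "dist v p < \<delta>" if "v \<in> S n" for v n
  proof -
    have "dist v p < \<delta> / real (n + 1)" using that by (simp add: S_def dist_commute)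
    also have "\<dots> \<le> \<delta>" using \<delta>(1) by (simp add: field_simps)
    finally show ?thesis .
  qed
  have disj: "S i \<inter> S j = {}" if "i < j" for i j
  proof -
    have "\<delta> / real (j + 1) \<le> \<delta> / real (i + 2)" using that \<delta>(1) by (intro divide_left_mono) auto
    then show ?thesis by (fastforce simp: S_def)
  qed
  have [measurable]: "S n \<in> sets borel" for n by (simp add: S_def)
  define M where "M n = measure lborel (S n)" for n
  have bS: "bounded (S n)" for n
    by (rule bounded_subset[OF bounded_ball[of p "\<delta> / real (n + 1)"]]) (auto simp: S_def)
  have Sfin: "emeasure lborel (S n) = ennreal (M n)" for n
    unfolding M_def by (rule emeasure_eq_ennreal_measure) (use emeasure_bounded_finite[OF bS[of n]] in auto)
  have M: "0 < M n" for n
  proof -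
    obtain b :: 'a where b: "b \<in> Basis" by (meson nonempty_Basis ex_in_conv)
    have "\<delta> / real (n + 2) < \<delta> / real (n + 1)" using \<delta>(1) by (intro divide_strict_left_mono) auto
    then obtain r where r: "\<delta> / real (n + 2) < r" "r < \<delta> / real (n + 1)" using dense by blast
    have "0 < \<delta> / real (n + 2)" using \<delta>(1) by simp
    then have "0 < r" using r(1) by linarith
    then have "p + r *\<^sub>R b \<in> S n" using r b by (simp add: S_def dist_norm)
    moreover have "open (S n)" by (simp add: S_def open_Diff)
    ultimately have "\<not> negligible (S n)"
      using open_not_negligible[of "S n"] by blast
    then have "\<not> S n \<in> null_sets lborel"
      by (auto simp: negligible_iff_null_sets null_sets_completionI)
    then have "emeasure lborel (S n) \<noteq> 0" by (simp add: null_sets_def)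
    then show ?thesis using Sfin[of n] by (simp add: M_def less_le)
  qed
  define f where "f n v = complex_of_real (indicator (S n) v / sqrt (M n))" for n v
  have [measurable]: "f n \<in> borel_measurable borel" for n unfolding f_def by measurable
  have nf: "(norm (f n v))\<^sup>2 = indicator (S n) v / M n" for n v
    using M[of n] by (simp add: f_def norm_divide power_divide indicator_def)
  have fsi: "square_integrable (f n)" for n
  proof -
    have "integrable lborel (\<lambda>v. indicator (S n) v / M n)" using Sfin[of n] by (simp add: less_top)
    then show ?thesis by (simp add: square_integrable_def nf)
  qed
  have f0: "f n v = 0" if "v \<notin> S n" for n v using that by (simp add: f_def)
  define x where "x n = abs_l2 (f n)" for n
  have x1: "norm (x n) = 1" for n
    using M[of n] by (simp add: x_def norm_abs_l2[OF fsi] nf) (simp add: M_def)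
  have x0: "x i \<bullet> x j = 0" if "i < j" for i j
  proof -
    have "f i v \<bullet> f j v = 0" for v using disj[OF that] by (metis disjoint_iff f0 inner_zero_left inner_zero_right)
    then show ?thesis by (simp add: x_def abs_l2_inner fsi)
  qed
  obtain i j where ij: "i < j" "norm (kernel_operator k (x i) - kernel_operator k (x j)) < e"
    using compact_operatorD[OF compact e, of x] x1 by (metis order_refl)
  define g where "g v = f i v - f j v" for v
  have gsi: "square_integrable g" unfolding g_def by (intro square_integrable_diff fsi)
  have g_eq: "abs_l2 g = x i - x j" by (simp add: g_def[abs_def] x_def abs_l2_diff fsi)
  have "(norm (x i - x j))\<^sup>2 = 2"
    using x1[of i] x1[of j] x0[OF ij(1)]
    by (simp add: power2_norm_eq_inner inner_diff_left inner_diff_right inner_commute norm_eq_1)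
  then have ng: "norm (abs_l2 g) = sqrt 2" unfolding g_eq by (simp add: real_sqrt_unique)
  have [measurable]: "g \<in> borel_measurable borel" using gsi by (rule square_integrable_measurable)
  define h where "h v = complex_of_real (\<sigma> v + t) * g v" for v
  have hb: "norm (h v) \<le> e * norm (g v)" for v
  proof (cases "v \<in> S i \<union> S j")
    case True
    then have "dist (\<sigma> v) (\<sigma> p) < e" using \<delta>(2) Sdist by blast
    then have "\<bar>\<sigma> v + t\<bar> \<le> e" using p by (simp add: dist_real_def)
    then show ?thesis unfolding h_def norm_mult norm_of_real by (intro mult_right_mono) auto
  next
    case False then show ?thesis by (simp add: h_def g_def f0)
  qed
  have [measurable]: "h \<in> borel_measurable borel" unfolding h_def by measurable
  have hsi: "square_integrable h" by (rule square_integrable_bound[OF gsi]) (use hb in auto)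
  have dg: "dom g"
  proof (rule domI[OF gsi])
    have "(\<lambda>v. complex_of_real (\<sigma> v) * g v) = (\<lambda>v. h v - complex_of_real t * g v)"
      by (auto simp: h_def algebra_simps)
    then show "square_integrable (\<lambda>v. complex_of_real (\<sigma> v) * g v)"
      using square_integrable_diff[OF hsi square_integrable_cmult[OF gsi]] by simp
  qed
  have nh: "norm (abs_l2 h) \<le> e * sqrt 2"
  proof (rule norm_abs_l2_le_nn[OF hsi])
    have "(\<integral>\<^sup>+v. ennreal ((norm (h v))\<^sup>2) \<partial>lborel) \<le> (\<integral>\<^sup>+v. ennreal (e\<^sup>2) * ennreal ((norm (g v))\<^sup>2) \<partial>lborel)"
      by (intro nn_integral_mono)
         (use hb in \<open>auto simp: ennreal_mult[symmetric] power_mult_distrib[symmetric] intro!: power_mono\<close>)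
    also have "\<dots> = ennreal ((e * sqrt 2)\<^sup>2)"
      by (simp add: nn_integral_cmult norm_abs_l2_nn[OF gsi] ng power_mult_distrib ennreal_mult)
    finally show "(\<integral>\<^sup>+v. ennreal ((norm (h v))\<^sup>2) \<partial>lborel) \<le> ennreal ((e * sqrt 2)\<^sup>2)" .
  qed (use e in simp)
  have "(\<lambda>v. L g v - complex_of_real t * g v) = (\<lambda>v. kernel_integral k g v - h v)"
    by (auto simp: L_def h_def algebra_simps)
  then have "abs_l2 (\<lambda>v. L g v - complex_of_real t * g v) = kernel_operator k (abs_l2 g) - abs_l2 h"
    by (simp add: abs_l2_diff hsi square_integrable_K gsi kernel_operator_abs[OF schur])
  also have "kernel_operator k (abs_l2 g) = kernel_operator k (x i) - kernel_operator k (x j)"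
    unfolding g_eq by (rule linear_diff[OF bounded_linear.linear[OF bounded_linear_kernel_operator[OF schur]]])
  finally have "norm (abs_l2 (\<lambda>v. L g v - complex_of_real t * g v)) \<le> e + e * sqrt 2"
    using norm_triangle_ineq4[of "kernel_operator k (x i) - kernel_operator k (x j)" "abs_l2 h"] ij(2) nh by simp
  also have "\<dots> \<le> 3 * e" using e sqrt2_less_2 by (simp add: field_simps)
  finally have "C * norm (abs_l2 (\<lambda>v. L g v - complex_of_real t * g v)) \<le> \<bar>C\<bar> * (3 * e)"
    by (meson abs_ge_self abs_ge_zero mult_mono norm_ge_zero)
  with C[OF dg] ng have "sqrt 2 \<le> \<bar>C\<bar> * (3 * e)" by simp
  also have "\<dots> < 1" by (simp add: e_def)
  finally show False by (simp add: real_less_lsqrt)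
qed

lemma not_regular_iff:
  "\<not> regular z \<longleftrightarrow> z \<in> complex_of_real ` {..-\<nu>} \<or> eigenvalue z"
  using half_line_not_regular eigenvalue_not_regular regular_if_not_eigenvalue by auto

text \<open>Eigenfunctions of distinct eigenvalues are orthogonal, so normalised ones stay
  \<open>sqrt 2\<close> apart. For eigenvalues near one point above \<open>- \<nu>\<close> they can
  be recovered boundedly from their images under \<open>K\<close>, and compactness brings two of
  these images together.\<close>

lemma eigenvalues_no_limit_point:
  assumes p: "- \<nu> < p" shows "\<not> p islimpt {x. eigenvalue (complex_of_real x)}"
proof
  let ?E = "{x. eigenvalue (complex_of_real x)}"
  assume lim: "p islimpt ?E"
  \<comment> \<open>Half the distance from \<open>p\<close> to \<open>- \<nu>\<close>. Within
    \<open>d / 8\<close> of \<open>p\<close>, eigenvalues satisfy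
    \<open>d \<le> \<sigma> v + l i\<close> and differ mutually by at most
    \<open>d / 4\<close>.\<close>
  define d where "d = (p + \<nu>) / 2"
  have d: "d > 0" using p by (simp add: d_def)
  have "infinite (?E \<inter> ball p (d / 8))" using lim d by (simp add: islimpt_eq_infinite_ball)
  then obtain l :: "nat \<Rightarrow> real" where l: "inj l" "range l \<subseteq> ?E \<inter> ball p (d / 8)"
    using infinite_countable_subset by blast
  have lb: "\<bar>l n - p\<bar> < d / 8" "eigenvalue (complex_of_real (l n))" for n
  proof -
    have "l n \<in> ?E \<inter> ball p (d / 8)" using l(2) by blast
    then show "\<bar>l n - p\<bar> < d / 8" "eigenvalue (complex_of_real (l n))"
      by (auto simp: dist_real_def abs_minus_commute)
  qed
  have "\<exists>f. eigenfunction (complex_of_real (l n)) f \<and> norm (abs_l2 f) = 1" for n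
  proof -
    obtain f where f: "dom f" "AE v in lborel. L f v = complex_of_real (l n) * f v" "\<not> (AE v in lborel. f v = 0)"
      using lb(2)[of n] by (auto simp: eigenvalue_def eigenfunction_def)
    note ff = domD[OF f(1)]
    define c where "c = complex_of_real (1 / norm (abs_l2 f))"
    have n0: "norm (abs_l2 f) \<noteq> 0" using f(3) ff(1) by (simp add: abs_l2_eq_0_iff)
    have "dom (\<lambda>v. c * f v)"
      by (rule domI) (use ff in \<open>auto intro!: square_integrable_cmult simp: mult.left_commute[of _ c]\<close>)
    moreover have "AE v in lborel. L (\<lambda>v. c * f v) v = complex_of_real (l n) * (c * f v)"
      using f(2) by eventually_elim (simp add: L_def kernel_integral_cmult algebra_simps)
    moreover have "abs_l2 (\<lambda>v. c * f v) = (1 / norm (abs_l2 f)) *\<^sub>R abs_l2 f"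
      by (simp add: abs_l2_scaleR ff c_def scaleR_conv_of_real)
    ultimately show ?thesis using n0 by (intro exI[of _ "\<lambda>v. c * f v"]) (simp add: eigenfunction_def)
  qed
  then obtain f where f: "\<And>n. eigenfunction (complex_of_real (l n)) (f n)" "\<And>n. norm (abs_l2 (f n)) = 1"
    by metis
  have df: "dom (f n)" and Lf: "AE v in lborel. L (f n) v = l n * f n v" for n
    using f(1)[of n] by (auto simp: eigenfunction_def)
  note ff = domD[OF df]
  define x where "x n = abs_l2 (f n)" for n
  have [measurable]: "f n \<in> borel_measurable borel" "L (f n) \<in> borel_measurable borel" for n
    using ff[of n] by (auto simp: square_integrable_def)
  have x0: "x i \<bullet> x j = 0" if "i < j" for i j
  proof -
    have "(\<integral>v. L (f i) v \<bullet> f j v \<partial>lborel) = (\<integral>v. l i * (f i v \<bullet> f j v) \<partial>lborel)"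
    proof (rule integral_cong_AE)
      show "AE v in lborel. L (f i) v \<bullet> f j v = l i * (f i v \<bullet> f j v)"
        using Lf[of i] by eventually_elim (simp add: scaleR_conv_of_real[symmetric])
    qed auto
    moreover have "(\<integral>v. f i v \<bullet> L (f j) v \<partial>lborel) = (\<integral>v. l j * (f i v \<bullet> f j v) \<partial>lborel)"
    proof (rule integral_cong_AE)
      show "AE v in lborel. f i v \<bullet> L (f j) v = l j * (f i v \<bullet> f j v)"
        using Lf[of j] by eventually_elim (simp add: scaleR_conv_of_real[symmetric])
    qed auto
    ultimately have "l i * (x i \<bullet> x j) = l j * (x i \<bullet> x j)"
      using L_symmetric[OF df df, of i j] by (auto simp: x_def abs_l2_inner ff)
    then have "(l i - l j) * (x i \<bullet> x j) = 0" by (simp add: left_diff_distrib)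
    moreover have "l i \<noteq> l j" using l(1) that by (auto dest: injD)
    ultimately show ?thesis by simp
  qed
  obtain i j where ij: "i < j" "norm (kernel_operator k (x i) - kernel_operator k (x j)) < d / 4"
    using compact_operatorD[OF compact, of "d / 4" x] d f(2) unfolding x_def by (metis order_refl divide_pos_pos zero_less_numeral)
  define h where "h v = R (complex_of_real (l i)) v" for v
  have \<sigma>l: "d \<le> \<sigma> v + l i" for v
  proof -
    have "p + \<nu> = 2 * d" by (simp add: d_def)
    then show ?thesis using \<sigma>_ge[of v] lb(1)[of i] d by linarith
  qed
  have hm [measurable]: "h \<in> borel_measurable borel" unfolding h_def R_def by measurable
  have hb: "norm (h v) \<le> 1 / d" for v
  proof -
    have "norm (h v) = 1 / (\<sigma> v + l i)"
      unfolding h_def R_def of_real_add[symmetric] norm_divide norm_of_real using \<sigma>l[of v] d by simp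
    also have "\<dots> \<le> 1 / d" using \<sigma>l[of v] d by (simp add: frac_le)
    finally show ?thesis .
  qed
  \<comment> \<open>Subtracting the two eigenvalue equations gives that
    \<open>\<sigma> + l i\<close> times \<open>f i - f j\<close> equals
    \<open>K (f i) - K (f j) + (l j - l i) f j\<close>. The right side has norm at most
    \<open>d / 2\<close> and the divisor is at least \<open>d\<close>, so the distance is at most
    1/2.\<close>
  let ?y = "kernel_operator k (x i) - kernel_operator k (x j) + (l j - l i) *\<^sub>R x j"
  let ?F = "\<lambda>v. kernel_integral k (f i) v - kernel_integral k (f j) v + (l j - l i) *\<^sub>R f j v"
  have F: "square_integrable ?F"
    by (intro square_integrable_add square_integrable_diff square_integrable_K square_integrable_scaleR ff)
  have "?y = abs_l2 ?F"
    by (simp add: x_def kernel_operator_abs[OF schur] ff abs_l2_diff abs_l2_scaleR abs_l2_add square_integrable_K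
        square_integrable_diff square_integrable_scaleR)
  then have "multiplication_operator h ?y = abs_l2 (\<lambda>v. h v * ?F v)"
    using multiplication_operator_abs[OF hm hb F] by simp
  also have "\<dots> = abs_l2 (\<lambda>v. f i v - f j v)"
  proof (subst abs_l2_eq_iff)
    show "AE v in lborel. h v * ?F v = f i v - f j v"
      using Lf[of i] Lf[of j]
    proof eventually_elim
      case (elim v)
      have nz: "complex_of_real (\<sigma> v) + complex_of_real (l i) \<noteq> 0"
        using \<sigma>l[of v] d unfolding of_real_add[symmetric] of_real_eq_0_iff by simp
      have "?F v = (complex_of_real (\<sigma> v) + complex_of_real (l i)) * (f i v - f j v)"
        using elim by (simp add: L_def scaleR_conv_of_real algebra_simps)
      then show ?case using nz by (simp add: h_def R_def)
    qed
  qed (auto intro!: square_integrable_diff ff square_integrable_multiplication[OF hm hb] F)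
  also have "\<dots> = x i - x j" by (simp add: x_def abs_l2_diff ff)
  finally have "x i - x j = multiplication_operator h ?y" ..
  then have "norm (x i - x j) \<le> 1 / d * norm ?y" using norm_multiplication_operator[OF hm hb] by simp
  also have "norm ?y \<le> d / 4 + \<bar>l j - l i\<bar>"
    using norm_triangle_ineq[of "kernel_operator k (x i) - kernel_operator k (x j)" "(l j - l i) *\<^sub>R x j"] ij(2) f(2)[of j]
    by (simp add: x_def)
  also have "\<bar>l j - l i\<bar> \<le> d / 4" using lb(1)[of i] lb(1)[of j] by linarith
  finally have "norm (x i - x j) \<le> 1 / 2" using d by (simp add: field_simps)
  then have "(norm (x i - x j))\<^sup>2 \<le> (1 / 2)\<^sup>2" by (intro power_mono) auto
  moreover have "(norm (x i - x j))\<^sup>2 = 2"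
    using f(2)[of i] f(2)[of j] x0[OF ij(1)]
    by (simp add: power2_norm_eq_inner inner_diff_left inner_diff_right inner_commute norm_eq_1 x_def)
  ultimately show False by (simp add: power2_eq_square)
qed

text \<open>For real \<open>x\<close> the operator \<open>L - x\<close> is symmetric, so the squared
  norm of the last nonzero link is the pairing of its predecessor with its own image under
  \<open>L - x\<close>, which vanishes. The chain therefore shortens to one step; this is
  semisimplicity.\<close>

lemma generalized_eigenfunction:
  assumes chain: "\<And>j. j < n \<Longrightarrow> dom (g j) \<and> (AE v in lborel. g (Suc j) v = L (g j) v - complex_of_real x * g j v)"
    and g0: "square_integrable (g 0)" and gn: "AE v in lborel. g n v = 0"
  shows "eigenfunction (complex_of_real x) (g 0)"
  using chain gn
proof (induction n)
  \<comment> \<open>A chain of length 0 forces \<open>g 0\<close> to vanish almost everywhere;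
    \<open>eigenfunction\<close> admits such null functions.\<close>
  case 0
  have "kernel_integral k (g 0) v = 0" for v
    using kernel_integral_cong_AE[OF k_measurable square_integrable_measurable[OF g0] _ 0(2), of v]
    by (simp add: kernel_integral_def)
  then have *: "AE v in lborel. L (g 0) v = complex_of_real x * g 0 v"
    using 0(2) by (auto simp: L_def elim: AE_mp)
  have "square_integrable (\<lambda>v. complex_of_real (\<sigma> v) * g 0 v)"
    by (rule square_integrable_cong_AE[OF square_integrable_zero])
       (use 0(2) square_integrable_measurable[OF g0] in \<open>auto elim: AE_mp\<close>)
  with * show ?case by (simp add: eigenfunction_def domI[OF g0])
next
  case (Suc n)
  show ?case
  proof (cases n)
    case 0
    have "AE v in lborel. L (g 0) v = complex_of_real x * g 0 v"
      using Suc.prems(1)[of 0] Suc.prems(2) 0 by (auto elim: AE_mp)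
    then show ?thesis using Suc.prems(1)[of 0] by (auto simp: eigenfunction_def)
  next
    case (Suc j)
    have j: "dom (g j)" "AE v in lborel. g n v = L (g j) v - complex_of_real x * g j v"
      and n: "dom (g n)" "AE v in lborel. g (Suc n) v = L (g n) v - complex_of_real x * g n v"
      using Suc.prems(1)[of j] Suc.prems(1)[of n] Suc by auto
    note jj = domD[OF j(1)] and nn = domD[OF n(1)]
    have [measurable]: "g j \<in> borel_measurable borel" "L (g j) \<in> borel_measurable borel"
       "g n \<in> borel_measurable borel" "L (g n) \<in> borel_measurable borel"
      using jj nn by (auto simp: square_integrable_def)
    have "(\<integral>v. g n v \<bullet> g n v \<partial>lborel) = (\<integral>v. L (g j) v \<bullet> g n v - x * (g j v \<bullet> g n v) \<partial>lborel)"
    proof (rule integral_cong_AE)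
      show "AE v in lborel. g n v \<bullet> g n v = L (g j) v \<bullet> g n v - x * (g j v \<bullet> g n v)"
        using j(2)
      proof eventually_elim
        case (elim v)
        have "g n v \<bullet> g n v = (L (g j) v - complex_of_real x * g j v) \<bullet> g n v" using elim by simp
        then show ?case by (simp add: inner_diff_left scaleR_conv_of_real[symmetric])
      qed
    qed auto
    also have "\<dots> = (\<integral>v. L (g j) v \<bullet> g n v \<partial>lborel) - x * (\<integral>v. g j v \<bullet> g n v \<partial>lborel)"
      by (simp add: square_integrable_inner jj nn)
    also have "\<dots> = (\<integral>v. g j v \<bullet> L (g n) v \<partial>lborel) - x * (\<integral>v. g j v \<bullet> g n v \<partial>lborel)"
      by (simp add: L_symmetric[OF j(1) n(1)])
    also have "\<dots> = (\<integral>v. g j v \<bullet> L (g n) v - x * (g j v \<bullet> g n v) \<partial>lborel)"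
      by (simp add: square_integrable_inner jj nn)
    also have "\<dots> = 0"
    proof (rule integral_eq_zero_AE)
      show "AE v in lborel. g j v \<bullet> L (g n) v - x * (g j v \<bullet> g n v) = 0"
        using n(2) Suc.prems(2)
      proof eventually_elim
        case (elim v)
        then have "L (g n) v = x *\<^sub>R g n v" by (simp add: scaleR_conv_of_real)
        then show ?case by simp
      qed
    qed
    finally have "abs_l2 (g n) \<bullet> abs_l2 (g n) = 0" by (simp add: abs_l2_inner nn)
    then have "abs_l2 (g n) = 0" by simp
    then have "AE v in lborel. g n v = 0" by (simp add: abs_l2_eq_0_iff nn)
    then show ?thesis using Suc.IH Suc.prems(1) by simp
  qed
qed

end

section \<open>Polar coordinates and Gaussian integrals\<close>

lemma nn_integral_lborel_affine:
  fixes f :: "'a::euclidean_space \<Rightarrow> ennreal"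
  assumes [measurable]: "f \<in> borel_measurable borel" and c: "c \<noteq> 0"
  shows "(\<integral>\<^sup>+x. f x \<partial>lborel) = ennreal (\<bar>c\<bar> ^ DIM('a)) * (\<integral>\<^sup>+x. f (t + c *\<^sub>R x) \<partial>lborel)"
  by (subst lborel_affine[OF c, of t])
     (simp add: nn_integral_density nn_integral_distr nn_integral_cmult)

lemma nn_integral_lborel_translate:
  fixes f :: "'a::euclidean_space \<Rightarrow> ennreal"
  assumes "f \<in> borel_measurable borel"
  shows "(\<integral>\<^sup>+x. f (t + x) \<partial>lborel) = (\<integral>\<^sup>+x. f x \<partial>lborel)"
  using nn_integral_lborel_affine[OF assms, of 1 t] by simp

lemma nn_integral_lborel_reflect:
  fixes f :: "'a::euclidean_space \<Rightarrow> ennreal"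
  assumes "f \<in> borel_measurable borel"
  shows "(\<integral>\<^sup>+x. f (- x) \<partial>lborel) = (\<integral>\<^sup>+x. f x \<partial>lborel)"
  using nn_integral_lborel_affine[OF assms, of "-1" 0] by simp

text \<open>Lebesgue measure is determined by boxes, and the preimage of a box is its image under
  the inverse map, which is again orthogonal.\<close>

lemma distr_lborel_orthogonal:
  fixes Q :: "real^'n::{finite,wellorder} \<Rightarrow> real^'n::_"
  assumes Q: "orthogonal_transformation Q"
  shows "distr lborel borel Q = lborel"
proof (rule lborel_eqI[symmetric])
  have linQ: "linear Q" using Q by (rule orthogonal_transformation_linear)
  have [measurable]: "Q \<in> borel_measurable borel"
    by (intro borel_measurable_continuous_onI linear_continuous_on linear_conv_bounded_linear[THEN iffD1] linQ)
  have Qi: "orthogonal_transformation (inv Q)" using Q by (rule orthogonal_transformation_inv)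
  have bij: "bij Q" using Q by (rule orthogonal_transformation_bij)
  fix l u :: "real^'n::_" assume le: "\<And>b. b \<in> Basis \<Longrightarrow> l \<bullet> b \<le> u \<bullet> b"
  have im: "inv Q ` box l u = Q -` box l u" using bij by (simp add: bij_vimage_eq_inv_image)
  have [measurable]: "Q -` box l u \<in> sets borel" by (rule measurable_sets_borel[of Q borel]) auto
  have "emeasure (distr lborel borel Q) (box l u) = emeasure lborel (Q -` box l u)"
    by (simp add: emeasure_distr)
  also have "\<dots> = emeasure lebesgue (inv Q ` box l u)" unfolding im by simp
  also have "\<dots> = ennreal (measure lebesgue (inv Q ` box l u))"
    by (intro emeasure_eq_measure2 measurable_orthogonal_image[OF Qi]) simp
  also have "\<dots> = (\<Prod>b\<in>Basis. (u - l) \<bullet> b)"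
    using le by (simp add: measure_orthogonal_image[OF Qi])
  finally show "emeasure (distr lborel borel Q) (box l u) = (\<Prod>b\<in>Basis. (u - l) \<bullet> b)" .
qed simp

lemma nn_integral_lborel_orthogonal:
  fixes Q :: "real^'n::{finite,wellorder} \<Rightarrow> real^'n::_"
  assumes Q: "orthogonal_transformation Q" and [measurable]: "f \<in> borel_measurable borel"
  shows "(\<integral>\<^sup>+x. f (Q x) \<partial>lborel) = (\<integral>\<^sup>+x. f x \<partial>lborel)"
proof -
  have linQ: "linear Q" using Q by (rule orthogonal_transformation_linear)
  have [measurable]: "Q \<in> borel_measurable borel"
    by (intro borel_measurable_continuous_onI linear_continuous_on linear_conv_bounded_linear[THEN iffD1] linQ)
  have "(\<integral>\<^sup>+x. f x \<partial>lborel) = (\<integral>\<^sup>+x. f x \<partial>(distr lborel borel Q))" by (simp add: distr_lborel_orthogonal[OF Q])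
  also have "\<dots> = (\<integral>\<^sup>+x. f (Q x) \<partial>lborel)" by (simp add: nn_integral_distr)
  finally show ?thesis ..
qed

section \<open>The surface measure of the sphere and polar coordinates\<close>

lemma measurable_sgn [measurable]: "(sgn :: 'a::euclidean_space \<Rightarrow> 'a) \<in> borel_measurable borel"
  unfolding sgn_div_norm[abs_def] by measurable

lemma measurable_ball [measurable]: "ball x r \<in> sets borel" for x :: "'a::euclidean_space"
  by simp

lemma measurable_greaterThan [measurable]: "{a<..} \<in> sets borel" for a :: real
  by simp

lemma nn_integral_sphere_measure:
  assumes [measurable]: "g \<in> borel_measurable borel"
  shows "(\<integral>\<^sup>+n. g n \<partial>sphere_measure) = (\<integral>\<^sup>+x. ennreal (3 * indicator (ball 0 1) x) * g (sgn x) \<partial>lborel)"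
  unfolding sphere_measure_def by (simp add: nn_integral_distr nn_integral_density)

lemma sets_sphere_measure [measurable_cong, simp]: "sets sphere_measure = sets borel"
  by (simp add: sphere_measure_def)

lemma space_sphere_measure [simp]: "space sphere_measure = UNIV"
  by (simp add: sphere_measure_def)

text \<open>The measure lives on the whole space, and \<open>sgn 0 = 0\<close> is not a unit vector;
  the origin is a null set of the ball, so only unit vectors count.\<close>

lemma nn_integral_sphere_measure_cong:
  assumes [measurable]: "f \<in> borel_measurable borel" "g \<in> borel_measurable borel"
    and eq: "\<And>n. norm n = 1 \<Longrightarrow> f n = g n"
  shows "(\<integral>\<^sup>+n. f n \<partial>sphere_measure) = (\<integral>\<^sup>+n. g n \<partial>sphere_measure)"
  unfolding nn_integral_sphere_measure[OF assms(1)] nn_integral_sphere_measure[OF assms(2)]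
proof (rule nn_integral_cong_AE)
  show "AE x in lborel. ennreal (3 * indicator (ball 0 1) x) * f (sgn x) = ennreal (3 * indicator (ball 0 1) x) * g (sgn x)"
    using AE_lborel_singleton[of 0] by eventually_elim (simp add: eq norm_sgn)
qed

lemma nn_integral_sphere_measure_mono:
  assumes [measurable]: "f \<in> borel_measurable borel" "g \<in> borel_measurable borel"
    and le: "\<And>n. norm n = 1 \<Longrightarrow> f n \<le> g n"
  shows "(\<integral>\<^sup>+n. f n \<partial>sphere_measure) \<le> (\<integral>\<^sup>+n. g n \<partial>sphere_measure)"
  unfolding nn_integral_sphere_measure[OF assms(1)] nn_integral_sphere_measure[OF assms(2)]
proof (rule nn_integral_mono_AE)
  show "AE x in lborel. ennreal (3 * indicator (ball 0 1) x) * f (sgn x) \<le> ennreal (3 * indicator (ball 0 1) x) * g (sgn x)"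
    using AE_lborel_singleton[of 0] by eventually_elim (intro mult_left_mono le, auto simp: norm_sgn)
qed

lemma nn_integral_sphere_measure_reflect:
  assumes [measurable]: "g \<in> borel_measurable borel"
  shows "(\<integral>\<^sup>+n. g (- n) \<partial>sphere_measure) = (\<integral>\<^sup>+n. g n \<partial>sphere_measure)"
proof -
  have "(\<integral>\<^sup>+n. g (- n) \<partial>sphere_measure) = (\<integral>\<^sup>+x. ennreal (3 * indicator (ball 0 1) (- x)) * g (sgn (- x)) \<partial>lborel)"
    by (simp add: nn_integral_sphere_measure sgn_minus indicator_def)
  also have "\<dots> = (\<integral>\<^sup>+x. ennreal (3 * indicator (ball 0 1) x) * g (sgn x) \<partial>lborel)"
    by (rule nn_integral_lborel_reflect) measurable
  finally show ?thesis by (simp add: nn_integral_sphere_measure)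
qed

text \<open>The number 4 pi, left unevaluated: only its finiteness and positivity enter.\<close>

definition sphere_area :: real where
  "sphere_area = 3 * measure lborel (ball (0::real^3) 1)"

lemma sphere_area_pos: "0 < sphere_area"
  unfolding sphere_area_def using content_ball_pos[of 1 "0::real^3"] by (simp add: measure_completion)

lemma emeasure_sphere_measure: "emeasure sphere_measure UNIV = ennreal sphere_area"
proof -
  have fin: "emeasure lborel (ball (0::real^3) 1) = ennreal (measure lborel (ball (0::real^3) 1))"
    by (rule emeasure_eq_ennreal_measure) (use emeasure_bounded_finite[OF bounded_ball[of "0::real^3" 1]] in auto)
  have "emeasure sphere_measure UNIV = (\<integral>\<^sup>+n. 1 \<partial>sphere_measure)" by simp
  also have "\<dots> = (\<integral>\<^sup>+x. ennreal (3 * indicator (ball (0::real^3) 1) x) * 1 \<partial>lborel)"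
    by (rule nn_integral_sphere_measure) simp
  also have "\<dots> = (\<integral>\<^sup>+x. 3 * indicator (ball (0::real^3) 1) x \<partial>lborel)"
    by (intro nn_integral_cong) (auto simp: indicator_def)
  also have "\<dots> = 3 * ennreal (measure lborel (ball (0::real^3) 1))"
    by (simp add: nn_integral_cmult fin)
  also have "\<dots> = ennreal sphere_area" by (simp add: sphere_area_def ennreal_mult)
  finally show ?thesis .
qed

interpretation sphere: finite_measure sphere_measure
  by (rule finite_measureI) (simp add: emeasure_sphere_measure)

text \<open>Used with \<open>a = norm y\<close>, this cancels the weight \<open>norm y ^ 3\<close>
  that the cone construction leaves in the polar formula.\<close>

lemma nn_integral_inverse_power_4:
  fixes a :: real assumes a: "a > 0"
  shows "(\<integral>\<^sup>+s. ennreal (3 / s ^ 4) * indicator {a<..} s \<partial>lborel) = ennreal (1 / a ^ 3)"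
proof -
  have "(\<integral>\<^sup>+s. ennreal (3 / s ^ 4) * indicator {a<..} s \<partial>lborel) = (\<integral>\<^sup>+s. ennreal (3 / s ^ 4) * indicator {a..} s \<partial>lborel)"
    by (rule nn_integral_cong_AE) (use AE_lborel_singleton[of a] in eventually_elim, auto simp: indicator_def)
  also have "\<dots> = ennreal (0 - (- (1 / a ^ 3)))"
  proof (rule nn_integral_FTC_atLeast)
    fix s :: real assume "a \<le> s"
    then show "((\<lambda>s. - (1 / s ^ 3)) has_real_derivative 3 / s ^ 4) (at s)"
      using a by (auto intro!: derivative_eq_intros simp: field_simps power_numeral_reduce)
  next
    show "((\<lambda>s::real. - (1 / s ^ 3)) \<longlongrightarrow> 0) at_top" by real_asymp
  qed auto
  finally show ?thesis by simp
qed

text \<open>The sphere measure is the cone measure, so after the substitution \<open>r = s |x|\<close> the formula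
  reduces to scaling of Lebesgue measure and Tonelli.\<close>
lemma nn_integral_polar:
  fixes F :: "real^3 \<Rightarrow> ennreal"
  assumes [measurable]: "F \<in> borel_measurable borel"
  shows "(\<integral>\<^sup>+x. F x \<partial>lborel)
    = (\<integral>\<^sup>+n. (\<integral>\<^sup>+r. ennreal (r\<^sup>2) * indicator {0<..} r * F (r *\<^sub>R n) \<partial>lborel) \<partial>sphere_measure)"
proof -
  \<comment> \<open>The integrand after \<open>r = s * norm x\<close>: the Jacobian
    \<open>norm x\<close> and the factor \<open>(s * norm x)\<^sup>2\<close> combine with the 3 of
    the cone measure.\<close>
  define G where "G x s = ennreal (3 * s\<^sup>2 * norm x ^ 3) * indicator (ball 0 1) x * indicator {0<..} s * F (s *\<^sub>R x)" for x s
  have [measurable]: "case_prod G \<in> borel_measurable (borel \<Otimes>\<^sub>M borel)" unfolding G_def by measurable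
  have "(\<integral>\<^sup>+n. (\<integral>\<^sup>+r. ennreal (r\<^sup>2) * indicator {0<..} r * F (r *\<^sub>R n) \<partial>lborel) \<partial>sphere_measure)
     = (\<integral>\<^sup>+x. ennreal (3 * indicator (ball 0 1) x) * (\<integral>\<^sup>+r. ennreal (r\<^sup>2) * indicator {0<..} r * F (r *\<^sub>R sgn x) \<partial>lborel) \<partial>lborel)"
    by (rule nn_integral_sphere_measure) measurable
  also have "\<dots> = (\<integral>\<^sup>+x. (\<integral>\<^sup>+s. G x s \<partial>lborel) \<partial>lborel)"
  proof (rule nn_integral_cong_AE)
    show "AE x in lborel. ennreal (3 * indicator (ball 0 1) x) * (\<integral>\<^sup>+r. ennreal (r\<^sup>2) * indicator {0<..} r * F (r *\<^sub>R sgn x) \<partial>lborel)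
       = (\<integral>\<^sup>+s. G x s \<partial>lborel)"
      using AE_lborel_singleton[of 0]
    proof eventually_elim
      case (elim x)
      then have nx: "norm x > 0" by simp
      have "(\<integral>\<^sup>+r. ennreal (r\<^sup>2) * indicator {0<..} r * F (r *\<^sub>R sgn x) \<partial>lborel)
          = ennreal (norm x) * (\<integral>\<^sup>+s. ennreal ((norm x * s)\<^sup>2) * indicator {0<..} (norm x * s) * F ((norm x * s) *\<^sub>R sgn x) \<partial>lborel)"
        using nx by (subst nn_integral_real_affine[where c = "norm x" and t = 0]) auto
      also have "\<dots> = (\<integral>\<^sup>+s. ennreal (norm x) * (ennreal ((norm x * s)\<^sup>2) * indicator {0<..} (norm x * s) * F ((norm x * s) *\<^sub>R sgn x)) \<partial>lborel)"
        by (rule nn_integral_cmult[symmetric]) measurable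
      finally have "ennreal (3 * indicator (ball 0 1) x) * (\<integral>\<^sup>+r. ennreal (r\<^sup>2) * indicator {0<..} r * F (r *\<^sub>R sgn x) \<partial>lborel)
         = (\<integral>\<^sup>+s. ennreal (3 * indicator (ball 0 1) x) * (ennreal (norm x) * (ennreal ((norm x * s)\<^sup>2) * indicator {0<..} (norm x * s) * F ((norm x * s) *\<^sub>R sgn x))) \<partial>lborel)"
        by (simp add: nn_integral_cmult)
      also have "\<dots> = (\<integral>\<^sup>+s. G x s \<partial>lborel)"
      proof (rule nn_integral_cong)
        fix s
        have 1: "(norm x * s) *\<^sub>R sgn x = s *\<^sub>R x" using nx by (simp add: sgn_div_norm)
        have 2: "indicator {0<..} (norm x * s) = (indicator {0<..} s :: ennreal)"
          using nx by (simp add: indicator_def zero_less_mult_iff)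
        have 3: "ennreal (3 * indicator (ball 0 1) x) * (ennreal (norm x) * ennreal ((norm x * s)\<^sup>2))
            = ennreal (3 * s\<^sup>2 * norm x ^ 3) * indicator (ball 0 1) x"
        proof -
          have "3 * s\<^sup>2 * norm x ^ 3 = 3 * (norm x * (norm x * s)\<^sup>2)"
            by (simp add: power2_eq_square power3_eq_cube)
          then have "ennreal (3 * s\<^sup>2 * norm x ^ 3) = ennreal (3 * (norm x * (norm x * s)\<^sup>2))"
            by (rule arg_cong)
          also have "\<dots> = 3 * (ennreal (norm x) * ennreal ((norm x * s)\<^sup>2))"
            by (simp add: ennreal_mult)
          finally have "ennreal (3 * s\<^sup>2 * norm x ^ 3) = 3 * (ennreal (norm x) * ennreal ((norm x * s)\<^sup>2))" .
          then show ?thesis by (cases "x \<in> ball 0 1") auto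
        qed
        show "ennreal (3 * indicator (ball 0 1) x) * (ennreal (norm x) * (ennreal ((norm x * s)\<^sup>2) * indicator {0<..} (norm x * s) * F ((norm x * s) *\<^sub>R sgn x))) = G x s"
          unfolding 1 2 G_def 3[symmetric] by (simp only: mult.assoc)
      qed
      finally show ?case .
    qed
  qed
  also have "\<dots> = (\<integral>\<^sup>+s. (\<integral>\<^sup>+x. G x s \<partial>lborel) \<partial>lborel)"
    by (rule lborel_pair.Fubini') measurable
  \<comment> \<open>Now \<open>y = s x\<close> for fixed \<open>s\<close>: membership of
    \<open>x\<close> in the unit ball becomes \<open>norm y < s\<close>, which leaves an elementary
    tail integral in \<open>s\<close>.\<close>
  also have "\<dots> = (\<integral>\<^sup>+s. (\<integral>\<^sup>+y. ennreal (3 / s ^ 4) * (if norm y < s then 1 else 0) * (ennreal (norm y ^ 3) * F y) \<partial>lborel) \<partial>lborel)"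
  proof (rule nn_integral_cong)
    fix s :: real
    show "(\<integral>\<^sup>+x. G x s \<partial>lborel) = (\<integral>\<^sup>+y. ennreal (3 / s ^ 4) * (if norm y < s then 1 else 0) * (ennreal (norm y ^ 3) * F y) \<partial>lborel)"
    proof (cases "s > 0")
      case True
      have "(\<integral>\<^sup>+y. ennreal (3 / s ^ 4) * (if norm y < s then 1 else 0) * (ennreal (norm y ^ 3) * F y) \<partial>lborel)
         = ennreal (s ^ 3) * (\<integral>\<^sup>+x. ennreal (3 / s ^ 4) * (if norm (s *\<^sub>R x) < s then 1 else 0) * (ennreal (norm (s *\<^sub>R x) ^ 3) * F (s *\<^sub>R x)) \<partial>lborel)"
        using True by (subst nn_integral_lborel_affine[where c = s and t = 0]) auto
      also have "\<dots> = (\<integral>\<^sup>+x. ennreal (s ^ 3) * (ennreal (3 / s ^ 4) * (if norm (s *\<^sub>R x) < s then 1 else 0) * (ennreal (norm (s *\<^sub>R x) ^ 3) * F (s *\<^sub>R x))) \<partial>lborel)"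
        by (rule nn_integral_cmult[symmetric]) measurable
      also have "\<dots> = (\<integral>\<^sup>+x. G x s \<partial>lborel)"
      proof (rule nn_integral_cong)
        fix x :: "real^3"
        have 1: "(if norm (s *\<^sub>R x) < s then 1 else 0) = (indicator (ball 0 1) x :: ennreal)"
          using True by (simp add: indicator_def)
        have 2: "ennreal (s ^ 3) * (ennreal (3 / s ^ 4) * ennreal (norm (s *\<^sub>R x) ^ 3)) = ennreal (3 * s\<^sup>2 * norm x ^ 3)"
          using True by (simp add: ennreal_mult[symmetric] power_mult_distrib field_simps power_numeral_reduce)
        have "ennreal (s ^ 3) * (ennreal (3 / s ^ 4) * (if norm (s *\<^sub>R x) < s then 1 else 0) * (ennreal (norm (s *\<^sub>R x) ^ 3) * F (s *\<^sub>R x)))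
           = ennreal (s ^ 3) * (ennreal (3 / s ^ 4) * ennreal (norm (s *\<^sub>R x) ^ 3)) * (if norm (s *\<^sub>R x) < s then 1 else 0) * F (s *\<^sub>R x)"
          by (simp only: mult_ac)
        also have "\<dots> = G x s" unfolding 1 2 G_def using True by simp
        finally show "ennreal (s ^ 3) * (ennreal (3 / s ^ 4) * (if norm (s *\<^sub>R x) < s then 1 else 0) * (ennreal (norm (s *\<^sub>R x) ^ 3) * F (s *\<^sub>R x))) = G x s" .
      qed
      finally show ?thesis ..
    next
      case False
      then have "\<not> norm y < s" for y :: "real^3"
        using norm_ge_zero[of y] by linarith
      then show ?thesis using False by (simp add: G_def)
    qed
  qed
  also have "\<dots> = (\<integral>\<^sup>+y. (\<integral>\<^sup>+s. ennreal (3 / s ^ 4) * (if norm y < s then 1 else 0) * (ennreal (norm y ^ 3) * F y) \<partial>lborel) \<partial>lborel)"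
    by (rule lborel_pair.Fubini'[symmetric]) measurable
  also have "\<dots> = (\<integral>\<^sup>+y. F y \<partial>lborel)"
  proof (rule nn_integral_cong_AE)
    show "AE y in lborel. (\<integral>\<^sup>+s. ennreal (3 / s ^ 4) * (if norm y < s then 1 else 0) * (ennreal (norm y ^ 3) * F y) \<partial>lborel) = F y"
      using AE_lborel_singleton[of 0]
    proof eventually_elim
      case (elim y)
      then have ny: "norm y > 0" by simp
      have "(\<integral>\<^sup>+s. ennreal (3 / s ^ 4) * (if norm y < s then 1 else 0) * (ennreal (norm y ^ 3) * F y) \<partial>lborel)
         = ennreal (1 / norm y ^ 3) * (ennreal (norm y ^ 3) * F y)"
        using nn_integral_inverse_power_4[OF ny]
        by (subst nn_integral_multc) (auto simp: indicator_def of_bool_def)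
      also have "\<dots> = F y"
        using ny by (simp add: mult.assoc[symmetric] ennreal_mult[symmetric])
      finally show ?case .
    qed
  qed
  finally show ?thesis ..
qed

section \<open>Gaussian integrals\<close>

lemma nn_integral_gaussian:
  fixes \<tau> :: real assumes \<tau>: "\<tau> > 0"
  shows "(\<integral>\<^sup>+x. ennreal (exp (- \<tau> * x\<^sup>2)) \<partial>lborel) = ennreal (sqrt (pi / \<tau>))"
proof -
  define s where "s = 1 / sqrt (2 * \<tau>)"
  have s: "s > 0" "s\<^sup>2 = 1 / (2 * \<tau>)" using \<tau> by (auto simp: s_def power_divide)
  have nd: "normal_density 0 s x = sqrt (\<tau> / pi) * exp (- \<tau> * x\<^sup>2)" for x
    using \<tau> by (simp add: normal_density_def s(2) field_simps real_sqrt_divide)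
  have "(\<integral>\<^sup>+x. ennreal (normal_density 0 s x) \<partial>lborel) = 1"
    using nn_integral_eq_integral[OF integrable_normal_density[OF s(1)], of 0] integral_normal_density[OF s(1), of 0] by simp
  then have "ennreal (sqrt (\<tau> / pi)) * (\<integral>\<^sup>+x. ennreal (exp (- \<tau> * x\<^sup>2)) \<partial>lborel) = 1"
    using \<tau> by (simp add: nd ennreal_mult nn_integral_cmult)
  then have "ennreal (sqrt (pi / \<tau>)) * (ennreal (sqrt (\<tau> / pi)) * (\<integral>\<^sup>+x. ennreal (exp (- \<tau> * x\<^sup>2)) \<partial>lborel)) = ennreal (sqrt (pi / \<tau>))"
    by simp
  moreover have "ennreal (sqrt (pi / \<tau>)) * ennreal (sqrt (\<tau> / pi)) = 1"
    using \<tau> by (simp add: ennreal_mult[symmetric] real_sqrt_mult[symmetric])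
  ultimately show ?thesis by (simp add: mult.assoc[symmetric])
qed

text \<open>A rotation moves \<open>n\<close> to a coordinate axis. The integrand is then a product
  over coordinates, and the two transverse ones contribute \<open>sqrt (pi / \<tau>)\<close>
  each.\<close>

lemma nn_integral_gaussian_marginal:
  fixes n :: "real^3" and h :: "real \<Rightarrow> ennreal"
  assumes \<tau>: "\<tau> > 0" and n: "norm n = 1" and [measurable]: "h \<in> borel_measurable borel"
  shows "(\<integral>\<^sup>+w. h (w \<bullet> n) * ennreal (exp (- \<tau> * (norm w)\<^sup>2)) \<partial>lborel)
     = ennreal (pi / \<tau>) * (\<integral>\<^sup>+x. h x * ennreal (exp (- \<tau> * x\<^sup>2)) \<partial>lborel)"
proof -
  define e :: "real^3" where "e = axis 1 1"
  have e: "e \<in> Basis" "norm e = 1" by (auto simp: e_def axis_in_Basis_iff)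
  obtain Q where Q: "orthogonal_transformation Q" "Q n = e"
    using orthogonal_transformation_exists[of n e] n e(2) by auto
  let ?f = "\<lambda>b x. (if b = e then h x else 1) * ennreal (exp (- \<tau> * x\<^sup>2))"
  have "(\<integral>\<^sup>+w. h (w \<bullet> n) * ennreal (exp (- \<tau> * (norm w)\<^sup>2)) \<partial>lborel)
     = (\<integral>\<^sup>+w. h (Q w \<bullet> e) * ennreal (exp (- \<tau> * (norm (Q w))\<^sup>2)) \<partial>lborel)"
    using Q by (simp add: orthogonal_transformation_norm flip: Q(2)) (simp add: orthogonal_transformation_def)
  also have "\<dots> = (\<integral>\<^sup>+w. h (w \<bullet> e) * ennreal (exp (- \<tau> * (norm w)\<^sup>2)) \<partial>lborel)"
    by (rule nn_integral_lborel_orthogonal[OF Q(1)]) measurable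
  also have "\<dots> = (\<integral>\<^sup>+w. (\<Prod>b\<in>Basis. ?f b (w \<bullet> b)) \<partial>lborel)"
  proof (rule nn_integral_cong)
    fix w :: "real^3"
    have "(\<Prod>b\<in>Basis. ?f b (w \<bullet> b)) = (\<Prod>b\<in>Basis. if b = e then h (w \<bullet> b) else 1) * (\<Prod>b\<in>Basis. ennreal (exp (- \<tau> * (w \<bullet> b)\<^sup>2)))"
      by (rule prod.distrib)
    also have "(\<Prod>b\<in>Basis. if b = e then h (w \<bullet> b) else 1) = h (w \<bullet> e)"
      using e(1) by (simp add: prod.delta)
    also have "(\<Prod>b\<in>Basis. ennreal (exp (- \<tau> * (w \<bullet> b)\<^sup>2))) = ennreal (\<Prod>b\<in>Basis. exp (- \<tau> * (w \<bullet> b)\<^sup>2))"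
      by (rule prod_ennreal) auto
    also have "(\<Prod>b\<in>Basis. exp (- \<tau> * (w \<bullet> b)\<^sup>2)) = exp (- \<tau> * (norm w)\<^sup>2)"
      unfolding exp_sum[OF finite_Basis, symmetric] sum_distrib_left[symmetric]
        power2_norm_eq_inner euclidean_inner[of w w]
      by (simp add: power2_eq_square)
    finally show "h (w \<bullet> e) * ennreal (exp (- \<tau> * (norm w)\<^sup>2)) = (\<Prod>b\<in>Basis. ?f b (w \<bullet> b))" ..
  qed
  also have "\<dots> = (\<Prod>b\<in>Basis. (\<integral>\<^sup>+x. ?f b x \<partial>lborel))"
    by (rule nn_integral_lborel_prod) auto
  also have "\<dots> = (\<integral>\<^sup>+x. ?f e x \<partial>lborel) * (\<Prod>b\<in>Basis - {e}. (\<integral>\<^sup>+x. ?f b x \<partial>lborel))"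
    using e(1) by (intro prod.remove) auto
  also have "(\<Prod>b\<in>Basis - {e}. (\<integral>\<^sup>+x. ?f b x \<partial>lborel)) = (\<Prod>b\<in>(Basis - {e}). ennreal (sqrt (pi / \<tau>)))"
    by (intro prod.cong) (auto simp: nn_integral_gaussian[OF \<tau>, unfolded mult_minus_left])
  also have "\<dots> = ennreal (sqrt (pi / \<tau>)) ^ 2"
    using e(1) by (simp add: card_Diff_singleton)
  also have "\<dots> = ennreal (pi / \<tau>)" using \<tau> by (simp add: ennreal_power)
  finally show ?thesis by (simp add: mult.commute)
qed

section \<open>The collision frequency\<close>

text \<open>The mean of \<open>\<bar>s - X\<bar>\<close> for a centred normal \<open>X\<close> of
  variance \<open>1 / (2 * \<tau>)\<close>. Extended nonnegative values postpone all questions of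
  integrability.\<close>

definition gauss_abs :: "real \<Rightarrow> real \<Rightarrow> ennreal" where
  "gauss_abs \<tau> s = (\<integral>\<^sup>+x. ennreal \<bar>s - x\<bar> * ennreal (sqrt (\<tau> / pi) * exp (- \<tau> * x\<^sup>2)) \<partial>lborel)"

text \<open>The mean of the positive part of \<open>X - s\<close> for the same \<open>X\<close>,
  written in the variable \<open>y = x - s\<close>. This half is the one that appears as a radial
  integral.\<close>

definition gauss_pos :: "real \<Rightarrow> real \<Rightarrow> ennreal" where
  "gauss_pos \<tau> s = (\<integral>\<^sup>+y. ennreal (sqrt (\<tau> / pi) * (y * exp (- \<tau> * (y + s)\<^sup>2))) * indicator {0<..} y \<partial>lborel)"

definition sphere_freq :: "real \<Rightarrow> real^3 \<Rightarrow> ennreal" where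
  "sphere_freq \<tau> h = (\<integral>\<^sup>+n. gauss_abs \<tau> (h \<bullet> n) \<partial>sphere_measure)"

lemma gauss_abs_measurable [measurable]: "gauss_abs \<tau> \<in> borel_measurable borel"
  unfolding gauss_abs_def[abs_def] by measurable

lemma gauss_pos_measurable [measurable]: "gauss_pos \<tau> \<in> borel_measurable borel"
  unfolding gauss_pos_def[abs_def] by measurable

lemma gauss_abs_eq_pos: "gauss_abs \<tau> s = gauss_pos \<tau> s + gauss_pos \<tau> (- s)"
proof -
  define g where "g x = ennreal (sqrt (\<tau> / pi) * exp (- \<tau> * x\<^sup>2))" for x
  have [measurable]: "g \<in> borel_measurable borel" unfolding g_def by measurable
  have "gauss_abs \<tau> s = (\<integral>\<^sup>+x. ennreal \<bar>s - x\<bar> * (if s < x then 1 else 0) * g x + ennreal \<bar>s - x\<bar> * (if x < s then 1 else 0) * g x \<partial>lborel)"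
    unfolding gauss_abs_def g_def by (intro nn_integral_cong) auto
  also have "\<dots> = (\<integral>\<^sup>+x. ennreal \<bar>s - x\<bar> * (if s < x then 1 else 0) * g x \<partial>lborel) + (\<integral>\<^sup>+x. ennreal \<bar>s - x\<bar> * (if x < s then 1 else 0) * g x \<partial>lborel)"
    by (rule nn_integral_add) measurable
  also have "(\<integral>\<^sup>+x. ennreal \<bar>s - x\<bar> * (if s < x then 1 else 0) * g x \<partial>lborel) = gauss_pos \<tau> s"
    unfolding gauss_pos_def g_def
    by (subst nn_integral_real_affine[where c = 1 and t = s])
       (auto intro!: nn_integral_cong simp: ennreal_mult'[symmetric] ac_simps indicator_def)
  also have "(\<integral>\<^sup>+x. ennreal \<bar>s - x\<bar> * (if x < s then 1 else 0) * g x \<partial>lborel) = gauss_pos \<tau> (- s)"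
    unfolding gauss_pos_def g_def
    by (subst nn_integral_real_affine[where c = "-1" and t = s])
       (auto intro!: nn_integral_cong simp: ennreal_mult'[symmetric] ac_simps indicator_def power2_commute[of s])
  finally show ?thesis .
qed

lemma gauss_abs_minus: "gauss_abs \<tau> (- s) = gauss_abs \<tau> s"
  by (simp add: gauss_abs_eq_pos add.commute)

context
  fixes \<tau> :: real
  assumes \<tau>: "\<tau> > 0"
begin

lemma gaussian_mass: "(\<integral>\<^sup>+x. ennreal (sqrt (\<tau> / pi) * exp (- \<tau> * x\<^sup>2)) \<partial>lborel) = 1"
proof -
  have "(\<integral>\<^sup>+x. ennreal (sqrt (\<tau> / pi) * exp (- \<tau> * x\<^sup>2)) \<partial>lborel) = ennreal (sqrt (\<tau> / pi)) * ennreal (sqrt (pi / \<tau>))"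
    using \<tau> by (simp add: ennreal_mult nn_integral_cmult nn_integral_gaussian[unfolded mult_minus_left])
  also have "\<dots> = 1" using \<tau> by (simp add: ennreal_mult[symmetric] real_sqrt_mult[symmetric])
  finally show ?thesis .
qed

lemma gauss_abs_0: "gauss_abs \<tau> 0 = ennreal (sqrt (\<tau> / pi) / \<tau>)"
proof -
  have "gauss_pos \<tau> 0 = (\<integral>\<^sup>+y. ennreal (sqrt (\<tau> / pi) * (y * exp (- \<tau> * y\<^sup>2))) * indicator {0..} y \<partial>lborel)"
    unfolding gauss_pos_def
    by (rule nn_integral_cong_AE) (use AE_lborel_singleton[of "0::real"] in eventually_elim, auto simp: indicator_def)
  also have "\<dots> = ennreal (0 - (- (sqrt (\<tau> / pi) / (2 * \<tau>)) * exp (- \<tau> * 0\<^sup>2)))"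
  proof (rule nn_integral_FTC_atLeast)
    fix x :: real
    show "((\<lambda>y. - (sqrt (\<tau> / pi) / (2 * \<tau>)) * exp (- \<tau> * y\<^sup>2)) has_real_derivative sqrt (\<tau> / pi) * (x * exp (- \<tau> * x\<^sup>2))) (at x)"
      using \<tau> by (auto intro!: derivative_eq_intros)
    show "((\<lambda>y. - (sqrt (\<tau> / pi) / (2 * \<tau>)) * exp (- \<tau> * y\<^sup>2)) \<longlongrightarrow> 0) at_top"
      using \<tau> by real_asymp
  qed (use \<tau> in auto)
  finally have "gauss_pos \<tau> 0 = ennreal (sqrt (\<tau> / pi) / (2 * \<tau>))" by simp
  then show ?thesis using \<tau> by (simp add: gauss_abs_eq_pos flip: ennreal_plus)
qed

lemma gauss_abs_lipschitz: "gauss_abs \<tau> s \<le> gauss_abs \<tau> t + ennreal \<bar>s - t\<bar>"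
proof -
  define g where "g x = ennreal (sqrt (\<tau> / pi) * exp (- \<tau> * x\<^sup>2))" for x
  have [measurable]: "g \<in> borel_measurable borel" unfolding g_def by measurable
  have "gauss_abs \<tau> s \<le> (\<integral>\<^sup>+x. ennreal \<bar>t - x\<bar> * g x + ennreal \<bar>s - t\<bar> * g x \<partial>lborel)"
    unfolding gauss_abs_def g_def[symmetric] distrib_right[symmetric]
    by (intro nn_integral_mono mult_right_mono) (auto simp flip: ennreal_plus)
  also have "\<dots> = gauss_abs \<tau> t + ennreal \<bar>s - t\<bar> * (\<integral>\<^sup>+x. g x \<partial>lborel)"
    unfolding gauss_abs_def g_def[symmetric] by (simp add: nn_integral_add nn_integral_cmult)
  finally show ?thesis using gaussian_mass by (simp add: g_def)
qed

text \<open>Averaging over \<open>s\<close> and \<open>- s\<close> produces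
  \<open>\<bar>s - x\<bar> + \<bar>s + x\<bar>\<close>, which dominates both
  \<open>2 * \<bar>s\<bar>\<close> and \<open>2 * \<bar>x\<bar>\<close>. The first bound gives
  growth at infinity, the second the minimum at 0.\<close>

lemma two_gauss_abs:
  "gauss_abs \<tau> s + gauss_abs \<tau> s = (\<integral>\<^sup>+x. (ennreal \<bar>s - x\<bar> + ennreal \<bar>s + x\<bar>) * ennreal (sqrt (\<tau> / pi) * exp (- \<tau> * x\<^sup>2)) \<partial>lborel)"
proof -
  have "gauss_abs \<tau> s + gauss_abs \<tau> s = gauss_abs \<tau> s + gauss_abs \<tau> (- s)" by (simp add: gauss_abs_minus)
  also have "\<dots> = (\<integral>\<^sup>+x. ennreal \<bar>s - x\<bar> * ennreal (sqrt (\<tau> / pi) * exp (- \<tau> * x\<^sup>2)) + ennreal \<bar>- s - x\<bar> * ennreal (sqrt (\<tau> / pi) * exp (- \<tau> * x\<^sup>2)) \<partial>lborel)"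
    unfolding gauss_abs_def by (rule nn_integral_add[symmetric]) measurable
  also have "\<dots> = (\<integral>\<^sup>+x. (ennreal \<bar>s - x\<bar> + ennreal \<bar>s + x\<bar>) * ennreal (sqrt (\<tau> / pi) * exp (- \<tau> * x\<^sup>2)) \<partial>lborel)"
    by (intro nn_integral_cong) (simp add: distrib_right abs_minus_commute[of "- s"] add.commute)
  finally show ?thesis .
qed

lemma ennreal_half_mono: "a + a \<le> b + b \<Longrightarrow> a \<le> b" for a b :: ennreal
  by (cases a; cases b) (auto simp: top_unique simp flip: ennreal_plus)

lemma gauss_abs_ge: "ennreal \<bar>s\<bar> \<le> gauss_abs \<tau> s"
proof (rule ennreal_half_mono)
  have "ennreal \<bar>s\<bar> + ennreal \<bar>s\<bar> = (\<integral>\<^sup>+x. (ennreal \<bar>s\<bar> + ennreal \<bar>s\<bar>) * ennreal (sqrt (\<tau> / pi) * exp (- \<tau> * x\<^sup>2)) \<partial>lborel)"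
    using gaussian_mass by (simp add: nn_integral_cmult)
  also have "\<dots> \<le> gauss_abs \<tau> s + gauss_abs \<tau> s"
    unfolding two_gauss_abs by (intro nn_integral_mono mult_right_mono) (auto simp flip: ennreal_plus)
  finally show "ennreal \<bar>s\<bar> + ennreal \<bar>s\<bar> \<le> gauss_abs \<tau> s + gauss_abs \<tau> s" .
qed

lemma gauss_abs_min: "gauss_abs \<tau> 0 \<le> gauss_abs \<tau> s"
proof (rule ennreal_half_mono)
  show "gauss_abs \<tau> 0 + gauss_abs \<tau> 0 \<le> gauss_abs \<tau> s + gauss_abs \<tau> s"
    unfolding two_gauss_abs by (intro nn_integral_mono mult_right_mono) (auto simp flip: ennreal_plus)
qed

lemma sphere_freq_lipschitz: "sphere_freq \<tau> h \<le> sphere_freq \<tau> h' + ennreal (norm (h - h') * sphere_area)"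
proof -
  have "sphere_freq \<tau> h \<le> (\<integral>\<^sup>+n. gauss_abs \<tau> (h' \<bullet> n) + ennreal (norm (h - h')) \<partial>sphere_measure)"
    unfolding sphere_freq_def
  proof (rule nn_integral_sphere_measure_mono)
    fix n :: "real^3" assume n: "norm n = 1"
    have "gauss_abs \<tau> (h \<bullet> n) \<le> gauss_abs \<tau> (h' \<bullet> n) + ennreal \<bar>h \<bullet> n - h' \<bullet> n\<bar>" by (rule gauss_abs_lipschitz)
    also have "\<bar>h \<bullet> n - h' \<bullet> n\<bar> \<le> norm (h - h')"
      using Cauchy_Schwarz_ineq2[of "h - h'" n] n by (simp add: inner_diff_left)
    finally show "gauss_abs \<tau> (h \<bullet> n) \<le> gauss_abs \<tau> (h' \<bullet> n) + ennreal (norm (h - h'))"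
      by (simp add: add_left_mono ennreal_leI)
  qed measurable
  also have "\<dots> = sphere_freq \<tau> h' + ennreal (norm (h - h') * sphere_area)"
    unfolding sphere_freq_def using sphere_area_pos
    by (subst nn_integral_add) (auto simp: emeasure_sphere_measure ennreal_mult)
  finally show ?thesis .
qed

lemma sphere_freq_0: "sphere_freq \<tau> 0 = ennreal (sqrt (\<tau> / pi) / \<tau> * sphere_area)"
  using \<tau> sphere_area_pos by (simp add: sphere_freq_def gauss_abs_0 emeasure_sphere_measure ennreal_mult[symmetric])

lemma sphere_freq_finite: "sphere_freq \<tau> h < \<infinity>"
  by (rule le_less_trans[OF sphere_freq_lipschitz[of h 0]]) (simp add: sphere_freq_0)

lemma sphere_freq_min: "sphere_freq \<tau> 0 \<le> sphere_freq \<tau> h"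
  unfolding sphere_freq_def by (intro nn_integral_mono) (simp add: gauss_abs_min)

text \<open>The reflection of the sphere exchanges the two halves of \<open>gauss_abs\<close>. This
  lets the full frequency be compared with polar integrals, where only positive radii occur.\<close>

lemma sphere_freq_eq_pos: "sphere_freq \<tau> h = 2 * (\<integral>\<^sup>+n. gauss_pos \<tau> (h \<bullet> n) \<partial>sphere_measure)"
proof -
  have "sphere_freq \<tau> h = (\<integral>\<^sup>+n. gauss_pos \<tau> (h \<bullet> n) + gauss_pos \<tau> (h \<bullet> (- n)) \<partial>sphere_measure)"
    by (simp add: sphere_freq_def gauss_abs_eq_pos)
  also have "\<dots> = (\<integral>\<^sup>+n. gauss_pos \<tau> (h \<bullet> n) \<partial>sphere_measure) + (\<integral>\<^sup>+n. gauss_pos \<tau> (h \<bullet> (- n)) \<partial>sphere_measure)"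
    by (rule nn_integral_add) measurable
  also have "(\<integral>\<^sup>+n. gauss_pos \<tau> (h \<bullet> (- n)) \<partial>sphere_measure) = (\<integral>\<^sup>+n. gauss_pos \<tau> (h \<bullet> n) \<partial>sphere_measure)"
    by (rule nn_integral_sphere_measure_reflect[of "\<lambda>n. gauss_pos \<tau> (h \<bullet> n)"]) measurable
  finally show ?thesis by (simp add: mult_2)
qed

text \<open>\<open>gauss_abs\<close> dominates the absolute value, so along a ray the frequency
  grows at least linearly, with rate the integral of \<open>\<bar>e \<bullet> n\<bar>\<close> over
  the sphere. It is positive because the hyperplane orthogonal to \<open>e\<close> is a null
  set.\<close>

lemma sphere_freq_unbounded:
  obtains c where "c > 0" "\<And>t. t \<ge> 0 \<Longrightarrow> ennreal (c * t) \<le> sphere_freq \<tau> (t *\<^sub>R axis 1 1)"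
proof -
  define e :: "real^3" where "e = axis 1 1"
  have e0: "e \<noteq> 0" by (simp add: e_def)
  define C where "C = (\<integral>\<^sup>+n. ennreal \<bar>e \<bullet> n\<bar> \<partial>sphere_measure)"
  have "C \<le> (\<integral>\<^sup>+n. 1 \<partial>sphere_measure)" unfolding C_def
  proof (rule nn_integral_sphere_measure_mono)
    fix n :: "real^3" assume "norm n = 1"
    then show "ennreal \<bar>e \<bullet> n\<bar> \<le> 1"
      using Cauchy_Schwarz_ineq2[of e n] by (simp add: e_def)
  qed measurable
  then have Cfin: "C < \<infinity>" by (rule le_less_trans) (simp add: emeasure_sphere_measure)
  have "C \<noteq> 0"
  proof
    assume "C = 0"
    then have "(\<integral>\<^sup>+x. ennreal (3 * indicator (ball 0 1) x) * ennreal \<bar>e \<bullet> sgn x\<bar> \<partial>lborel) = 0"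
      unfolding C_def by (subst (asm) nn_integral_sphere_measure) auto
    then have "AE x in lborel. ennreal (3 * indicator (ball 0 1) x) * ennreal \<bar>e \<bullet> sgn x\<bar> = 0"
      by (subst (asm) nn_integral_0_iff_AE) auto
    moreover have "AE x in lborel. e \<bullet> x \<noteq> 0"
    proof -
      have "negligible {x. e \<bullet> x = 0}" using negligible_hyperplane[of e 0] e0 by simp
      then have "{x. e \<bullet> x = 0} \<in> null_sets lebesgue" by (simp add: negligible_iff_null_sets)
      then have "{x. e \<bullet> x = 0} \<in> null_sets lborel" by (simp add: null_sets_completion_iff)
      then show ?thesis by (auto dest: AE_not_in)
    qed
    ultimately have "AE x in lborel. x \<notin> ball (0::real^3) 1"
      by eventually_elim (auto simp: sgn_div_norm indicator_def)
    then have "emeasure lborel (ball (0::real^3) 1) = 0"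
      using AE_iff_null_sets[of "ball (0::real^3) 1" lborel] by (simp add: null_sets_def)
    then have "sphere_area = 0" by (simp add: sphere_area_def measure_def)
    then show False using sphere_area_pos by simp
  qed
  with Cfin obtain c where c: "c > 0" "C = ennreal c" by (cases C) (auto simp: less_le)
  show thesis
  proof (rule that[OF c(1)])
    fix t :: real assume t: "t \<ge> 0"
    have "ennreal (c * t) = ennreal t * C" using c t by (simp add: ennreal_mult mult.commute)
    also have "\<dots> = (\<integral>\<^sup>+n. ennreal \<bar>(t *\<^sub>R e) \<bullet> n\<bar> \<partial>sphere_measure)"
      unfolding C_def using t by (subst nn_integral_cmult[symmetric]) (auto simp: abs_mult ennreal_mult)
    also have "\<dots> \<le> sphere_freq \<tau> (t *\<^sub>R e)"
      unfolding sphere_freq_def by (intro nn_integral_mono gauss_abs_ge)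
    finally show "ennreal (c * t) \<le> sphere_freq \<tau> (t *\<^sub>R axis 1 1)" by (simp add: e_def)
  qed
qed

text \<open>In polar coordinates about \<open>v\<close>, with
  \<open>s = (v - u) \<bullet> n\<close>, the energy difference divided by \<open>r\<close> is
  \<open>2 * s + r\<close>. The bracket is therefore the affine function
  \<open>2 * (q * r + s)\<close>, the singularity reduces the weight from the square of
  \<open>r\<close> to \<open>r\<close>, and scaling by \<open>q\<close> identifies the radial
  integral with \<open>gauss_pos\<close>.\<close>

lemma nn_integral_radial:
  assumes c: "c > 0"
  shows "(\<integral>\<^sup>+w. ennreal (exp (- (\<tau> / 4) * (c * norm (w - v) + ((norm (w - u))\<^sup>2 - (norm (v - u))\<^sup>2) / norm (w - v))\<^sup>2) / norm (w - v)) \<partial>lborel)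
     = ennreal (2 / (1 + c)\<^sup>2 * sqrt (pi / \<tau>)) * sphere_freq \<tau> (v - u)"
proof -
  define h where "h = v - u"
  define q where "q = (1 + c) / 2"
  have q: "q > 0" using c by (simp add: q_def)
  define F :: "real^3 \<Rightarrow> real" where
    "F x = exp (- (\<tau> / 4) * (c * norm x + ((norm (h + x))\<^sup>2 - (norm h)\<^sup>2) / norm x)\<^sup>2) / norm x" for x
  have [measurable]: "F \<in> borel_measurable borel" unfolding F_def by measurable
  have "(\<integral>\<^sup>+w. ennreal (exp (- (\<tau> / 4) * (c * norm (w - v) + ((norm (w - u))\<^sup>2 - (norm (v - u))\<^sup>2) / norm (w - v))\<^sup>2) / norm (w - v)) \<partial>lborel)
     = (\<integral>\<^sup>+w. ennreal (F (w - v)) \<partial>lborel)"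
    by (simp add: F_def h_def algebra_simps)
  also have "\<dots> = (\<integral>\<^sup>+x. ennreal (F x) \<partial>lborel)"
    using nn_integral_lborel_translate[of "\<lambda>x. ennreal (F x)" "- v"] by simp
  also have "\<dots> = (\<integral>\<^sup>+n. (\<integral>\<^sup>+r. ennreal (r\<^sup>2) * indicator {0<..} r * ennreal (F (r *\<^sub>R n)) \<partial>lborel) \<partial>sphere_measure)"
    by (rule nn_integral_polar) measurable
  also have "\<dots> = (\<integral>\<^sup>+n. ennreal (sqrt (pi / \<tau>) / q\<^sup>2) * gauss_pos \<tau> (h \<bullet> n) \<partial>sphere_measure)"
  proof (rule nn_integral_sphere_measure_cong)
    fix n :: "real^3" assume n: "norm n = 1"
    define s where "s = h \<bullet> n"
    have Fr: "r\<^sup>2 * F (r *\<^sub>R n) = r * exp (- \<tau> * (q * r + s)\<^sup>2)" if r: "r > 0" for r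
    proof -
      have "(norm (h + r *\<^sub>R n))\<^sup>2 - (norm h)\<^sup>2 = r * (2 * s + r)"
        using n by (simp add: power2_norm_eq_inner inner_add_left inner_add_right inner_commute s_def norm_eq_1 algebra_simps)
      then have "((norm (h + r *\<^sub>R n))\<^sup>2 - (norm h)\<^sup>2) / norm (r *\<^sub>R n) = 2 * s + r"
        using r n by simp
      then have eq: "c * norm (r *\<^sub>R n) + ((norm (h + r *\<^sub>R n))\<^sup>2 - (norm h)\<^sup>2) / norm (r *\<^sub>R n) = 2 * (q * r + s)"
        using r n by (simp add: q_def field_simps)
      then have "F (r *\<^sub>R n) = exp (- \<tau> * (q * r + s)\<^sup>2) / r"
        unfolding F_def eq power_mult_distrib using r n by simp
      then show ?thesis using r by (simp add: power2_eq_square)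
    qed
    have "gauss_pos \<tau> s = ennreal q * (\<integral>\<^sup>+r. ennreal (sqrt (\<tau> / pi) * (q * r * exp (- \<tau> * (q * r + s)\<^sup>2))) * indicator {0<..} (q * r) \<partial>lborel)"
      unfolding gauss_pos_def using q by (subst nn_integral_real_affine[where c = q and t = 0]) auto
    also have "\<dots> = ennreal q * (\<integral>\<^sup>+r. ennreal (sqrt (\<tau> / pi) * q) * (ennreal (r\<^sup>2) * indicator {0<..} r * ennreal (F (r *\<^sub>R n))) \<partial>lborel)"
    proof (rule arg_cong[where f = "\<lambda>x. ennreal q * x"], rule nn_integral_cong)
      fix r :: real
      show "ennreal (sqrt (\<tau> / pi) * (q * r * exp (- \<tau> * (q * r + s)\<^sup>2))) * indicator {0<..} (q * r)
          = ennreal (sqrt (\<tau> / pi) * q) * (ennreal (r\<^sup>2) * indicator {0<..} r * ennreal (F (r *\<^sub>R n)))"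
      proof (cases "r > 0")
        case True
        have "0 \<le> F (r *\<^sub>R n)" by (simp add: F_def)
        then have "ennreal (r\<^sup>2) * ennreal (F (r *\<^sub>R n)) = ennreal (r * exp (- \<tau> * (q * r + s)\<^sup>2))"
          using Fr[OF True] by (simp add: ennreal_mult[symmetric])
        then show ?thesis using True q \<tau> by (simp add: ennreal_mult[symmetric] mult.assoc)
      next
        case False then show ?thesis using q by (simp add: zero_less_mult_iff)
      qed
    qed
    also have "\<dots> = ennreal q * (ennreal (sqrt (\<tau> / pi) * q) * (\<integral>\<^sup>+r. (ennreal (r\<^sup>2) * indicator {0<..} r * ennreal (F (r *\<^sub>R n))) \<partial>lborel))"
      by (subst nn_integral_cmult) auto
    finally have gp: "gauss_pos \<tau> s = \<dots>" .
    \<comment> \<open>The scaling \<open>y = q * r\<close> produces \<open>q\<close> twice, once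
      from the measure and once from the factor \<open>r\<close> of the integrand.\<close>
    have "ennreal (sqrt (pi / \<tau>) / q\<^sup>2) * (ennreal q * ennreal (sqrt (\<tau> / pi) * q)) = ennreal (sqrt (pi / \<tau>) / q\<^sup>2 * (q * (sqrt (\<tau> / pi) * q)))"
      using q \<tau> by (simp add: ennreal_mult[symmetric])
    also have "sqrt (pi / \<tau>) / q\<^sup>2 * (q * (sqrt (\<tau> / pi) * q)) = sqrt (pi / \<tau>) * sqrt (\<tau> / pi)"
      using q by (simp add: power2_eq_square)
    also have "\<dots> = 1" using \<tau> by (simp add: real_sqrt_mult[symmetric])
    finally have "ennreal (sqrt (pi / \<tau>) / q\<^sup>2) * (ennreal q * ennreal (sqrt (\<tau> / pi) * q)) = 1" by simp
    then show "(\<integral>\<^sup>+r. ennreal (r\<^sup>2) * indicator {0<..} r * ennreal (F (r *\<^sub>R n)) \<partial>lborel) = ennreal (sqrt (pi / \<tau>) / q\<^sup>2) * gauss_pos \<tau> (h \<bullet> n)"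
      unfolding s_def[symmetric] gp by (simp add: mult.assoc[symmetric])
  qed measurable
  also have "\<dots> = ennreal (sqrt (pi / \<tau>) / q\<^sup>2) * (\<integral>\<^sup>+n. gauss_pos \<tau> (h \<bullet> n) \<partial>sphere_measure)"
    by (rule nn_integral_cmult) measurable
  also have "ennreal (sqrt (pi / \<tau>) / q\<^sup>2) = ennreal (2 / (1 + c)\<^sup>2 * sqrt (pi / \<tau>)) * 2"
  proof -
    have "sqrt (pi / \<tau>) / q\<^sup>2 = 2 / (1 + c)\<^sup>2 * sqrt (pi / \<tau>) * 2" by (simp add: q_def power_divide)
    then show ?thesis by (simp only: ennreal_mult'' zero_le_numeral ennreal_numeral)
  qed
  finally show ?thesis by (simp add: sphere_freq_eq_pos h_def mult.assoc)
qed

end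

text \<open>After Tonelli the inner integral sees only the component of \<open>w\<close> along
  \<open>n\<close>; the transverse Gaussian mass turns the three-dimensional normalisation into the
  one-dimensional one. Finiteness of \<open>sphere_freq\<close> is what makes the real-valued
  integral carry the full information.\<close>

lemma ennreal_coll_freq:
  assumes "m1 > 0" "th1 > 0"
  shows "ennreal (coll_freq m1 u1 th1 v) = sphere_freq (m1 / (2 * th1)) (v - u1)"
proof -
  define \<tau> where "\<tau> = m1 / (2 * th1)"
  have \<tau>: "\<tau> > 0" using assms by (simp add: \<tau>_def)
  define C where "C = (\<tau> / pi) powr (3/2)"
  have M1: "Maxw1 m1 u1 th1 w = C * exp (- \<tau> * (norm (w - u1))\<^sup>2)" for w
    by (simp add: Maxw1_def C_def \<tau>_def field_simps)
  have C: "C * (pi / \<tau>) = sqrt (\<tau> / pi)" "C \<ge> 0"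
  proof -
    have "C = (\<tau> / pi) powr (1 + 1/2)" by (simp add: C_def)
    also have "\<dots> = (\<tau> / pi) powr 1 * (\<tau> / pi) powr (1/2)" by (rule powr_add)
    also have "\<dots> = (\<tau> / pi) * sqrt (\<tau> / pi)" using \<tau> by (simp add: powr_half_sqrt)
    finally show "C * (pi / \<tau>) = sqrt (\<tau> / pi)" using \<tau> by simp
  qed (simp add: C_def)
  interpret P: pair_sigma_finite "lborel :: (real^3) measure" sphere_measure ..
  have [measurable]: "Maxw1 m1 u1 th1 \<in> borel_measurable borel" unfolding M1[abs_def] by measurable
  have m: "(\<lambda>(w, n). \<bar>(v - w) \<bullet> n\<bar> * Maxw1 m1 u1 th1 w) \<in> borel_measurable (lborel \<Otimes>\<^sub>M sphere_measure)"
    by measurable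
  have "coll_freq m1 u1 th1 v = enn2real (\<integral>\<^sup>+p. ennreal (case p of (w, n) \<Rightarrow> \<bar>(v - w) \<bullet> n\<bar> * Maxw1 m1 u1 th1 w) \<partial>(lborel \<Otimes>\<^sub>M sphere_measure))"
    unfolding coll_freq_def by (rule integral_eq_nn_integral[OF m]) (auto simp: M1 C(2))
  also have "(\<integral>\<^sup>+p. ennreal (case p of (w, n) \<Rightarrow> \<bar>(v - w) \<bullet> n\<bar> * Maxw1 m1 u1 th1 w) \<partial>(lborel \<Otimes>\<^sub>M sphere_measure))
     = (\<integral>\<^sup>+n. (\<integral>\<^sup>+w. ennreal (\<bar>(v - w) \<bullet> n\<bar> * Maxw1 m1 u1 th1 w) \<partial>lborel) \<partial>sphere_measure)"
    using P.nn_integral_snd[of "\<lambda>p. ennreal (case p of (w, n) \<Rightarrow> \<bar>(v - w) \<bullet> n\<bar> * Maxw1 m1 u1 th1 w)"] by simp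
  also have "\<dots> = sphere_freq \<tau> (v - u1)"
    unfolding sphere_freq_def
  proof (rule nn_integral_sphere_measure_cong)
    fix n :: "real^3" assume n: "norm n = 1"
    have "(\<integral>\<^sup>+w. ennreal (\<bar>(v - w) \<bullet> n\<bar> * Maxw1 m1 u1 th1 w) \<partial>lborel)
        = (\<integral>\<^sup>+w. ennreal (\<bar>(v - (u1 + w)) \<bullet> n\<bar> * Maxw1 m1 u1 th1 (u1 + w)) \<partial>lborel)"
      by (rule nn_integral_lborel_translate[symmetric]) measurable
    also have "\<dots> = (\<integral>\<^sup>+w. (ennreal \<bar>(v - u1) \<bullet> n - w \<bullet> n\<bar> * ennreal C) * ennreal (exp (- \<tau> * (norm w)\<^sup>2)) \<partial>lborel)"
      using C(2) by (intro nn_integral_cong) (simp add: M1 ennreal_mult[symmetric] inner_diff_left inner_add_left mult.assoc diff_diff_eq)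
    also have "\<dots> = ennreal (pi / \<tau>) * (\<integral>\<^sup>+x. (ennreal \<bar>(v - u1) \<bullet> n - x\<bar> * ennreal C) * ennreal (exp (- \<tau> * x\<^sup>2)) \<partial>lborel)"
      by (rule nn_integral_gaussian_marginal[OF \<tau> n]) measurable
    also have "\<dots> = (\<integral>\<^sup>+x. ennreal (pi / \<tau>) * ((ennreal \<bar>(v - u1) \<bullet> n - x\<bar> * ennreal C) * ennreal (exp (- \<tau> * x\<^sup>2))) \<partial>lborel)"
      by (rule nn_integral_cmult[symmetric]) measurable
    also have "\<dots> = gauss_abs \<tau> ((v - u1) \<bullet> n)"
      unfolding gauss_abs_def C(1)[symmetric] using C(2) \<tau>
      by (intro nn_integral_cong) (simp add: ennreal_mult[symmetric] mult_ac)
    finally show "(\<integral>\<^sup>+w. ennreal (\<bar>(v - w) \<bullet> n\<bar> * Maxw1 m1 u1 th1 w) \<partial>lborel) = gauss_abs \<tau> ((v - u1) \<bullet> n)" .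
  qed measurable
  finally have "coll_freq m1 u1 th1 v = enn2real (sphere_freq \<tau> (v - u1))" .
  then show ?thesis using sphere_freq_finite[OF \<tau>, of "v - u1"] by (simp add: \<tau>_def less_top)
qed

context
  fixes m1 th1 :: real and u1 :: "real^3"
  assumes m1: "m1 > 0" and th1: "th1 > 0"
begin

lemma coll_freq_nonneg: "0 \<le> coll_freq m1 u1 th1 v"
  unfolding coll_freq_def Maxw1_def by (intro integral_nonneg_AE) auto

lemma \<tau>_pos: "0 < m1 / (2 * th1)"
  using m1 th1 by simp

lemma coll_freq_min: "coll_freq m1 u1 th1 u1 \<le> coll_freq m1 u1 th1 v"
proof -
  have "ennreal (coll_freq m1 u1 th1 u1) \<le> ennreal (coll_freq m1 u1 th1 v)"
    unfolding ennreal_coll_freq[OF m1 th1] using sphere_freq_min[OF \<tau>_pos] by simp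
  then show ?thesis by (simp add: coll_freq_nonneg)
qed

lemma coll_freq_pos: "0 < coll_freq m1 u1 th1 u1"
proof -
  have "0 < ennreal (coll_freq m1 u1 th1 u1)"
    unfolding ennreal_coll_freq[OF m1 th1] using \<tau>_pos sphere_area_pos m1 th1 by (simp add: sphere_freq_0)
  then show ?thesis by (simp add: ennreal_less_zero_iff)
qed

lemma coll_freq_continuous: "continuous_on UNIV (coll_freq m1 u1 th1)"
proof -
  have *: "coll_freq m1 u1 th1 v \<le> coll_freq m1 u1 th1 w + norm (v - w) * sphere_area" for v w
  proof -
    have "ennreal (coll_freq m1 u1 th1 v) \<le> ennreal (coll_freq m1 u1 th1 w) + ennreal (norm (v - w) * sphere_area)"
      unfolding ennreal_coll_freq[OF m1 th1]
      using sphere_freq_lipschitz[OF \<tau>_pos, of "v - u1" "w - u1"] by simp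
    then show ?thesis using sphere_area_pos by (simp add: coll_freq_nonneg flip: ennreal_plus)
  qed
  have "sphere_area-lipschitz_on UNIV (coll_freq m1 u1 th1)"
  proof (rule lipschitz_onI)
    fix v w
    show "dist (coll_freq m1 u1 th1 v) (coll_freq m1 u1 th1 w) \<le> sphere_area * dist v w"
      using *[of v w] *[of w v] by (simp add: dist_real_def dist_norm norm_minus_commute mult.commute abs_le_iff)
  qed (use sphere_area_pos in simp)
  then show ?thesis by (rule lipschitz_on_continuous_on)
qed

text \<open>The intermediate value theorem along one ray from \<open>u1\<close>: the linear lower
  bound reaches \<open>y\<close> at parameter \<open>y / c\<close>.\<close>

lemma range_coll_freq: "range (coll_freq m1 u1 th1) = {coll_freq m1 u1 th1 u1..}"
proof (intro equalityI subsetI)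
  fix y assume "y \<in> {coll_freq m1 u1 th1 u1..}"
  then have y: "coll_freq m1 u1 th1 u1 \<le> y" by simp
  obtain c where c: "c > 0" "\<And>t. t \<ge> 0 \<Longrightarrow> ennreal (c * t) \<le> sphere_freq (m1 / (2 * th1)) (t *\<^sub>R axis 1 1)"
    using sphere_freq_unbounded[OF \<tau>_pos] by metis
  define f where "f t = coll_freq m1 u1 th1 (u1 + t *\<^sub>R axis 1 1)" for t :: real
  have cf: "continuous_on {0..y / c} f" unfolding f_def
    by (rule continuous_on_compose2[OF coll_freq_continuous]) (auto intro!: continuous_intros)
  have y0: "0 \<le> y / c" using y coll_freq_pos c(1) by simp
  have "ennreal (c * (y / c)) \<le> ennreal (f (y / c))"
    unfolding f_def ennreal_coll_freq[OF m1 th1] using c(2)[OF y0] by simp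
  then have "y \<le> f (y / c)" using c(1) by (simp add: f_def coll_freq_nonneg)
  moreover have "f 0 \<le> y" using y by (simp add: f_def)
  ultimately obtain t where "f t = y" using IVT'[of f 0 y "y / c"] cf y0 by auto
  then show "y \<in> range (coll_freq m1 u1 th1)" by (auto simp: f_def)
qed (use coll_freq_min in auto)

end

section \<open>Compactness of the symmetrised gain operator\<close>

text \<open>The case of slope 1 with both centres at the origin: the bracket of
  \<open>nn_integral_radial\<close> becomes \<open>2 * norm x\<close>, and the factor 4 of its
  square cancels the quarter in the exponent.\<close>

lemma nn_integral_gaussian_over_norm_finite:
  assumes s: "s > 0"
  shows "(\<integral>\<^sup>+x. ennreal (exp (- s * (norm (x::real^3))\<^sup>2) / norm x) \<partial>lborel) < \<infinity>"
proof -
  have eq: "exp (- (s / 4) * (1 * norm (x - 0) + ((norm (x - 0))\<^sup>2 - (norm (0 - 0 :: real^3))\<^sup>2) / norm (x - 0))\<^sup>2) / norm (x - 0)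
      = exp (- s * (norm x)\<^sup>2) / norm x" for x :: "real^3"
  proof (cases "x = 0")
    case False
    have "1 * norm (x - 0) + ((norm (x - 0))\<^sup>2 - (norm (0 - 0 :: real^3))\<^sup>2) / norm (x - 0) = 2 * norm x"
      using False by (simp add: power2_eq_square)
    then show ?thesis by (simp only: power_mult_distrib) simp
  qed simp
  have "(\<integral>\<^sup>+x. ennreal (exp (- s * (norm (x::real^3))\<^sup>2) / norm x) \<partial>lborel)
     = ennreal (2 / (1 + 1)\<^sup>2 * sqrt (pi / s)) * sphere_freq s (0 - 0)"
    by (rule nn_integral_radial[OF s, of 1 0 0, unfolded eq]) simp
  also have "\<dots> < \<infinity>" using sphere_freq_finite[OF s, of 0] by (simp add: ennreal_mult_less_top)
  finally show ?thesis .
qed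

lemma square_integrable_gaussian:
  fixes u :: "real^3"
  assumes s: "s > 0"
  shows "square_integrable (\<lambda>w. C * exp (- s * (norm (w - u))\<^sup>2))"
proof -
  have "(\<integral>\<^sup>+w. ennreal (exp (- (2 * s) * (norm (w::real^3))\<^sup>2)) \<partial>lborel) < \<infinity>"
    using nn_integral_gaussian_marginal[of "2 * s" "axis 1 1" "\<lambda>_. 1"] s
    by (simp add: nn_integral_gaussian[unfolded mult_minus_left] ennreal_mult_less_top)
  also have "(\<integral>\<^sup>+w. ennreal (exp (- (2 * s) * (norm (w::real^3))\<^sup>2)) \<partial>lborel)
      = (\<integral>\<^sup>+w. ennreal (exp (- (2 * s) * (norm (w - u))\<^sup>2)) \<partial>lborel)"
    using nn_integral_lborel_translate[of "\<lambda>w. ennreal (exp (- (2 * s) * (norm (w::real^3))\<^sup>2))" "- u"] by simp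
  finally have *: "(\<integral>\<^sup>+w. ennreal (exp (- (2 * s) * (norm (w - u))\<^sup>2)) \<partial>lborel) < \<infinity>" .
  have "(norm (C * exp (- s * (norm (w - u))\<^sup>2)))\<^sup>2 = C\<^sup>2 * exp (- (2 * s) * (norm (w - u))\<^sup>2)" for w
    by (simp add: power_mult_distrib flip: exp_double)
  then have "(\<integral>\<^sup>+w. ennreal ((norm (C * exp (- s * (norm (w - u))\<^sup>2)))\<^sup>2) \<partial>lborel)
      = ennreal (C\<^sup>2) * (\<integral>\<^sup>+w. ennreal (exp (- (2 * s) * (norm (w - u))\<^sup>2)) \<partial>lborel)"
    by (simp add: ennreal_mult nn_integral_cmult)
  also have "\<dots> < \<infinity>" using * by (simp add: ennreal_mult_less_top)
  finally show ?thesis by (simp add: square_integrable_iff_nn)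
qed

lemma Cauchy_Schwarz_kernel:
  fixes f :: "'a::euclidean_space \<Rightarrow> complex" and g :: "'a \<Rightarrow> real"
  assumes f: "square_integrable f" and g: "square_integrable g"
  shows "integrable lborel (\<lambda>w. g w *\<^sub>R f w)"
    and "norm (\<integral>w. g w *\<^sub>R f w \<partial>lborel) \<le> norm (abs_l2 g) * norm (abs_l2 f)"
proof -
  have [measurable]: "f \<in> borel_measurable borel" "g \<in> borel_measurable borel"
    using f g by (auto simp: square_integrable_def)
  define f' where "f' w = norm (f w)" for w
  have f': "square_integrable f'" using f by (simp add: f'_def[abs_def] square_integrable_def)
  have g': "square_integrable (\<lambda>w. \<bar>g w\<bar>)" using g by (simp add: square_integrable_def)
  have i: "integrable lborel (\<lambda>w. \<bar>g w\<bar> * norm (f w))"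
    using square_integrable_inner(2)[OF g' f'] by (simp add: f'_def)
  show "integrable lborel (\<lambda>w. g w *\<^sub>R f w)"
    by (rule Bochner_Integration.integrable_bound[OF i]) auto
  have "norm (\<integral>w. g w *\<^sub>R f w \<partial>lborel) \<le> (\<integral>w. norm (g w *\<^sub>R f w) \<partial>lborel)" by (rule integral_norm_bound)
  also have "\<dots> = abs_l2 (\<lambda>w. \<bar>g w\<bar>) \<bullet> abs_l2 f'"
    by (simp add: abs_l2_inner[OF g' f'] f'_def)
  also have "\<dots> \<le> norm (abs_l2 (\<lambda>w. \<bar>g w\<bar>)) * norm (abs_l2 f')"
    using Cauchy_Schwarz_ineq2 abs_le_D1 by blast
  also have "\<dots> = norm (abs_l2 g) * norm (abs_l2 f)"
    by (simp add: norm_abs_l2 f g f' g') (simp add: f'_def)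
  finally show "norm (\<integral>w. g w *\<^sub>R f w \<partial>lborel) \<le> norm (abs_l2 g) * norm (abs_l2 f)" .
qed

section \<open>The symmetric kernel, its majorant and its truncations\<close>

locale gain_kernel =
  fixes a c \<kappa> :: real and u :: "real^3"
  assumes a: "a > 0" and c: "c > 0" and \<kappa>: "\<kappa> > 0"
begin

definition G :: "real^3 \<Rightarrow> real^3 \<Rightarrow> real" where
  "G v w = \<kappa> / norm (v - w) *
     exp (- a * ((c * norm (v - w))\<^sup>2 + (((norm (v - u))\<^sup>2 - (norm (w - u))\<^sup>2) / norm (v - w))\<^sup>2))"

text \<open>Both denominators are truncated, the one inside the exponent as well: this makes the
  kernel continuous in \<open>v\<close>, and it leaves \<open>G\<close> unchanged wherever
  \<open>norm (v - w)\<close> is at least \<open>\<delta>\<close>.\<close>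

definition Gcut :: "real \<Rightarrow> real^3 \<Rightarrow> real^3 \<Rightarrow> real" where
  "Gcut \<delta> v w = \<kappa> / max \<delta> (norm (v - w)) *
     exp (- a * ((c * norm (v - w))\<^sup>2 + (((norm (v - u))\<^sup>2 - (norm (w - u))\<^sup>2) / max \<delta> (norm (v - w)))\<^sup>2))"

text \<open>Dropping the energy difference leaves a function of \<open>v - w\<close> alone, so one
  integral bounds all rows and all columns of \<open>G\<close>.\<close>

definition W :: "real^3 \<Rightarrow> real" where
  "W x = \<kappa> / norm x * exp (- a * (c * norm x)\<^sup>2)"

lemma W_measurable [measurable]: "W \<in> borel_measurable borel"
  unfolding W_def by measurable

lemma W_nonneg: "0 \<le> W x"
  using \<kappa> by (simp add: W_def)

lemma G_measurable [measurable]: "case_prod G \<in> borel_measurable (borel \<Otimes>\<^sub>M borel)"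
  unfolding G_def by measurable

lemma Gcut_measurable [measurable]: "case_prod (Gcut \<delta>) \<in> borel_measurable (borel \<Otimes>\<^sub>M borel)"
  unfolding Gcut_def by measurable

lemma G_sym: "G v w = G w v"
  by (simp add: G_def norm_minus_commute[of w v] power_divide power2_commute[of "(norm (v - u))\<^sup>2"])

lemma G_pos: "v \<noteq> w \<Longrightarrow> 0 < G v w"
  using \<kappa> by (simp add: G_def)

lemma G_nonneg: "0 \<le> G v w"
  using \<kappa> by (simp add: G_def)

lemma Gcut_nonneg: "\<delta> > 0 \<Longrightarrow> 0 \<le> Gcut \<delta> v w"
  using \<kappa> by (simp add: Gcut_def)

lemma G_le_W: "G v w \<le> W (v - w)"
  unfolding G_def W_def using \<kappa> a by (intro mult_left_mono) auto

lemma Gcut_le: "\<delta> > 0 \<Longrightarrow> Gcut \<delta> v w \<le> \<kappa> / \<delta> * exp (- a * (c * norm (v - w))\<^sup>2)"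
  unfolding Gcut_def using \<kappa> a by (intro mult_mono divide_left_mono) auto

text \<open>The diagonal is excluded because \<open>W 0\<close> is 0 by the convention for division,
  while \<open>Gcut\<close> is positive there.\<close>

lemma Gcut_le_W: "\<delta> > 0 \<Longrightarrow> v \<noteq> w \<Longrightarrow> Gcut \<delta> v w \<le> W (v - w)"
  unfolding Gcut_def W_def using \<kappa> a by (intro mult_mono divide_left_mono) auto

lemma nn_integral_W_finite: "(\<integral>\<^sup>+x. ennreal (W x) \<partial>lborel) < \<infinity>"
proof -
  have "W x = \<kappa> * (exp (- (a * c\<^sup>2) * (norm x)\<^sup>2) / norm x)" for x
    by (simp add: W_def power_mult_distrib)
  then have eq: "ennreal (W x) = ennreal \<kappa> * ennreal (exp (- (a * c\<^sup>2) * (norm x)\<^sup>2) / norm x)" for x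
    using \<kappa> by (simp only: ennreal_mult' less_imp_le)
  have "(\<integral>\<^sup>+x. ennreal (W x) \<partial>lborel) = ennreal \<kappa> * (\<integral>\<^sup>+x. ennreal (exp (- (a * c\<^sup>2) * (norm (x::real^3))\<^sup>2) / norm x) \<partial>lborel)"
    unfolding eq by (rule nn_integral_cmult) measurable
  also have "\<dots> < \<infinity>"
    using nn_integral_gaussian_over_norm_finite[of "a * c\<^sup>2"] a c by (simp add: ennreal_mult_less_top)
  finally show ?thesis .
qed

definition A :: real where "A = enn2real (\<integral>\<^sup>+x. ennreal (W x) \<partial>lborel)"

lemma A_nonneg: "0 \<le> A" by (simp add: A_def)

lemma nn_integral_W: "(\<integral>\<^sup>+x. ennreal (W x) \<partial>lborel) = ennreal A"
  using nn_integral_W_finite by (simp add: A_def less_top)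

lemma nn_integral_W_shift:
  "(\<integral>\<^sup>+w. ennreal (W (v - w)) \<partial>lborel) = ennreal A" "(\<integral>\<^sup>+v. ennreal (W (v - w)) \<partial>lborel) = ennreal A"
proof -
  have W: "W (- x) = W x" for x by (simp add: W_def)
  have "(\<integral>\<^sup>+x. ennreal (W (x - v)) \<partial>lborel) = ennreal A" for v
    using nn_integral_lborel_translate[of "\<lambda>x. ennreal (W x)" "- v"] nn_integral_W by simp
  then show "(\<integral>\<^sup>+w. ennreal (W (v - w)) \<partial>lborel) = ennreal A" "(\<integral>\<^sup>+v. ennreal (W (v - w)) \<partial>lborel) = ennreal A"
    using W[of "v - _"] by (simp_all add: W[symmetric, of "v - _"])
qed

lemma schur_G: "schur_kernel G A A"
  unfolding schur_kernel_def
proof (intro conjI allI)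
  show "(\<integral>\<^sup>+w. ennreal \<bar>G v w\<bar> \<partial>lborel) \<le> ennreal A" for v
    unfolding nn_integral_W_shift(1)[symmetric, of v]
    by (intro nn_integral_mono ennreal_leI) (simp add: G_nonneg G_le_W)
  show "(\<integral>\<^sup>+v. ennreal \<bar>G v w\<bar> \<partial>lborel) \<le> ennreal A" for w
    unfolding nn_integral_W_shift(2)[symmetric, of w]
    by (intro nn_integral_mono ennreal_leI) (simp add: G_nonneg G_le_W)
qed (auto simp: A_nonneg)

lemma nn_integral_W_near_diagonal:
  assumes e: "e > 0"
  obtains \<delta> where "\<delta> > 0" "(\<integral>\<^sup>+x. ennreal (W x) * indicator (ball 0 \<delta>) x \<partial>lborel) \<le> ennreal e"
proof -
  have "(\<lambda>n. \<integral>\<^sup>+x. ennreal (W x) * indicator (ball 0 (1 / real (Suc n))) x \<partial>lborel) \<longlonglongrightarrow> (\<integral>\<^sup>+x. 0 \<partial>(lborel :: (real^3) measure))"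
  proof (rule nn_integral_dominated_convergence[where w = "\<lambda>x. ennreal (W x)"])
    show "AE x in lborel. (\<lambda>n. ennreal (W x) * indicator (ball 0 (1 / real (Suc n))) x) \<longlonglongrightarrow> 0"
      using AE_lborel_singleton[of "0::real^3"]
    proof eventually_elim
      case (elim x)
      then obtain N where N: "1 / real (Suc N) < norm x" using nat_approx_posE[of "norm x"] by auto
      have "x \<notin> ball 0 (1 / real (Suc n))" if "n \<ge> N" for n
      proof -
        have "1 / real (Suc n) \<le> 1 / real (Suc N)" using that by (simp add: frac_le)
        then show ?thesis using N by simp
      qed
      then have "eventually (\<lambda>n. ennreal (W x) * indicator (ball 0 (1 / real (Suc n))) x = 0) sequentially"
        by (intro eventually_sequentiallyI[of N]) auto
      then show ?case by (rule tendsto_eventually)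
    qed
  qed (use nn_integral_W_finite in \<open>auto simp: indicator_def\<close>)
  then have "eventually (\<lambda>n. (\<integral>\<^sup>+x. ennreal (W x) * indicator (ball 0 (1 / real (Suc n))) x \<partial>lborel) < ennreal e) sequentially"
    by (rule order_tendstoD(2)) (use e in simp)
  then obtain n where "(\<integral>\<^sup>+x. ennreal (W x) * indicator (ball 0 (1 / real (Suc n))) x \<partial>lborel) < ennreal e"
    by (auto simp: eventually_sequentially)
  then show thesis by (intro that[of "1 / real (Suc n)"]) auto
qed

text \<open>The energy term contains \<open>2 * (h \<bullet> x) / norm x\<close> with
  \<open>h = v - u\<close>. For almost every fixed \<open>x\<close> it is unbounded as
  \<open>h\<close> grows along a fixed direction, so rows tend to 0 by dominated convergence under
  \<open>W\<close>. Uniformity over all directions of \<open>h\<close> comes from rotation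
  invariance.\<close>

lemma G_row_decay:
  assumes e: "e > 0"
  obtains R where "\<And>v. norm (v - u) > R \<Longrightarrow> (\<integral>\<^sup>+w. ennreal (G v w) \<partial>lborel) \<le> ennreal e"
proof -
  define P :: "real^3 \<Rightarrow> real^3 \<Rightarrow> real" where
    "P h x = \<kappa> / norm x * exp (- a * ((c * norm x)\<^sup>2 + ((2 * (h \<bullet> x) + (norm x)\<^sup>2) / norm x)\<^sup>2))" for h x
  have [measurable]: "P h \<in> borel_measurable borel" for h unfolding P_def by measurable
  have P0: "0 \<le> P h x" for h x using \<kappa> by (simp add: P_def)
  have PW: "P h x \<le> W x" for h x
    unfolding P_def W_def using \<kappa> a by (intro mult_left_mono) auto
  have row: "(\<integral>\<^sup>+w. ennreal (G v w) \<partial>lborel) = (\<integral>\<^sup>+x. ennreal (P (v - u) x) \<partial>lborel)" for v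
  proof -
    have shift: "(\<integral>\<^sup>+w. ennreal (G v w) \<partial>lborel) = (\<integral>\<^sup>+x. ennreal (G v (v + x)) \<partial>lborel)"
      using measurable_Pair2[OF G_measurable, of v] by (intro nn_integral_lborel_translate[symmetric]) simp
    have GP: "G v (v + x) = P (v - u) x" for x
    proof -
      have E: "(norm (v - u))\<^sup>2 - (norm (v + x - u))\<^sup>2 = - (2 * ((v - u) \<bullet> x) + (norm x)\<^sup>2)"
        by (simp add: power2_norm_eq_inner algebra_simps inner_commute)
      have "(((norm (v - u))\<^sup>2 - (norm (v + x - u))\<^sup>2) / norm x)\<^sup>2 = ((2 * ((v - u) \<bullet> x) + (norm x)\<^sup>2) / norm x)\<^sup>2"
        unfolding E by (simp only: minus_divide_left[symmetric] power2_minus)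
      then show ?thesis by (simp add: G_def P_def)
    qed
    show ?thesis unfolding shift GP ..
  qed
  define b :: "real^3" where "b = axis 1 1"
  have b: "norm b = 1" by (simp add: b_def)
  \<comment> \<open>The row integral depends on \<open>h\<close> only through its length, so a
    sequence going to infinity in varying directions may be replaced by one on a single ray;
    pointwise convergence then fails at most on a hyperplane.\<close>
  have rot: "(\<integral>\<^sup>+x. ennreal (P h x) \<partial>lborel) = (\<integral>\<^sup>+x. ennreal (P (norm h *\<^sub>R b) x) \<partial>lborel)" for h
  proof -
    obtain Q where Q: "orthogonal_transformation Q" "Q h = norm h *\<^sub>R b"
      using orthogonal_transformation_exists[of h "norm h *\<^sub>R b"] b by auto
    have "P (norm h *\<^sub>R b) (Q x) = P h x" for x
      using Q(1) unfolding Q(2)[symmetric] P_def orthogonal_transformation_norm[OF Q(1)]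
      by (simp add: orthogonal_transformation_def)
    then show ?thesis
      using nn_integral_lborel_orthogonal[OF Q(1), of "\<lambda>x. ennreal (P (norm h *\<^sub>R b) x)"] by simp
  qed
  show thesis
  proof (rule ccontr)
    assume *: "\<not> thesis"
    have "\<exists>v. norm (v - u) > real n \<and> \<not> (\<integral>\<^sup>+w. ennreal (G v w) \<partial>lborel) \<le> ennreal e" for n
      using * that by blast
    then obtain v where v: "\<And>n. norm (v n - u) > real n" "\<And>n. (\<integral>\<^sup>+w. ennreal (G (v n) w) \<partial>lborel) > ennreal e"
      by (metis not_le)
    define t where "t n = norm (v n - u)" for n
    have t: "t n \<ge> real n" for n using v(1)[of n] by (simp add: t_def)
    have "(\<lambda>n. \<integral>\<^sup>+x. ennreal (P (t n *\<^sub>R b) x) \<partial>lborel) \<longlonglongrightarrow> (\<integral>\<^sup>+x. 0 \<partial>(lborel :: (real^3) measure))"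
    proof (rule nn_integral_dominated_convergence[where w = "\<lambda>x. ennreal (W x)"])
      have "negligible {x. b \<bullet> x = 0}" using negligible_hyperplane[of b 0] by (simp add: b_def)
      then have "{x. b \<bullet> x = 0} \<in> null_sets lebesgue" by (simp add: negligible_iff_null_sets)
      then have "{x. b \<bullet> x = 0} \<in> null_sets lborel" by (simp add: null_sets_completion_iff)
      then have "AE x in lborel. b \<bullet> x \<noteq> 0" by (auto dest: AE_not_in)
      then show "AE x in lborel. (\<lambda>n. ennreal (P (t n *\<^sub>R b) x)) \<longlonglongrightarrow> 0"
      proof eventually_elim
        case (elim x)
        define d r where "d = \<bar>b \<bullet> x\<bar>" and "r = norm x"
        have d: "d > 0" "r > 0" using elim by (auto simp: d_def r_def)
        \<comment> \<open>Once this lower bound \<open>z\<close> for the modulus of the energy term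
          is at least 1, it is below its own square, so the quadratic exponent is controlled by a
          linear one.\<close>
        have lim: "filterlim (\<lambda>n. (2 * real n * d - r\<^sup>2) / r) at_top sequentially" using d by real_asymp
        have lim0: "(\<lambda>n. \<kappa> / r * exp (- a * ((2 * real n * d - r\<^sup>2) / r))) \<longlonglongrightarrow> 0"
          using d a \<kappa> by real_asymp
        have "eventually (\<lambda>n. norm (P (t n *\<^sub>R b) x) \<le> \<kappa> / r * exp (- a * ((2 * real n * d - r\<^sup>2) / r))) sequentially"
          using filterlim_at_top_ge[THEN iffD1, OF lim, rule_format, of 1, OF order_refl]
        proof eventually_elim
          case (elim n)
          define z y where "z = (2 * real n * d - r\<^sup>2) / r" and "y = (2 * (t n * (b \<bullet> x)) + r\<^sup>2) / r"
          have "2 * real n * d \<le> 2 * t n * d" using t[of n] d by simp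
          also have "\<dots> = \<bar>2 * (t n * (b \<bullet> x))\<bar>" using t[of n] by (simp add: d_def abs_mult)
          finally have "2 * real n * d - r\<^sup>2 \<le> \<bar>2 * (t n * (b \<bullet> x)) + r\<^sup>2\<bar>"
            using zero_le_power2[of r] by linarith
          then have "z \<le> \<bar>y\<bar>" using d by (simp add: z_def y_def abs_divide divide_right_mono)
          moreover have z1: "1 \<le> z" using elim by (simp add: z_def)
          ultimately have "z\<^sup>2 \<le> y\<^sup>2" by (simp add: abs_le_square_iff[symmetric])
          moreover have "z \<le> z\<^sup>2" using z1 by (simp add: power2_eq_square)
          ultimately have "z \<le> (c * r)\<^sup>2 + y\<^sup>2" using zero_le_power2[of "c * r"] by linarith
          then have "exp (- a * ((c * r)\<^sup>2 + y\<^sup>2)) \<le> exp (- a * z)" using a by simp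
          then have "\<kappa> / r * exp (- a * ((c * r)\<^sup>2 + y\<^sup>2)) \<le> \<kappa> / r * exp (- a * z)"
            using \<kappa> d by (intro mult_left_mono) auto
          then have "P (t n *\<^sub>R b) x \<le> \<kappa> / r * exp (- a * z)" by (simp add: P_def y_def r_def)
          then show ?case unfolding z_def[symmetric] using P0[of "t n *\<^sub>R b" x] by simp
        qed
        then have "(\<lambda>n. P (t n *\<^sub>R b) x) \<longlonglongrightarrow> 0"
          by (rule Lim_null_comparison[OF _ lim0])
        then show ?case by (simp add: tendsto_ennreal_iff P0 flip: ennreal_0)
      qed
    qed (use nn_integral_W_finite in \<open>auto simp: PW ennreal_leI\<close>)
    then have "eventually (\<lambda>n. (\<integral>\<^sup>+x. ennreal (P (t n *\<^sub>R b) x) \<partial>lborel) < ennreal e) sequentially"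
      by (rule order_tendstoD(2)) (use e in simp)
    then obtain n where "(\<integral>\<^sup>+x. ennreal (P (t n *\<^sub>R b) x) \<partial>lborel) < ennreal e"
      by (auto simp: eventually_sequentially)
    then show False using v(2)[of n] row[of "v n"] rot[of "v n - u"] by (simp add: t_def)
  qed
qed

text \<open>Only \<open>v\<close> is confined to a ball; for such \<open>v\<close> the Gaussian
  factor in \<open>v - w\<close> already controls large \<open>w\<close>.\<close>

definition Glocal :: "real \<Rightarrow> real \<Rightarrow> real^3 \<Rightarrow> real^3 \<Rightarrow> real" where
  "Glocal R \<delta> v w = indicator (cball u R) v * Gcut \<delta> v w"

lemma Glocal_measurable [measurable]: "case_prod (Glocal R \<delta>) \<in> borel_measurable (borel \<Otimes>\<^sub>M borel)"
proof -
  have [measurable]: "cball u R \<in> sets borel" by simp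
  show ?thesis unfolding Glocal_def by measurable
qed

context
  fixes R \<delta> :: real
  assumes \<delta>: "\<delta> > 0"
begin

lemma Glocal_bounds: "0 \<le> Glocal R \<delta> v w" "v \<noteq> w \<Longrightarrow> Glocal R \<delta> v w \<le> W (v - w)"
  using Gcut_nonneg[OF \<delta>, of v w] Gcut_le_W[OF \<delta>, of v w] W_nonneg[of "v - w"]
  by (auto simp: Glocal_def indicator_def)

lemma schur_Glocal: "schur_kernel (Glocal R \<delta>) A A"
  unfolding schur_kernel_def
proof (intro conjI allI)
  show "(\<integral>\<^sup>+w. ennreal \<bar>Glocal R \<delta> v w\<bar> \<partial>lborel) \<le> ennreal A" for v
    unfolding nn_integral_W_shift(1)[symmetric, of v]
    by (intro nn_integral_mono_AE, use AE_lborel_singleton[of v] in eventually_elim)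
       (auto intro!: ennreal_leI simp: Glocal_bounds)
  show "(\<integral>\<^sup>+v. ennreal \<bar>Glocal R \<delta> v w\<bar> \<partial>lborel) \<le> ennreal A" for w
    unfolding nn_integral_W_shift(2)[symmetric, of w]
    by (intro nn_integral_mono_AE, use AE_lborel_singleton[of w] in eventually_elim)
       (auto intro!: ennreal_leI simp: Glocal_bounds)
qed (auto simp: A_nonneg)

text \<open>Both kernels lie between 0 and the convolution majorant off the diagonal, so the column
  bound stays \<open>A\<close>. A far row of the difference is a row of \<open>G\<close>; any other
  row is supported within \<open>\<delta>\<close> of the diagonal. Hence the rows are bounded by
  \<open>e\<close> and the operator norm by \<open>sqrt (e * A)\<close>.\<close>

lemma schur_G_minus_Glocal:
  assumes e: "e > 0"
    and near: "(\<integral>\<^sup>+x. ennreal (W x) * indicator (ball 0 \<delta>) x \<partial>lborel) \<le> ennreal e"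
    and far: "\<And>v. norm (v - u) > R \<Longrightarrow> (\<integral>\<^sup>+w. ennreal (G v w) \<partial>lborel) \<le> ennreal e"
  shows "schur_kernel (\<lambda>v w. G v w - Glocal R \<delta> v w) e A"
  unfolding schur_kernel_def
proof (intro conjI allI)
  show "(\<integral>\<^sup>+v. ennreal \<bar>G v w - Glocal R \<delta> v w\<bar> \<partial>lborel) \<le> ennreal A" for w
    unfolding nn_integral_W_shift(2)[symmetric, of w]
  proof (intro nn_integral_mono_AE, use AE_lborel_singleton[of w] in eventually_elim)
    case (elim v)
    show ?case using Glocal_bounds[of v w] elim G_le_W[of v w] G_nonneg[of v w] by (intro ennreal_leI) auto
  qed
  show "(\<integral>\<^sup>+w. ennreal \<bar>G v w - Glocal R \<delta> v w\<bar> \<partial>lborel) \<le> ennreal e" for v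
  proof (cases "norm (v - u) > R")
    case True
    then have "Glocal R \<delta> v w = 0" for w by (simp add: Glocal_def dist_norm norm_minus_commute)
    then show ?thesis using far[OF True] by (simp add: G_nonneg)
  next
    case False
    have "(\<integral>\<^sup>+w. ennreal \<bar>G v w - Glocal R \<delta> v w\<bar> \<partial>lborel) \<le> (\<integral>\<^sup>+w. ennreal (W (w - v)) * indicator (ball 0 \<delta>) (w - v) \<partial>lborel)"
    proof (intro nn_integral_mono_AE, use AE_lborel_singleton[of v] in eventually_elim)
      case (elim w)
      show ?case
      proof (cases "norm (w - v) < \<delta>")
        case True
        have "W (w - v) = W (v - w)" by (simp add: W_def norm_minus_commute)
        then show ?thesis
          using True Glocal_bounds[of v w] elim G_le_W[of v w] G_nonneg[of v w] by (auto intro!: ennreal_leI)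
      next
        case c2: False
        then have "max \<delta> (norm (v - w)) = norm (v - w)" by (simp add: norm_minus_commute)
        then have "G v w = Glocal R \<delta> v w"
          using False by (simp add: Glocal_def Gcut_def G_def dist_norm norm_minus_commute)
        then show ?thesis by simp
      qed
    qed
    also have "\<dots> = (\<integral>\<^sup>+x. ennreal (W x) * indicator (ball 0 \<delta>) x \<partial>lborel)"
      using nn_integral_lborel_translate[of "\<lambda>x. ennreal (W x) * indicator (ball 0 \<delta>) x" "- v"] by simp
    finally show ?thesis using near by simp
  qed
qed (use e in \<open>auto simp: A_nonneg\<close>)

lemma continuous_Gcut: "continuous_on UNIV (\<lambda>v. Gcut \<delta> v w)"
  unfolding Gcut_def using \<delta> by (intro continuous_intros) (auto simp: max_def)

text \<open>From \<open>(norm (w - u))\<^sup>2 \<le> 2 * (norm (v - u))\<^sup>2 + 2 * (norm (v -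
  w))\<^sup>2\<close> the Gaussian in \<open>v - w\<close> passes to one in \<open>w\<close> with
  half the rate, uniformly for \<open>v\<close> in the ball.\<close>

lemma Gcut_dominated:
  assumes "v \<in> cball u R"
  shows "Gcut \<delta> v w \<le> \<kappa> / \<delta> * exp (a * c\<^sup>2 * R\<^sup>2) * exp (- (a * c\<^sup>2 / 2) * (norm (w - u))\<^sup>2)"
proof -
  have "norm (v - u) \<le> R" using assms by (simp add: dist_norm norm_minus_commute)
  then have R: "(norm (v - u))\<^sup>2 \<le> R\<^sup>2" by (intro power_mono) auto
  have "(norm (w - u))\<^sup>2 \<le> (norm (v - u) + norm (v - w))\<^sup>2"
    using norm_triangle_ineq4[of "v - u" "v - w"] by (intro power_mono) auto
  also have "\<dots> \<le> 2 * (norm (v - u))\<^sup>2 + 2 * (norm (v - w))\<^sup>2" 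
    using sum_squares_bound[of "norm (v - u)" "norm (v - w)"] by (simp add: power2_sum)
  finally have "(norm (w - u))\<^sup>2 / 2 - R\<^sup>2 \<le> (norm (v - w))\<^sup>2" using R by simp
  then have "a * c\<^sup>2 * ((norm (w - u))\<^sup>2 / 2 - R\<^sup>2) \<le> a * c\<^sup>2 * (norm (v - w))\<^sup>2"
    using a by (intro mult_left_mono) auto
  then have "exp (- a * (c * norm (v - w))\<^sup>2) \<le> exp (a * c\<^sup>2 * R\<^sup>2 + - (a * c\<^sup>2 / 2) * (norm (w - u))\<^sup>2)"
    by (simp add: power_mult_distrib algebra_simps)
  then have "\<kappa> / \<delta> * exp (- a * (c * norm (v - w))\<^sup>2) \<le> \<kappa> / \<delta> * (exp (a * c\<^sup>2 * R\<^sup>2) * exp (- (a * c\<^sup>2 / 2) * (norm (w - u))\<^sup>2))"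
    unfolding exp_add[symmetric] using \<kappa> \<delta> by (intro mult_left_mono) auto
  with Gcut_le[OF \<delta>, of v w] show ?thesis by (simp add: mult.assoc)
qed

text \<open>Rows of the truncated kernel depend continuously on \<open>v\<close> as elements of
  \<open>l2\<close>, so images of the unit ball are bounded and equicontinuous on the ball.
  Arzela-Ascoli gives uniform convergence of a subsequence, and finite volume turns it into
  convergence in norm.\<close>

lemma compact_Glocal: "compact_operator (kernel_operator (Glocal R \<delta>) :: (real^3, complex) l2 \<Rightarrow> (real^3, complex) l2)"
  unfolding compact_operator_def
proof (intro allI impI)
  fix e :: real and x :: "nat \<Rightarrow> (real^3, complex) l2"
  assume e: "e > 0" and x: "\<forall>n. norm (x n) \<le> 1"
  let ?S = "cball u R"
  define D where "D w = \<kappa> / \<delta> * exp (a * c\<^sup>2 * R\<^sup>2) * exp (- (a * c\<^sup>2 / 2) * (norm (w - u))\<^sup>2)" for w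
  have D: "square_integrable D" unfolding D_def
    by (rule square_integrable_gaussian) (use a c in simp)
  have GD: "\<bar>Gcut \<delta> v w\<bar> \<le> D w" if "v \<in> ?S" for v w
    using Gcut_dominated[OF that, of w] Gcut_nonneg[OF \<delta>, of v w] by (simp add: D_def)
  have D0: "0 \<le> D w" for w using \<kappa> \<delta> by (simp add: D_def)
  have Gm [measurable]: "Gcut \<delta> v \<in> borel_measurable borel" for v
    using measurable_Pair2[OF Gcut_measurable, of v \<delta>] by simp
  have Gsi: "square_integrable (Gcut \<delta> v)" if "v \<in> ?S" for v
    by (rule square_integrable_bound[OF D Gm, of _ 1]) (use GD[OF that] D0 in auto)
  define f where "f n = rep_l2 (x n)" for n
  have f: "square_integrable (f n)" "abs_l2 (f n) = x n" for n
    by (auto simp: f_def square_integrable_rep_l2 abs_l2_rep_l2)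
  define F where "F n v = kernel_integral (Gcut \<delta>) (f n) v" for n v
  have diff: "norm (F n v - F n v') \<le> norm (abs_l2 (\<lambda>w. Gcut \<delta> v w - Gcut \<delta> v' w))"
    if v: "v \<in> ?S" "v' \<in> ?S" for n v v'
  proof -
    have "F n v - F n v' = (\<integral>w. (Gcut \<delta> v w - Gcut \<delta> v' w) *\<^sub>R f n w \<partial>lborel)"
      unfolding F_def kernel_integral_def scaleR_left_diff_distrib
      by (intro Bochner_Integration.integral_diff[symmetric] Cauchy_Schwarz_kernel(1) f Gsi v)
    also have "norm \<dots> \<le> norm (abs_l2 (\<lambda>w. Gcut \<delta> v w - Gcut \<delta> v' w)) * norm (abs_l2 (f n))"
      by (intro Cauchy_Schwarz_kernel(2) f square_integrable_diff Gsi v)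
    also have "\<dots> \<le> norm (abs_l2 (\<lambda>w. Gcut \<delta> v w - Gcut \<delta> v' w)) * 1"
      using x f(2)[of n] by (intro mult_left_mono) auto
    finally show ?thesis by simp
  qed
  have bound: "norm (F n v) \<le> norm (abs_l2 D)" if v: "v \<in> ?S" for n v
  proof -
    have "norm (F n v) \<le> norm (abs_l2 (Gcut \<delta> v)) * norm (abs_l2 (f n))"
      unfolding F_def kernel_integral_def by (intro Cauchy_Schwarz_kernel(2) f Gsi v)
    also have "\<dots> \<le> norm (abs_l2 (Gcut \<delta> v)) * 1"
      using x f(2)[of n] by (intro mult_left_mono) auto
    also have "norm (abs_l2 (Gcut \<delta> v)) \<le> norm (abs_l2 D)"
    proof (rule norm_abs_l2_le_nn[OF Gsi[OF v]])
      show "(\<integral>\<^sup>+w. ennreal ((norm (Gcut \<delta> v w))\<^sup>2) \<partial>lborel) \<le> ennreal ((norm (abs_l2 D))\<^sup>2)"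
        unfolding norm_abs_l2_nn[OF D, symmetric] using GD[OF v] D0
        by (intro nn_integral_mono ennreal_leI power_mono) auto
    qed simp
    finally show ?thesis by simp
  qed
  \<comment> \<open>The estimate \<open>diff\<close> is independent of \<open>n\<close>, so
    continuity of the row map suffices; it follows by dominated convergence with the common majorant
    \<open>D\<close>.\<close>
  have equi: "\<exists>d>0. \<forall>n y. y \<in> ?S \<and> norm (v - y) < d \<longrightarrow> norm (F n v - F n y) < e'"
    if v: "v \<in> ?S" and e': "e' > 0" for v e'
  proof (rule ccontr)
    assume *: "\<not> ?thesis"
    have "\<exists>y n. y \<in> ?S \<and> norm (v - y) < 1 / real (Suc m) \<and> e' \<le> norm (F n v - F n y)" for m
      using *[simplified, rule_format, of "1 / real (Suc m)"] by (auto simp: not_less)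
    then obtain y N where y: "\<And>m. y m \<in> ?S" "\<And>m. norm (v - y m) < 1 / real (Suc m)" "\<And>m. e' \<le> norm (F (N m) v - F (N m) (y m))"
      by metis
    have ylim: "y \<longlonglongrightarrow> v"
    proof -
      have "(\<lambda>m. v - y m) \<longlonglongrightarrow> 0"
        by (rule Lim_null_comparison[OF _ LIMSEQ_Suc[OF lim_inverse_n']]) (use y(2) in \<open>auto intro!: eventuallyI less_imp_le\<close>)
      from tendsto_diff[OF tendsto_const[of v] this] show ?thesis by simp
    qed
    have "(\<lambda>m. \<integral>w. (norm (Gcut \<delta> v w - Gcut \<delta> (y m) w))\<^sup>2 \<partial>lborel) \<longlonglongrightarrow> (\<integral>w. 0 \<partial>(lborel :: (real^3) measure))"
    proof (rule integral_dominated_convergence[where w = "\<lambda>w. 4 * (norm (D w))\<^sup>2"])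
      show "integrable lborel (\<lambda>w. 4 * (norm (D w))\<^sup>2)" using D by (simp add: square_integrable_def)
      show "AE w in lborel. (\<lambda>m. (norm (Gcut \<delta> v w - Gcut \<delta> (y m) w))\<^sup>2) \<longlonglongrightarrow> 0"
      proof (rule AE_I2)
        fix w
        have "(\<lambda>m. Gcut \<delta> (y m) w) \<longlonglongrightarrow> Gcut \<delta> v w"
          using continuous_on_tendsto_compose[OF continuous_Gcut ylim] by simp
        then have "(\<lambda>m. (norm (Gcut \<delta> v w - Gcut \<delta> (y m) w))\<^sup>2) \<longlonglongrightarrow> (norm (Gcut \<delta> v w - Gcut \<delta> v w))\<^sup>2"
          by (intro tendsto_intros)
        then show "(\<lambda>m. (norm (Gcut \<delta> v w - Gcut \<delta> (y m) w))\<^sup>2) \<longlonglongrightarrow> 0" by simp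
      qed
      show "AE w in lborel. norm ((norm (Gcut \<delta> v w - Gcut \<delta> (y m) w))\<^sup>2) \<le> 4 * (norm (D w))\<^sup>2" for m
      proof (rule AE_I2)
        fix w
        have "norm (Gcut \<delta> v w - Gcut \<delta> (y m) w) \<le> 2 * norm (D w)"
          using GD[OF v, of w] GD[OF y(1)[of m], of w] by simp
        then have "(norm (Gcut \<delta> v w - Gcut \<delta> (y m) w))\<^sup>2 \<le> (2 * norm (D w))\<^sup>2" by (intro power_mono) auto
        then show "norm ((norm (Gcut \<delta> v w - Gcut \<delta> (y m) w))\<^sup>2) \<le> 4 * (norm (D w))\<^sup>2" by (simp add: power_mult_distrib)
      qed
    qed auto
    then have "(\<lambda>m. sqrt (\<integral>w. (norm (Gcut \<delta> v w - Gcut \<delta> (y m) w))\<^sup>2 \<partial>lborel)) \<longlonglongrightarrow> sqrt 0"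
      by (intro tendsto_real_sqrt) simp
    then have "eventually (\<lambda>m. sqrt (\<integral>w. (norm (Gcut \<delta> v w - Gcut \<delta> (y m) w))\<^sup>2 \<partial>lborel) < e') sequentially"
      by (rule order_tendstoD(2)) (use e' in simp)
    then obtain m where "sqrt (\<integral>w. (norm (Gcut \<delta> v w - Gcut \<delta> (y m) w))\<^sup>2 \<partial>lborel) < e'"
      by (auto simp: eventually_sequentially)
    with diff[OF v y(1)[of m], of "N m"] y(3)[of m]
      norm_abs_l2[OF square_integrable_diff[OF Gsi[OF v] Gsi[OF y(1)[of m]]]]
    show False by linarith
  qed
  have "\<exists>g r. strict_mono (r :: nat \<Rightarrow> nat) \<and>
      (\<forall>e>0. \<exists>N. \<forall>n v. n \<ge> N \<and> v \<in> ?S \<longrightarrow> norm (F (r n) v - g v) < e)"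
  proof (rule Arzela_Ascoli[OF compact_cball bound equi])
    fix g :: "real^3 \<Rightarrow> complex" and k :: "nat \<Rightarrow> nat"
    assume "strict_mono k" "\<And>e. 0 < e \<Longrightarrow> \<exists>N. \<forall>n v. n \<ge> N \<and> v \<in> ?S \<longrightarrow> norm (F (k n) v - g v) < e"
    then show ?thesis by (intro exI[of _ g] exI[of _ k] conjI allI impI)
  qed
  then obtain g r where r: "strict_mono (r :: nat \<Rightarrow> nat)"
    and unif: "\<And>e. 0 < e \<Longrightarrow> \<exists>N. \<forall>n v. n \<ge> N \<and> v \<in> ?S \<longrightarrow> norm (F (r n) v - g v) < e"
    by auto
  define V where "V = measure lborel ?S"
  have V: "emeasure lborel ?S = ennreal V"
    unfolding V_def by (rule emeasure_eq_ennreal_measure) (use emeasure_bounded_finite[OF bounded_cball[of u R]] in auto)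
  have V0: "V \<ge> 0" by (simp add: V_def)
  \<comment> \<open>Two late members of the subsequence differ by at most \<open>2 * e'\<close> on a
    set of volume \<open>V\<close>. The added 1 keeps the denominator positive when \<open>V\<close>
    is 0 and makes the final inequality strict.\<close>
  define e' where "e' = e / (2 * (sqrt V + 1))"
  have e': "e' > 0" using e V0 by (simp add: e'_def add_nonneg_pos)
  obtain N where N: "\<And>n v. n \<ge> N \<Longrightarrow> v \<in> ?S \<Longrightarrow> norm (F (r n) v - g v) < e'" using unif[OF e'] by blast
  define i j where "i = r N" and "j = r (Suc N)"
  have ij: "i < j" using r by (simp add: i_def j_def strict_mono_less)
  have Fij: "norm (F i v - F j v) \<le> 2 * e'" if "v \<in> ?S" for v
    using norm_triangle_ineq4[of "F i v - g v" "F j v - g v"] N[of N v] N[of "Suc N" v] that by (simp add: i_def j_def)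
  have KF: "kernel_integral (Glocal R \<delta>) (f n) v = indicator ?S v *\<^sub>R F n v" for n v
    by (simp add: kernel_integral_def Glocal_def F_def indicator_def)
  let ?h = "\<lambda>v. kernel_integral (Glocal R \<delta>) (f i) v - kernel_integral (Glocal R \<delta>) (f j) v"
  have h: "square_integrable ?h"
    by (intro square_integrable_diff square_integrable_kernel_integral[OF schur_Glocal] f)
  have "kernel_operator (Glocal R \<delta>) (x i) - kernel_operator (Glocal R \<delta>) (x j) = abs_l2 ?h"
    unfolding f(2)[symmetric]
    by (simp add: kernel_operator_abs[OF schur_Glocal] f(1) abs_l2_diff square_integrable_kernel_integral[OF schur_Glocal])
  also have "norm \<dots> \<le> 2 * e' * sqrt V"
  proof (rule norm_abs_l2_le_nn[OF h])
    have "(\<integral>\<^sup>+v. ennreal ((norm (?h v))\<^sup>2) \<partial>lborel) \<le> (\<integral>\<^sup>+v. ennreal ((2 * e')\<^sup>2) * indicator ?S v \<partial>lborel)"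
    proof (rule nn_integral_mono)
      fix v
      show "ennreal ((norm (?h v))\<^sup>2) \<le> ennreal ((2 * e')\<^sup>2) * indicator ?S v"
        using power_mono[OF Fij, of v 2] by (cases "v \<in> ?S") (auto simp: KF intro!: ennreal_leI)
    qed
    also have "\<dots> = ennreal ((2 * e' * sqrt V)\<^sup>2)"
      using V V0 by (subst nn_integral_cmult_indicator) (auto simp: ennreal_mult[symmetric] power_mult_distrib)
    finally show "(\<integral>\<^sup>+v. ennreal ((norm (?h v))\<^sup>2) \<partial>lborel) \<le> ennreal ((2 * e' * sqrt V)\<^sup>2)" .
  qed (use e' V0 in simp)
  also have "\<dots> < e"
  proof -
    have "2 * e' * sqrt V < 2 * e' * (sqrt V + 1)" using e' by simp
    also have "\<dots> = e" using V0 by (simp add: e'_def field_simps add_nonneg_eq_0_iff)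
    finally show ?thesis .
  qed
  finally show "\<exists>i j. i < j \<and> norm (kernel_operator (Glocal R \<delta>) (x i) - kernel_operator (Glocal R \<delta>) (x j)) < e"
    using ij by blast
qed

end

lemma compact_G: "compact_operator (kernel_operator G :: (real^3, complex) l2 \<Rightarrow> (real^3, complex) l2)"
  unfolding compact_operator_def
proof (intro allI impI)
  fix e :: real and x :: "nat \<Rightarrow> (real^3, complex) l2"
  assume e: "e > 0" and x: "\<forall>n. norm (x n) \<le> 1"
  \<comment> \<open>Chosen so that the Schur norm \<open>sqrt (\<eta> * A)\<close> is at most
    \<open>e / 4\<close>; the two replacement errors and the compact part then add up to less than
    \<open>e\<close>.\<close>
  define \<eta> where "\<eta> = (e / 4)\<^sup>2 / (A + 1)"
  have \<eta>: "\<eta> > 0" using e A_nonneg by (simp add: \<eta>_def)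
  have "\<eta> * A \<le> \<eta> * (A + 1)" using \<eta> by (intro mult_left_mono) auto
  also have "\<dots> = (e / 4)\<^sup>2" using A_nonneg by (simp add: \<eta>_def)
  finally have sq: "sqrt (\<eta> * A) \<le> e / 4" using e by (intro real_le_lsqrt) auto
  obtain \<delta> where \<delta>: "\<delta> > 0" "(\<integral>\<^sup>+x. ennreal (W x) * indicator (ball 0 \<delta>) x \<partial>lborel) \<le> ennreal \<eta>"
    using nn_integral_W_near_diagonal[OF \<eta>] by metis
  obtain R where R: "\<And>v. norm (v - u) > R \<Longrightarrow> (\<integral>\<^sup>+w. ennreal (G v w) \<partial>lborel) \<le> ennreal \<eta>"
    using G_row_decay[OF \<eta>] by metis
  have sk: "schur_kernel (\<lambda>v w. G v w - Glocal R \<delta> v w) \<eta> A"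
    by (rule schur_G_minus_Glocal[OF \<delta>(1) \<eta> \<delta>(2)]) (rule R)
  have close: "norm (kernel_operator G (x n) - kernel_operator (Glocal R \<delta>) (x n)) \<le> e / 4" for n
  proof -
    have "kernel_operator G (x n) - kernel_operator (Glocal R \<delta>) (x n) = kernel_operator (\<lambda>v w. G v w - Glocal R \<delta> v w) (x n)"
      by (rule kernel_operator_diff[OF schur_G schur_Glocal[OF \<delta>(1)] sk])
    then have "norm (kernel_operator G (x n) - kernel_operator (Glocal R \<delta>) (x n)) \<le> sqrt (\<eta> * A) * norm (x n)"
      using norm_kernel_operator[OF sk, of "x n"] by simp
    also have "\<dots> \<le> e / 4 * 1" using sq x e by (intro mult_mono) auto
    finally show ?thesis by simp
  qed
  obtain i j where ij: "i < j" "norm (kernel_operator (Glocal R \<delta>) (x i) - kernel_operator (Glocal R \<delta>) (x j)) < e / 2"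
    using compact_operatorD[OF compact_Glocal[OF \<delta>(1)], of "e / 2" x] e x by (metis half_gt_zero)
  have "norm (kernel_operator G (x i) - kernel_operator G (x j)) < e"
  proof -
    let ?p = "kernel_operator G (x i) - kernel_operator (Glocal R \<delta>) (x i)"
    let ?q = "kernel_operator (Glocal R \<delta>) (x i) - kernel_operator (Glocal R \<delta>) (x j)"
    let ?s = "kernel_operator G (x j) - kernel_operator (Glocal R \<delta>) (x j)"
    have "norm (kernel_operator G (x i) - kernel_operator G (x j)) = norm (?p + ?q - ?s)" by simp
    also have "\<dots> \<le> norm ?p + norm ?q + norm ?s"
      by (rule order_trans[OF norm_triangle_ineq4 add_right_mono[OF norm_triangle_ineq]])
    also have "\<dots> < e / 4 + e / 2 + e / 4"
      by (rule add_less_le_mono[OF add_le_less_mono[OF close ij(2)] close])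
    also have "e / 4 + e / 2 + e / 4 = e" by simp
    finally show ?thesis .
  qed
  then show "\<exists>i j. i < j \<and> norm (kernel_operator G (x i) - kernel_operator G (x j)) < e" using ij(1) by blast
qed

end

section \<open>The inelastic Boltzmann operator\<close>

locale boltzmann =
  fixes m m1 eps th1 :: real and u1 :: "real^3"
  assumes m: "m > 0" and m1: "m1 > 0" and eps: "0 < eps" "eps < 1" and th1: "th1 > 0"
begin

definition \<tau> :: real where "\<tau> = m1 / (2 * th1)"
text \<open>The parameter through which restitution and mass ratio enter: the gain prefactor becomes
  \<open>1 / (2 * p\<^sup>2)\<close>, and the slope \<open>c = 1 + mu\<close> satisfies
  \<open>1 + c = 1 / p\<close>.\<close>

definition p :: real where "p = alpha m m1 * (1 - beta eps)"
definition c :: real where "c = 1 + mu m m1 eps"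
definition \<kappa> :: real where "\<kappa> = 1 / (2 * eps\<^sup>2 * (gamma m m1 eps)\<^sup>2) * sqrt (m1 / (2 * pi * th1))"
definition \<sigma> :: "real^3 \<Rightarrow> real" where "\<sigma> = coll_freq m1 u1 th1"
definition \<phi> :: "real^3 \<Rightarrow> real" where "\<phi> v = sqrt (Maxw m m1 eps u1 th1 v)"

lemma \<tau>: "\<tau> > 0"
  using m1 th1 by (simp add: \<tau>_def)

lemma alpha_bounds: "0 < alpha m m1" "alpha m m1 < 1"
  using m m1 by (auto simp: alpha_def)

lemma beta_bounds: "0 < 1 - beta eps" "1 - beta eps < 1" "1 - 2 * beta eps = eps"
  using eps by (auto simp: beta_def field_simps)

lemma p_bounds: "0 < p" "p < 1"
  using alpha_bounds beta_bounds mult_strict_mono[of "alpha m m1" 1 "1 - beta eps" 1]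
  by (auto simp: p_def)

lemma eps_gamma: "eps * gamma m m1 eps = p"
  using eps by (simp add: gamma_def p_def beta_bounds(3))

lemma c_eq: "c = (1 - p) / p"
proof -
  have "mu m m1 eps = (1 - 2 * p) / p" by (simp only: mu_def p_def mult.assoc)
  then show ?thesis using p_bounds by (simp add: c_def field_simps)
qed

lemma c: "c > 0"
  using p_bounds by (simp add: c_eq)

lemma \<kappa>_eq: "\<kappa> = 1 / (2 * p\<^sup>2) * sqrt (\<tau> / pi)"
  by (simp add: \<kappa>_def eps_gamma[symmetric] power_mult_distrib \<tau>_def field_simps)

lemma \<kappa>: "\<kappa> > 0"
  using p_bounds \<tau> by (simp add: \<kappa>_eq)

lemma theta_sharp_eq: "theta_sharp m m1 eps th1 = (1 - alpha m m1) * (1 - beta eps) / (1 - p) * th1"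
  unfolding theta_sharp_def p_def ..

lemma theta_sharp_pos: "0 < theta_sharp m m1 eps th1"
  unfolding theta_sharp_eq using alpha_bounds beta_bounds p_bounds th1
  by (intro mult_pos_pos divide_pos_pos) auto

text \<open>This fixes the temperature of the equilibrium: its Gaussian exponent is exactly the one
  that absorbs the cross term of the kernel. The mass relation behind it is
  \<open>m1 * (1 - alpha) = m * alpha\<close>.\<close>

lemma detailed_balance: "m / (2 * theta_sharp m m1 eps th1) = \<tau> * c"
proof -
  define X where "X = (1 - alpha m m1) * (1 - beta eps)"
  have a: "m1 * (1 - alpha m m1) = m * alpha m m1"
    using m m1 by (simp add: alpha_def field_simps)
  have X: "m1 * X = m * p"
    unfolding X_def p_def mult.assoc[symmetric] a ..
  have "m1 * (theta_sharp m m1 eps th1 * (1 - p)) = m1 * X * th1"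
    using p_bounds by (simp add: theta_sharp_eq X_def)
  then have "m1 * (theta_sharp m m1 eps th1 * (1 - p)) = m * p * th1" by (simp only: X)
  then show ?thesis
    using p_bounds th1 theta_sharp_pos by (simp add: \<tau>_def c_eq field_simps)
qed

definition D :: real where "D = (m / (2 * pi * theta_sharp m m1 eps th1)) powr (3/2)"

lemma D: "D > 0"
  using m theta_sharp_pos by (simp add: D_def)

lemma Maxw_eq: "Maxw m m1 eps u1 th1 v = D * exp (- (\<tau> * c) * (norm (v - u1))\<^sup>2)"
  unfolding detailed_balance[symmetric] by (simp add: Maxw_def Let_def D_def)

lemma Maxw_eq_\<phi>: "Maxw m m1 eps u1 th1 v = (\<phi> v)\<^sup>2"
  using D by (simp add: \<phi>_def Maxw_eq)

lemma \<phi>_eq: "\<phi> v = sqrt D * exp (- (\<tau> * c / 2) * (norm (v - u1))\<^sup>2)"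
proof -
  have "\<phi> v = sqrt D * sqrt ((exp (- (\<tau> * c / 2) * (norm (v - u1))\<^sup>2))\<^sup>2)"
    unfolding \<phi>_def Maxw_eq real_sqrt_mult by (simp flip: exp_double)
  then show ?thesis by simp
qed

lemma \<phi>_pos: "\<phi> v > 0"
  using D by (simp add: \<phi>_eq)

lemma \<phi>_measurable [measurable]: "\<phi> \<in> borel_measurable borel"
  unfolding \<phi>_eq[abs_def] by measurable

sublocale gain_kernel "\<tau> / 4" c \<kappa> u1
  using \<tau> c \<kappa> by unfold_locales auto

text \<open>Conjugation with the square root of the Maxwellian turns the kernel into a symmetric one.\<close>
lemma kern_eq_G:
  "1 / (2 * eps\<^sup>2 * (gamma m m1 eps)\<^sup>2) * kern m m1 eps u1 th1 v w * \<phi> w = \<phi> v * G v w"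
proof (cases "v = w")
  case False
  define r d where "r = norm (v - w)" and "d = (norm (v - u1))\<^sup>2 - (norm (w - u1))\<^sup>2"
  have r: "r > 0" using False by (simp add: r_def)
  \<comment> \<open>The cross term \<open>2 * c * d\<close> of the square does not involve
    \<open>r\<close>. Its contribution \<open>\<tau> * c / 2 * d\<close> to the exponent trades the
    energy of \<open>w\<close> for that of \<open>v\<close>.\<close>
  have "- (\<tau> / 4) * (c * r + d / r)\<^sup>2 + - (\<tau> * c / 2) * (norm (w - u1))\<^sup>2
     = - (\<tau> / 4) * ((c * r)\<^sup>2 + (d / r)\<^sup>2) + - (\<tau> * c / 2) * ((norm (w - u1))\<^sup>2 + d)"
    using r by (simp add: power2_sum algebra_simps)
  then have e: "exp (- (\<tau> / 4) * (c * r + d / r)\<^sup>2) * exp (- (\<tau> * c / 2) * (norm (w - u1))\<^sup>2)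
     = exp (- (\<tau> / 4) * ((c * r)\<^sup>2 + (d / r)\<^sup>2)) * exp (- (\<tau> * c / 2) * (norm (v - u1))\<^sup>2)"
    unfolding exp_add[symmetric] by (simp add: d_def)
  have "1 / (2 * eps\<^sup>2 * (gamma m m1 eps)\<^sup>2) * kern m m1 eps u1 th1 v w * \<phi> w
     = \<kappa> / r * sqrt D * (exp (- (\<tau> / 4) * (c * r + d / r)\<^sup>2) * exp (- (\<tau> * c / 2) * (norm (w - u1))\<^sup>2))"
    by (simp add: kern_def \<kappa>_def \<phi>_eq \<tau>_def r_def d_def c_def)
  also have "\<dots> = \<phi> v * G v w"
    unfolding e by (simp add: G_def \<phi>_eq r_def d_def)
  finally show ?thesis .
qed (simp add: kern_def G_def)

lemma square_integrable_\<phi>: "square_integrable \<phi>"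
  unfolding \<phi>_eq[abs_def] by (rule square_integrable_gaussian) (use \<tau> c in simp)

text \<open>In the original variables this is conservation of mass: the gain kernel integrated over
  its first argument equals the collision frequency at the second.\<close>

lemma balance: "(\<integral>\<^sup>+w. ennreal (G v w * \<phi> w) \<partial>lborel) = ennreal (\<sigma> v * \<phi> v)"
proof -
  define F where "F w = exp (- (\<tau> / 4) * (c * norm (w - v) + ((norm (w - u1))\<^sup>2 - (norm (v - u1))\<^sup>2) / norm (w - v))\<^sup>2) / norm (w - v)" for w
  have [measurable]: "F \<in> borel_measurable borel" unfolding F_def by measurable
  have F0: "0 \<le> F w" for w by (simp add: F_def)
  have "G v w * \<phi> w = \<kappa> * \<phi> v * F w" for w
  proof -
    \<comment> \<open>Symmetry moves the integration variable to the first slot of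
      \<open>kern\<close>, where the bracket has the sign required by
      \<open>nn_integral_radial\<close>.\<close>
    have "G v w * \<phi> w = \<phi> w * G w v" by (simp add: G_sym[of v w] mult.commute)
    also have "\<dots> = 1 / (2 * eps\<^sup>2 * (gamma m m1 eps)\<^sup>2) * kern m m1 eps u1 th1 w v * \<phi> v"
      by (rule kern_eq_G[symmetric])
    also have "\<dots> = \<kappa> * \<phi> v * F w" by (simp add: kern_def F_def \<kappa>_def \<tau>_def c_def)
    finally show ?thesis .
  qed
  then have "(\<integral>\<^sup>+w. ennreal (G v w * \<phi> w) \<partial>lborel) = (\<integral>\<^sup>+w. ennreal (\<kappa> * \<phi> v) * ennreal (F w) \<partial>lborel)"
    using \<kappa> \<phi>_pos[of v] F0 by (simp add: ennreal_mult'')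
  also have "\<dots> = ennreal (\<kappa> * \<phi> v) * (\<integral>\<^sup>+w. ennreal (F w) \<partial>lborel)"
    by (rule nn_integral_cmult) measurable
  also have "(\<integral>\<^sup>+w. ennreal (F w) \<partial>lborel) = ennreal (2 / (1 + c)\<^sup>2 * sqrt (pi / \<tau>)) * ennreal (\<sigma> v)"
    unfolding F_def nn_integral_radial[OF \<tau> c] \<sigma>_def ennreal_coll_freq[OF m1 th1] by (simp add: \<tau>_def)
  also have "ennreal (\<kappa> * \<phi> v) * (ennreal (2 / (1 + c)\<^sup>2 * sqrt (pi / \<tau>)) * ennreal (\<sigma> v))
      = ennreal (\<kappa> * \<phi> v * (2 / (1 + c)\<^sup>2 * sqrt (pi / \<tau>) * \<sigma> v))"
    using \<kappa> \<phi>_pos[of v] \<tau> coll_freq_nonneg[OF m1 th1, of u1 v]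
    by (simp add: ennreal_mult[symmetric] \<sigma>_def)
  also have "\<kappa> * \<phi> v * (2 / (1 + c)\<^sup>2 * sqrt (pi / \<tau>) * \<sigma> v) = \<sigma> v * \<phi> v"
  proof -
    have "1 + c = 1 / p" using p_bounds by (simp add: c_eq field_simps)
    moreover have "sqrt (\<tau> / pi) * sqrt (pi / \<tau>) = 1" using \<tau> by (simp add: real_sqrt_mult[symmetric])
    ultimately have "\<kappa> * (2 / (1 + c)\<^sup>2 * sqrt (pi / \<tau>)) = 1"
      using p_bounds by (simp add: \<kappa>_eq power_divide)
    then have "\<kappa> * (2 / (1 + c)\<^sup>2 * sqrt (pi / \<tau>)) * (\<sigma> v * \<phi> v) = \<sigma> v * \<phi> v"
      by (simp only: mult_1_left)
    then show ?thesis by (simp only: mult_ac)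
  qed
  finally show ?thesis .
qed

sublocale K: kernel_minus_multiplication G \<sigma> \<phi> "\<sigma> u1" A
proof
  show "range \<sigma> = {\<sigma> u1..}" unfolding \<sigma>_def by (rule range_coll_freq[OF m1 th1])
  show "continuous_on UNIV \<sigma>" unfolding \<sigma>_def by (rule coll_freq_continuous[OF m1 th1])
  show "0 < \<sigma> u1" unfolding \<sigma>_def by (rule coll_freq_pos[OF m1 th1])
qed (auto intro: schur_G G_nonneg G_pos G_sym compact_G \<phi>_pos square_integrable_\<phi> balance)

section \<open>Transfer between the weighted and the unweighted space\<close>

abbreviation "inH' \<equiv> inH m m1 eps u1 th1"
abbreviation "inD' \<equiv> inD m m1 eps u1 th1"
abbreviation "Lop' \<equiv> Lop m m1 eps u1 th1"

text \<open>The isometry of the weighted space onto the unweighted one. It is a bijection on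
  functions, not only on classes, so domains, almost everywhere equations and quantifiers over
  functions transfer literally.\<close>

definition flat :: "(real^3 \<Rightarrow> complex) \<Rightarrow> real^3 \<Rightarrow> complex" where
  "flat f v = f v / complex_of_real (\<phi> v)"

definition unflat :: "(real^3 \<Rightarrow> complex) \<Rightarrow> real^3 \<Rightarrow> complex" where
  "unflat g v = complex_of_real (\<phi> v) * g v"

lemma flat_unflat [simp]: "flat (unflat g) = g"
  using \<phi>_pos by (auto simp: flat_def unflat_def less_le)

lemma unflat_flat [simp]: "unflat (flat f) = f"
  using \<phi>_pos by (auto simp: flat_def unflat_def less_le)

lemma flat_eq_iff: "flat f v = flat g v \<longleftrightarrow> f v = g v"
  using \<phi>_pos[of v] by (simp add: flat_def)

lemma norm_flat: "(norm (flat f v))\<^sup>2 = (cmod (f v))\<^sup>2 / Maxw m m1 eps u1 th1 v"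
  by (simp add: flat_def norm_divide power_divide Maxw_eq_\<phi>)

lemma inH_iff: "inH' f \<longleftrightarrow> square_integrable (flat f)"
proof -
  have "f \<in> borel_measurable borel \<longleftrightarrow> flat f \<in> borel_measurable borel"
  proof
    assume [measurable]: "f \<in> borel_measurable borel"
    show "flat f \<in> borel_measurable borel" unfolding flat_def by measurable
  next
    assume [measurable]: "flat f \<in> borel_measurable borel"
    have "unflat (flat f) \<in> borel_measurable borel" unfolding unflat_def by measurable
    then show "f \<in> borel_measurable borel" by simp
  qed
  then show ?thesis by (simp add: inH_def square_integrable_def norm_flat)
qed

lemma Hnorm_eq: "inH' f \<Longrightarrow> Hnorm m m1 eps u1 th1 f = norm (abs_l2 (flat f))"
  by (simp add: Hnorm_def norm_abs_l2 inH_iff norm_flat)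

text \<open>Conjugation is exact at every point: where the integral diverges, the Bochner integrals
  on both sides take the value 0, and a constant factor respects this.\<close>

lemma flat_Lop: "flat (Lop' f) = K.L (flat f)"
proof
  fix v
  have f: "complex_of_real (\<phi> w) * flat f w = f w" for w
    using \<phi>_pos[of w] by (simp add: flat_def)
  let ?C = "complex_of_real (1 / (2 * eps\<^sup>2 * (gamma m m1 eps)\<^sup>2))"
  have "?C * (\<integral>w. complex_of_real (kern m m1 eps u1 th1 v w) * f w \<partial>lborel)
      = (\<integral>w. ?C * (complex_of_real (kern m m1 eps u1 th1 v w) * f w) \<partial>lborel)"
    by (rule integral_mult_right_zero[symmetric])
  also have "\<dots> = (\<integral>w. complex_of_real (\<phi> v) * (G v w *\<^sub>R flat f w) \<partial>lborel)"
  proof (rule Bochner_Integration.integral_cong[OF refl])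
    fix w
    have "?C * (complex_of_real (kern m m1 eps u1 th1 v w) * f w)
       = complex_of_real (1 / (2 * eps\<^sup>2 * (gamma m m1 eps)\<^sup>2) * kern m m1 eps u1 th1 v w * \<phi> w) * flat f w"
      unfolding f[of w, symmetric] by (simp only: of_real_mult mult.assoc)
    also have "\<dots> = complex_of_real (\<phi> v) * (G v w *\<^sub>R flat f w)"
      unfolding kern_eq_G by (simp add: scaleR_conv_of_real mult.assoc)
    finally show "?C * (complex_of_real (kern m m1 eps u1 th1 v w) * f w) = complex_of_real (\<phi> v) * (G v w *\<^sub>R flat f w)" .
  qed
  also have "\<dots> = complex_of_real (\<phi> v) * kernel_integral G (flat f) v"
    unfolding kernel_integral_def by (rule integral_mult_right_zero)
  finally have "Lop' f v = complex_of_real (\<phi> v) * kernel_integral G (flat f) v - complex_of_real (\<sigma> v) * f v"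
    unfolding Lop_def \<sigma>_def by simp
  then show "flat (Lop' f) v = K.L (flat f) v"
    using \<phi>_pos[of v] by (simp add: flat_def K.L_def diff_divide_distrib)
qed

lemma inD_iff: "inD' f \<longleftrightarrow> K.dom (flat f)"
  unfolding inD_def K.dom_def inH_iff flat_Lop norm_flat \<sigma>_def[symmetric] by simp

lemma flat_diff: "flat (\<lambda>v. Lop' f v - z * f v) = (\<lambda>v. K.L (flat f) v - z * flat f v)"
  unfolding flat_Lop[symmetric] by (auto simp: flat_def diff_divide_distrib)

lemma resolvent_iff: "z \<in> resolvent_set m m1 eps u1 th1 \<longleftrightarrow> K.regular z"
proof -
  have bd: "(Hnorm m m1 eps u1 th1 f \<le> C * Hnorm m m1 eps u1 th1 (\<lambda>v. Lop' f v - z * f v))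
      = (norm (abs_l2 (flat f)) \<le> C * norm (abs_l2 (\<lambda>v. K.L (flat f) v - z * flat f v)))" if "inD' f" for f C
  proof -
    have d: "K.dom (flat f)" using that by (simp add: inD_iff)
    have "inH' (\<lambda>v. Lop' f v - z * f v)"
      unfolding inH_iff flat_diff by (intro square_integrable_diff K.square_integrable_cmult K.domD[OF d])
    moreover have "inH' f" using K.domD(1)[OF d] by (simp add: inH_iff)
    ultimately show ?thesis by (simp add: Hnorm_eq flat_diff)
  qed
  have ae: "(AE v in lborel. Lop' f v - z * f v = g v) = (AE v in lborel. K.L (flat f) v - z * flat f v = flat g v)" for f g
  proof -
    have "K.L (flat f) v - z * flat f v = flat g v \<longleftrightarrow> Lop' f v - z * f v = g v" for v
      using flat_eq_iff[of "\<lambda>v. Lop' f v - z * f v" v g] by (simp add: flat_diff)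
    then show ?thesis by simp
  qed
  \<comment> \<open>Every function is \<open>flat\<close> of some function, so the quantifiers may
    range over \<open>flat f\<close>.\<close>
  have ex: "(\<exists>f. P (flat f)) = (\<exists>f. P f)" and all: "(\<forall>f. P (flat f)) = (\<forall>f. P f)" for P :: "(real^3 \<Rightarrow> complex) \<Rightarrow> bool"
    by (metis flat_unflat)+
  have "z \<in> resolvent_set m m1 eps u1 th1 \<longleftrightarrow>
     (\<exists>C. \<forall>f. K.dom (flat f) \<longrightarrow> norm (abs_l2 (flat f)) \<le> C * norm (abs_l2 (\<lambda>v. K.L (flat f) v - z * flat f v))) \<and>
     (\<forall>g. square_integrable (flat g) \<longrightarrow> (\<exists>f. K.dom (flat f) \<and> (AE v in lborel. K.L (flat f) v - z * flat f v = flat g v)))"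
    unfolding resolvent_set_def mem_Collect_eq ae using bd by (simp add: inD_iff[symmetric] inH_iff[symmetric])
  also have "\<dots> \<longleftrightarrow> K.regular z"
    unfolding K.regular_def
    unfolding all[of "\<lambda>f. K.dom f \<longrightarrow> norm (abs_l2 f) \<le> _ * norm (abs_l2 (\<lambda>v. K.L f v - z * f v))"]
      ex[of "\<lambda>f. K.dom f \<and> (AE v in lborel. K.L f v - z * f v = _ v)"]
      all[of "\<lambda>g. square_integrable g \<longrightarrow> (\<exists>f. K.dom f \<and> (AE v in lborel. K.L f v - z * f v = g v))"] ..
  finally show ?thesis .
qed

lemma AE_Lop_eigen: "(AE v in lborel. Lop' f v = z * f v) \<longleftrightarrow> (AE v in lborel. K.L (flat f) v = z * flat f v)"
proof -
  have "K.L (flat f) v = z * flat f v \<longleftrightarrow> Lop' f v = z * f v" for v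
    using flat_eq_iff[of "Lop' f" v "\<lambda>v. z * f v"] unfolding flat_Lop by (simp add: flat_def)
  then show ?thesis by simp
qed

lemma AE_flat_0: "(AE v in lborel. flat f v = 0) \<longleftrightarrow> (AE v in lborel. f v = 0)"
  using \<phi>_pos by (simp add: flat_def less_le)

lemma is_eigenvalue_iff: "is_eigenvalue m m1 eps u1 th1 z \<longleftrightarrow> K.eigenvalue z"
proof -
  have "is_eigenvalue m m1 eps u1 th1 z \<longleftrightarrow> (\<exists>f. K.eigenfunction z (flat f) \<and> \<not> (AE v in lborel. flat f v = 0))"
    unfolding is_eigenvalue_def K.eigenfunction_def inD_iff AE_Lop_eigen AE_flat_0 by blast
  also have "\<dots> \<longleftrightarrow> K.eigenvalue z" unfolding K.eigenvalue_def by (metis flat_unflat)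
  finally show ?thesis .
qed

lemma gen_eigvec_eigenfunction:
  assumes "gen_eigvec m m1 eps u1 th1 (complex_of_real x) f"
  shows "K.eigenfunction (complex_of_real x) (flat f)"
proof -
  obtain n :: nat and g where g: "g 0 = f" "inH' f" "AE v in lborel. g n v = 0"
    "\<And>j. j < n \<Longrightarrow> inD' (g j) \<and> g (Suc j) = (\<lambda>v. Lop' (g j) v - complex_of_real x * g j v)"
    using assms unfolding gen_eigvec_def by blast
  have "K.eigenfunction (complex_of_real x) (flat (g 0))"
  proof (rule K.generalized_eigenfunction[where g = "\<lambda>j. flat (g j)" and n = n])
    show "K.dom (flat (g j)) \<and> (AE v in lborel. flat (g (Suc j)) v = K.L (flat (g j)) v - complex_of_real x * flat (g j) v)"
      if "j < n" for j
      using g(4)[OF that] by (simp add: inD_iff flat_diff)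
  qed (use g in \<open>auto simp: inH_iff AE_flat_0\<close>)
  then show ?thesis by (simp add: g(1))
qed

text \<open>Generalised eigenvectors for a real value are eigenvectors, so the finite-dimensional
  eigenspace supplies the spanning set, carried back by \<open>unflat\<close>.\<close>

lemma finite_alg_mult:
  assumes x: "- \<sigma> u1 < x" shows "finite_alg_mult m m1 eps u1 th1 (complex_of_real x)"
proof -
  have "complex_of_real x \<notin> complex_of_real ` {..- \<sigma> u1}" using x by auto
  then have "\<exists>B. finite B \<and>
    (\<forall>f. K.eigenfunction (complex_of_real x) f \<longrightarrow> (\<exists>c. AE v in lborel. f v = (\<Sum>b\<in>B. c b * b v)))"
  proof (rule K.eigenspace_finite_dim)
    fix B :: "(real^3 \<Rightarrow> complex) set"
    assume "finite B" "\<And>f. K.eigenfunction (complex_of_real x) f \<Longrightarrow> \<exists>c. AE v in lborel. f v = (\<Sum>b\<in>B. c b * b v)"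
    then show ?thesis by (intro exI[of _ B] conjI allI impI)
  qed
  then obtain B where B: "finite B"
    "\<And>f. K.eigenfunction (complex_of_real x) f \<Longrightarrow> \<exists>c. AE v in lborel. f v = (\<Sum>b\<in>B. c b * b v)"
    by auto
  have inj: "inj_on unflat B" by (rule inj_on_inverseI[of _ flat]) simp
  show ?thesis unfolding finite_alg_mult_def
  proof (intro exI[of _ "unflat ` B"] conjI allI impI)
    fix f assume "gen_eigvec m m1 eps u1 th1 (complex_of_real x) f"
    then obtain c where c: "AE v in lborel. flat f v = (\<Sum>b\<in>B. c b * b v)"
      using B(2) gen_eigvec_eigenfunction by blast
    have "AE v in lborel. f v = (\<Sum>b\<in>unflat ` B. c (flat b) * b v)"
      using c
    proof eventually_elim
      case (elim v)
      have "f v = complex_of_real (\<phi> v) * flat f v" using \<phi>_pos[of v] by (simp add: flat_def)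
      also have "\<dots> = (\<Sum>b\<in>B. c b * unflat b v)"
        unfolding elim sum_distrib_left by (simp add: unflat_def mult_ac)
      also have "\<dots> = (\<Sum>b\<in>unflat ` B. c (flat b) * b v)" by (simp add: sum.reindex[OF inj])
      finally show ?case .
    qed
    then show "\<exists>c. AE v in lborel. f v = (\<Sum>b\<in>unflat ` B. c b * b v)" by (intro exI[of _ "\<lambda>b. c (flat b)"])
  qed (use B in simp)
qed

section \<open>The spectrum of the Boltzmann operator\<close>

definition E :: "real set" where
  "E = {x. - \<sigma> u1 < x \<and> K.eigenvalue (complex_of_real x)}"

lemma E_props: "E \<subseteq> {- \<sigma> u1<..0}" "0 \<in> E" "- \<sigma> u1 < y \<Longrightarrow> \<not> y islimpt E"
proof -
  show "E \<subseteq> {- \<sigma> u1<..0}" using K.eigenvalue_nonpos by (auto simp: E_def)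
  show "0 \<in> E" using K.\<phi>_eigenfunction(3) K.\<nu>_pos by (simp add: E_def)
  assume "- \<sigma> u1 < y"
  then have "\<not> y islimpt {x. K.eigenvalue (complex_of_real x)}" by (rule K.eigenvalues_no_limit_point)
  then show "\<not> y islimpt E" using islimpt_subset[of y E "{x. K.eigenvalue (complex_of_real x)}"] by (auto simp: E_def)
qed

lemma spec_eq: "spec m m1 eps u1 th1 = complex_of_real ` ({..- \<sigma> u1} \<union> E)"
proof (rule set_eqI)
  fix z
  have "z \<in> spec m m1 eps u1 th1 \<longleftrightarrow> z \<in> complex_of_real ` {..- \<sigma> u1} \<or> K.eigenvalue z"
    unfolding spec_def Compl_iff resolvent_iff by (rule K.not_regular_iff)
  also have "\<dots> \<longleftrightarrow> z \<in> complex_of_real ` ({..- \<sigma> u1} \<union> E)"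
  proof
    assume "z \<in> complex_of_real ` {..- \<sigma> u1} \<or> K.eigenvalue z"
    then show "z \<in> complex_of_real ` ({..- \<sigma> u1} \<union> E)"
    proof
      assume ev: "K.eigenvalue z"
      have z: "z = complex_of_real (Re z)" using K.eigenvalue_real[OF ev] by (simp add: complex_eq_iff)
      have "Re z \<in> {..- \<sigma> u1} \<union> E" using ev z by (auto simp: E_def not_less)
      then show ?thesis using z by blast
    qed auto
  qed (auto simp: E_def)
  finally show "z \<in> spec m m1 eps u1 th1 \<longleftrightarrow> z \<in> complex_of_real ` ({..- \<sigma> u1} \<union> E)" .
qed

lemma isolated:
  assumes x: "x \<in> E" shows "isolated_in_spec m m1 eps u1 th1 (complex_of_real x)"
proof -
  have lx: "- \<sigma> u1 < x" using x by (simp add: E_def)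
  obtain e where e: "e > 0" "\<And>y. y \<in> E \<Longrightarrow> dist y x < e \<Longrightarrow> y = x"
    using E_props(3)[OF lx] unfolding islimpt_approachable by blast
  show ?thesis unfolding isolated_in_spec_def
  \<comment> \<open>The second entry of the minimum is the distance from \<open>x\<close> to the
    half line; \<open>e\<close> separates \<open>x\<close> from the other eigenvalues.\<close>
  proof (intro conjI exI[of _ "min e (x + \<sigma> u1)"] ballI impI)
    show "complex_of_real x \<in> spec m m1 eps u1 th1" using x by (simp add: spec_eq)
    show "0 < min e (x + \<sigma> u1)" using e lx by simp
    fix w assume "w \<in> spec m m1 eps u1 th1" and d: "cmod (w - complex_of_real x) < min e (x + \<sigma> u1)"
    then obtain y where y: "w = complex_of_real y" "y \<le> - \<sigma> u1 \<or> y \<in> E" by (auto simp: spec_eq)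
    have "\<bar>y - x\<bar> < min e (x + \<sigma> u1)" using d unfolding y of_real_diff[symmetric] norm_of_real .
    then show "w = complex_of_real x" using y e(2)[of y] by (auto simp: dist_real_def)
  qed
qed

lemma MM:
  defines "MM \<equiv> (\<lambda>v. complex_of_real (Maxw m m1 eps u1 th1 v))"
  shows "inD' MM" "Lop' MM v = 0" "flat MM = (\<lambda>v. complex_of_real (\<phi> v))"
proof -
  show f: "flat MM = (\<lambda>v. complex_of_real (\<phi> v))"
    using \<phi>_pos by (auto simp: flat_def MM_def Maxw_eq_\<phi> power2_eq_square less_le)
  show "inD' MM" unfolding inD_iff f using K.\<phi>_eigenfunction(2) by (simp add: K.eigenfunction_def)
  have "flat (Lop' MM) v = 0" unfolding flat_Lop f by (rule K.\<phi>_eigenfunction(1))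
  then show "Lop' MM v = 0" using \<phi>_pos[of v] by (simp add: flat_def)
qed

text \<open>Formulated for generalised eigenvectors, so that simplicity is algebraic and not merely
  geometric.\<close>

lemma simple_0:
  assumes "gen_eigvec m m1 eps u1 th1 0 f"
  shows "\<exists>c. AE v in lborel. f v = c * complex_of_real (Maxw m m1 eps u1 th1 v)"
proof -
  have "K.eigenfunction 0 (flat f)" using gen_eigvec_eigenfunction[of 0 f] assms by simp
  then obtain c where c: "AE v in lborel. flat f v = c * complex_of_real (\<phi> v)" by (rule K.eigenfunction_0)
  have "AE v in lborel. f v = c * complex_of_real (Maxw m m1 eps u1 th1 v)"
    using c
  proof eventually_elim
    case (elim v)
    then show ?case using \<phi>_pos[of v] by (simp add: flat_def Maxw_eq_\<phi> power2_eq_square field_simps)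
  qed
  then show ?thesis ..
qed

end

theorem theorem3p5:
  fixes m m1 eps th1 :: real and u1 :: "real^3"
  assumes "m > 0" and "m1 > 0" and "0 < eps" and "eps < 1" and "th1 > 0"
  defines "\<nu>0 \<equiv> Inf (range (coll_freq m1 u1 th1))"
  defines "MM \<equiv> (\<lambda>v. complex_of_real (Maxw m m1 eps u1 th1 v))"
  shows "\<nu>0 = coll_freq m1 u1 th1 u1 \<and> \<nu>0 > 0 \<and>
    (\<exists>(I :: nat set) (lam :: nat \<Rightarrow> real).
       0 \<in> I \<and> (\<forall>n\<in>I. \<forall>k\<le>n. k \<in> I) \<and> lam 0 = 0 \<and>
       (\<forall>n\<in>I. \<forall>k\<in>I. n < k \<longrightarrow> lam k < lam n) \<and>
       (\<forall>n\<in>I. - \<nu>0 < lam n \<and> lam n \<le> 0 \<and>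
          is_eigenvalue m m1 eps u1 th1 (complex_of_real (lam n)) \<and>
          isolated_in_spec m m1 eps u1 th1 (complex_of_real (lam n)) \<and>
          finite_alg_mult m m1 eps u1 th1 (complex_of_real (lam n))) \<and>
       (\<forall>x. x islimpt (lam ` I) \<longrightarrow> x = - \<nu>0) \<and>
       spec m m1 eps u1 th1 = complex_of_real ` ({..- \<nu>0} \<union> lam ` I)) \<and>
    is_eigenvalue m m1 eps u1 th1 0 \<and>
    inD m m1 eps u1 th1 MM \<and> (AE v in lborel. Lop m m1 eps u1 th1 MM v = 0) \<and>
    (\<forall>f. gen_eigvec m m1 eps u1 th1 0 f \<longrightarrow> (\<exists>c. AE v in lborel. f v = c * MM v))"
proof -
  interpret boltzmann m m1 eps th1 u1 by (rule boltzmann.intro) (fact assms)+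
  have \<nu>: "\<nu>0 = coll_freq m1 u1 th1 u1"
    unfolding \<nu>0_def range_coll_freq[OF m1 th1] by simp
  have \<nu>\<sigma>: "\<sigma> u1 = \<nu>0" by (simp add: \<nu> \<sigma>_def)
  note E = E_props[unfolded \<nu>\<sigma>]
  have E3: "\<forall>y>- \<nu>0. \<not> y islimpt E" using E(3) by blast
  obtain I :: "nat set" and lam :: "nat \<Rightarrow> real" where I: "0 \<in> I" "\<forall>n\<in>I. \<forall>k\<le>n. k \<in> I" "lam 0 = 0"
    "\<forall>n\<in>I. \<forall>k\<in>I. n < k \<longrightarrow> lam k < lam n" "lam ` I = E"
    using decreasing_enumeration[OF E(1,2) E3] by (elim exE conjE) (rule that)
  have lamE: "lam n \<in> E" if "n \<in> I" for n using that I(5) by blast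
  \<comment> \<open>Limit points of the eigenvalues cannot leave the closed half line from
    \<open>- \<nu>0\<close> upwards, and those strictly above \<open>- \<nu>0\<close> are
    excluded.\<close>
  have lim: "x = - \<nu>0" if "x islimpt (lam ` I)" for x
  proof -
    have "x islimpt {- \<nu>0..}" using E(1) I(5) by (intro islimpt_subset[OF that]) auto
    then have "- \<nu>0 \<le> x" using closed_limpt[of "{- \<nu>0..}"] by auto
    moreover have "\<not> - \<nu>0 < x" using E(3)[of x] that I(5) by auto
    ultimately show ?thesis by simp
  qed
  show ?thesis
  proof (intro conjI exI[of _ I] exI[of _ lam] ballI allI impI)
    show "\<nu>0 > 0" using K.\<nu>_pos by (simp add: \<nu>\<sigma>)
    show "spec m m1 eps u1 th1 = complex_of_real ` ({..- \<nu>0} \<union> lam ` I)" by (simp add: spec_eq I(5) \<nu>\<sigma>)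
    show "is_eigenvalue m m1 eps u1 th1 0" by (simp add: is_eigenvalue_iff K.\<phi>_eigenfunction(3))
    fix n assume n: "n \<in> I"
    show "- \<nu>0 < lam n" "lam n \<le> 0" using lamE[OF n] E(1) by auto
    show "is_eigenvalue m m1 eps u1 th1 (complex_of_real (lam n))"
      using lamE[OF n] by (simp add: is_eigenvalue_iff E_def)
    show "isolated_in_spec m m1 eps u1 th1 (complex_of_real (lam n))" by (rule isolated[OF lamE[OF n]])
    show "finite_alg_mult m m1 eps u1 th1 (complex_of_real (lam n))"
      using lamE[OF n] by (intro finite_alg_mult) (simp add: E_def)
  qed (use \<nu> I lim MM simple_0 in \<open>auto simp: MM_def\<close>)
qed

end
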